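(* Let $\alpha\in(0,2)$, let $X=(x_{ij})$ be the $N\times n$ heavy-tailed random matrix described in the context, with tail exponent $\alpha$, and suppose that $x_{11}$ is symmetrically distributed. Let $\mathfrak b\in(0,1/2)$ be a constant and let $k=k(n)$ satisfy $k=O(n^{1-2\mathfrak b})$. Let $\mathfrak u^{(k)}$ be the unit right singular vector of $X$ corresponding to its $k$-th smallest singular value. Then for any arbitrarily small $\delta>0$ there is a (random, depending on $\mathfrak u^{(k)}$) subset $\hat J_k\subset[n]$ such that $|\hat J_k|=n-o(n)$ but $\|\mathfrak u^{(k)}_{\hat J_k}\|_2<\sqrt\delta$ with high probability.
   Context: Model: $\mathsf a>1$ is a constant, $N=\lceil \mathsf a n\rceil$, and $X=(x_{ij})$ is an $N\times n$ real random matrix with i.i.d. entries whose law does not depend on $n$ and satisfies, for some constants $\alpha,C_\ell,C_u,T_0>0$, $C_\ell t^{-\alpha}\le \mathbb P\{|x_{11}|>t\}\le C_u t^{-\alpha}$ for all $t\ge T_0$. "Symmetrically distributed" means $x_{11}$ and $-x_{11}$ have the same law. Notation: $[n]=\{1,\dots,n\}$; for $x\in\mathbb R^n$ and $I\subseteq[n]$, $x_I\in\mathbb R^{|I|}$ is obtained by deleting the components with indices in $I^c$; unit vectors are with respect to $\|\cdot\|_2$. Asymptotics are as $n\to\infty$ with $\mathsf a$ and the law of $x_{11}$ fixed; "with high probability" means with probability tending to $1$ as $n\to\infty$. *)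

theory Defs
  imports
    "HOL-Probability.Probability"
    "HOL-Library.Landau_Symbols"
    "Jordan_Normal_Form.Char_Poly"
    "Jordan_Normal_Form.DL_Submatrix"
begin

unbundle no vec_syntax
unbundle no inner_syntax

definition l2_norm_vec :: "real vec \<Rightarrow> real" where
  "l2_norm_vec v = sqrt (v \<bullet> v)"

text \<open>
  The vector \<open>x\<^sub>I\<close>, in dimension \<open>|I|\<close> for \<open>I\<close> a set of valid indices; the analogue for vectors of
  \<^const>\<open>submatrix\<close>. Coordinates are numbered \<open>0, \<dots>, n - 1\<close>, so \<open>[n]\<close> becomes \<open>{..<n}\<close>.
\<close>
definition subvec :: "'a vec \<Rightarrow> nat set \<Rightarrow> 'a vec" where
  "subvec v I = vec (card {i. i < dim_vec v \<and> i \<in> I}) (\<lambda>i. v $ pick I i)"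

text \<open>
  For an \<open>N \<times> n\<close> matrix with \<open>N \<ge> n\<close>: its \<open>n\<close> singular values, repeated according to multiplicity, in
  ascending order. All roots of the characteristic polynomial are real and nonnegative here,
  \<open>A\<^sup>T A\<close> being symmetric and positive semidefinite.
\<close>
definition singular_values :: "real mat \<Rightarrow> real list" where
  "singular_values A =
     sorted_list_of_multiset (image_mset sqrt (proots (char_poly (transpose_mat A * A))))"

text \<open>The positions in the list count from \<open>0\<close>, while the \<open>k\<close>-th smallest value counts from \<open>1\<close>.\<close>
definition kth_smallest_singular_value :: "real mat \<Rightarrow> nat \<Rightarrow> real" where
  "kth_smallest_singular_value A k = singular_values A ! (k - 1)"

definition unit_right_singular_vector :: "real mat \<Rightarrow> real \<Rightarrow> real vec \<Rightarrow> bool" where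
  "unit_right_singular_vector A s v \<longleftrightarrow>
     v \<in> carrier_vec (dim_col A) \<and> l2_norm_vec v = 1 \<and>
     (\<exists>w \<in> carrier_vec (dim_row A). l2_norm_vec w = 1 \<and>
        A *\<^sub>v v = s \<cdot>\<^sub>v w \<and> transpose_mat A *\<^sub>v w = s \<cdot>\<^sub>v v)"

definition heavy_tailed_law :: "real \<Rightarrow> real measure \<Rightarrow> bool" where
  "heavy_tailed_law \<alpha> D \<longleftrightarrow>
     prob_space D \<and> sets D = sets borel \<and> \<alpha> > 0 \<and>
     (\<exists>C\<^sub>l > 0. \<exists>C\<^sub>u > 0. \<exists>T\<^sub>0 > 0. \<forall>t \<ge> T\<^sub>0.
        C\<^sub>l * t powr (- \<alpha>) \<le> measure D {x. \<bar>x\<bar> > t} \<and>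
        measure D {x. \<bar>x\<bar> > t} \<le> C\<^sub>u * t powr (- \<alpha>))"

definition symmetric_law :: "real measure \<Rightarrow> bool" where
  "symmetric_law D \<longleftrightarrow> distr D borel uminus = distr D borel (\<lambda>x. x)"

definition iid_random_matrix ::
    "'w measure \<Rightarrow> real measure \<Rightarrow> nat \<Rightarrow> nat \<Rightarrow> ('w \<Rightarrow> real mat) \<Rightarrow> bool" where
  "iid_random_matrix M D N n X \<longleftrightarrow>
     prob_space M \<and>
     (\<forall>\<omega> \<in> space M. X \<omega> \<in> carrier_mat N n) \<and>
     prob_space.indep_vars M (\<lambda>_. borel) (\<lambda>ij \<omega>. X \<omega> $$ ij) ({..<N} \<times> {..<n}) \<and>
     (\<forall>i < N. \<forall>j < n. distr M borel (\<lambda>\<omega>. X \<omega> $$ (i, j)) = D)"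

text \<open>Measurability is imposed coordinatewise, since \<^typ>\<open>real vec\<close> carries no \<open>\<sigma>\<close>-algebra.\<close>
definition random_vec :: "'w measure \<Rightarrow> nat \<Rightarrow> ('w \<Rightarrow> real vec) \<Rightarrow> bool" where
  "random_vec M n u \<longleftrightarrow>
     (\<forall>\<omega> \<in> space M. u \<omega> \<in> carrier_vec n) \<and>
     (\<forall>j < n. (\<lambda>\<omega>. u \<omega> $ j) \<in> borel_measurable M)"

end

theory Submission
  imports Defs "Jordan_Normal_Form.Spectral_Radius" "HOL-Real_Asymp.Real_Asymp"
begin

text \<open>
  Put \<open>b = n\<^bsup>1/\<alpha>\<^esup>\<close>. Singular vectors for small singular values are localized because
  \<open>s\<^sub>k(X)\<close> is at most \<open>c b\<close> for every \<open>c > 0\<close>, while \<open>\<parallel>X v\<parallel>\<close> is at least \<open>c b\<close> for some \<open>c > 0\<close>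
  uniformly over the spread unit vectors \<open>v\<close>.

  Upper bound: a positive fraction of the columns have norm at most \<open>c b\<close>; since \<open>k = o(n)\<close>, there are
  \<open>2k\<close> such columns, and a trace comparison bounds \<open>s\<^sub>k\<close>.

  Lower bound: after removing few rows of norm above \<open>L\<^bsup>1/2\<^esup> b\<close>, every spread \<open>v\<close> can be rounded to a
  lattice of mesh \<open>\<kappa> \<tau> / n\<^bsup>1/2\<^esup>\<close> at a cost controlled by the Hilbert-Schmidt norm of the remaining
  rows. The net has \<open>O(1/\<tau>)\<^sup>n\<close> points, a row is small with probability \<open>O(\<tau>)\<close> by a characteristic function
  estimate, and there are at least \<open>a n\<close> rows with \<open>a > 1\<close>, so a union bound suffices.

  The set \<open>J\<close> consists of the coordinates that are at most \<open>(\<epsilon> n)\<^bsup>-1/2\<^esup>\<close> in absolute value, with \<open>\<epsilon>\<close> tending to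
  \<open>0\<close> slowly.
\<close>

subsection \<open>Real symmetric matrices and singular values\<close>

text \<open>A net argument usually pays the operator norm of \<open>X\<close> times the mesh. That
  norm is useless here: the largest entry alone has order n^(2/\<alpha>), far above
  \<open>b\<close>. Most rows, however, have norm of order \<open>b\<close>, so a rounding that pays
  the Hilbert-Schmidt norm of these rows costs no more than a typical row allows. The decisive point
  is scaling. With \<open>v\<close> stretched to norm sqrt n and mesh \<kappa> \<tau>, rounding
  spoils a fraction of the rows governed by a L \<kappa>^2, in which \<tau> does not occur. Hence
  the order of choice: \<theta> = (a - 1) / 4, then \<open>L\<close>, then \<kappa>, then \<tau>,
  and finally \<open>c\<close> proportional to \<tau>. Giving up \<theta> n long rows and \<theta> n
  spoiled rows out of (1 + 4\<theta>) n leaves (1 + 2\<theta>) n, so the union bound is of the form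
  (const * \<tau>^(2\<theta>))^n with a constant free of \<tau>. The upper bound holds for every c >
  0 because squared entries have tail index \<alpha>/2 < 1: a sum of about n of them falls below any
  fixed multiple of b^2 with probability bounded away from 0.\<close>

text \<open>Take a complex eigenvector x + i y with eigenvalue \<open>z\<close>. Symmetry, in the
  form x . G y = G x . y, forces Im z (|x|^2 + |y|^2) = 0. Then \<open>x\<close> and
  \<open>y\<close> both satisfy the eigenvalue equation for \<open>Re z\<close>, and one of them is
  nonzero and can be normalized.\<close>

lemma real_symmetric_eigenvector:
  fixes G :: "real mat"
  assumes G: "G \<in> carrier_mat n n" and sym: "transpose_mat G = G" and n: "n > 0"
  obtains v e where "v \<in> carrier_vec n" "v \<bullet> v = 1" "G *\<^sub>v v = e \<cdot>\<^sub>v v"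
proof -
  let ?C = "map_mat complex_of_real G"
  have C: "?C \<in> carrier_mat n n" using G by simp
  from spectrum_non_empty[OF C] n obtain z where "z \<in> spectrum ?C" by auto
  then obtain v where v: "v \<in> carrier_vec n" "v \<noteq> 0\<^sub>v n" and ev: "?C *\<^sub>v v = z \<cdot>\<^sub>v v"
    using C unfolding spectrum_def eigenvalue_def eigenvector_def by auto
  define x where "x = map_vec Re v"
  define y where "y = map_vec Im v"
  have xy: "x \<in> carrier_vec n" "y \<in> carrier_vec n" using v by (auto simp: x_def y_def)
  have comp: "(\<Sum>j<n. complex_of_real (G $$ (i,j)) * v $ j) = z * v $ i" if "i < n" for i
    using arg_cong[OF ev, of "\<lambda>w. w $ i"] that G v
    by (simp add: scalar_prod_def atLeast0LessThan)
  have Gx: "G *\<^sub>v x = Re z \<cdot>\<^sub>v x - Im z \<cdot>\<^sub>v y"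
  proof (rule eq_vecI)
    fix i assume "i < dim_vec (Re z \<cdot>\<^sub>v x - Im z \<cdot>\<^sub>v y)"
    hence i: "i < n" using xy by simp
    from arg_cong[OF comp[OF i], of Re] show "(G *\<^sub>v x) $ i = (Re z \<cdot>\<^sub>v x - Im z \<cdot>\<^sub>v y) $ i"
      using i G v xy by (simp add: scalar_prod_def atLeast0LessThan x_def y_def)
  qed (use G xy in auto)
  have Gy: "G *\<^sub>v y = Im z \<cdot>\<^sub>v x + Re z \<cdot>\<^sub>v y"
  proof (rule eq_vecI)
    fix i assume "i < dim_vec (Im z \<cdot>\<^sub>v x + Re z \<cdot>\<^sub>v y)"
    hence i: "i < n" using xy by simp
    from arg_cong[OF comp[OF i], of Im] show "(G *\<^sub>v y) $ i = (Im z \<cdot>\<^sub>v x + Re z \<cdot>\<^sub>v y) $ i"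
      using i G v xy by (simp add: scalar_prod_def atLeast0LessThan x_def y_def)
  qed (use G xy in auto)
  have "x \<bullet> (G *\<^sub>v y) = (G *\<^sub>v x) \<bullet> y"
    using transpose_vec_mult_scalar[OF G xy(2) xy(1)] sym
    by (metis G comm_scalar_prod mult_mat_vec_carrier xy)
  hence "Im z * (x \<bullet> x + y \<bullet> y) = 0"
    using xy unfolding Gx Gy
    by (simp add: scalar_prod_add_distrib[of _ n] minus_scalar_prod_distrib[of _ n]
        comm_scalar_prod[of y n x] algebra_simps)
  moreover have nn: "x \<bullet> x \<ge> 0" "y \<bullet> y \<ge> 0" by (auto simp: scalar_prod_def sum_nonneg)
  moreover have ne: "x \<bullet> x + y \<bullet> y \<noteq> 0"
  proof
    assume "x \<bullet> x + y \<bullet> y = 0"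
    hence "x \<bullet> x = 0" "y \<bullet> y = 0" using nn by auto
    hence "v = 0\<^sub>v n" using v xy
      by (auto simp: scalar_prod_def sum_nonneg_eq_0_iff x_def y_def complex_eq_iff intro!: eq_vecI)
    with v show False by simp
  qed
  ultimately have z: "Im z = 0" by simp
  note main = that
  have key: thesis if w: "w \<in> carrier_vec n" "G *\<^sub>v w = Re z \<cdot>\<^sub>v w" "w \<bullet> w > 0" for w
  proof (rule main[of "(1 / sqrt (w \<bullet> w)) \<cdot>\<^sub>v w" "Re z"])
    show "((1 / sqrt (w \<bullet> w)) \<cdot>\<^sub>v w) \<bullet> ((1 / sqrt (w \<bullet> w)) \<cdot>\<^sub>v w) = 1"
      using w by (simp add: field_simps flip: real_sqrt_mult)
    show "G *\<^sub>v ((1 / sqrt (w \<bullet> w)) \<cdot>\<^sub>v w) = Re z \<cdot>\<^sub>v ((1 / sqrt (w \<bullet> w)) \<cdot>\<^sub>v w)"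
      using w G by (simp add: mult_mat_vec[of _ n n] smult_smult_assoc mult.commute)
  qed (use w in auto)
  show thesis
  proof (cases "x \<bullet> x > 0")
    case True
    show ?thesis by (rule key[OF xy(1) _ True]) (use Gx z xy in auto)
  next
    case False
    with nn ne have "y \<bullet> y > 0" by linarith
    show ?thesis by (rule key[OF xy(2) _ \<open>y \<bullet> y > 0\<close>]) (use Gy z xy in auto)
  qed
qed

text \<open>The reflection along w = v - e_0, that is 1 - 2 w w^T / (w . w), swaps the unit vectors
  \<open>v\<close> and e_0. It extends \<open>v\<close> to an orthonormal basis without a
  Gram-Schmidt process.\<close>

lemma householder_reflection:
  fixes v :: "real vec"
  assumes v: "v \<in> carrier_vec (Suc m)" "v \<bullet> v = 1"
  obtains H :: "real mat" where "H \<in> carrier_mat (Suc m) (Suc m)" "transpose_mat H = H"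
    "H * H = 1\<^sub>m (Suc m)" "col H 0 = v"
proof -
  let ?n = "Suc m"
  define w where "w = v - unit_vec ?n 0"
  \<comment> \<open>If \<open>w = 0\<close>, then \<open>c = 0\<close> by the convention \<open>x / 0 = 0\<close>, and \<open>H\<close> is the identity.\<close>
  define c where "c = 2 / (w \<bullet> w)"
  define H where "H = mat ?n ?n (\<lambda>(i,j). (if i = j then 1 else 0) - c * w $ i * w $ j)"
  have w: "w \<in> carrier_vec ?n" using v by (simp add: w_def)
  have ww: "(\<Sum>k<?n. w $ k * w $ k) = w \<bullet> w"
    using w by (simp add: scalar_prod_def atLeast0LessThan)
  have c2: "c * c * (w \<bullet> w) = 2 * c" by (simp add: c_def)
  have HH: "H * H = 1\<^sub>m ?n"
  proof (rule eq_matI)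
    fix i j assume ij: "i < dim_row (1\<^sub>m ?n :: real mat)" "j < dim_col (1\<^sub>m ?n :: real mat)"
    have "(H * H) $$ (i,j) = (\<Sum>k<?n. ((if i = k then 1 else 0) - c * w $ i * w $ k) *
        ((if k = j then 1 else 0) - c * w $ k * w $ j))"
      using ij by (simp add: H_def scalar_prod_def atLeast0LessThan del: sum.lessThan_Suc)
    also have "\<dots> = (\<Sum>k<?n. (if k = i then if i = j then 1 else 0 else 0)
        - (if k = i then c * w $ i * w $ j else 0) - (if k = j then c * w $ i * w $ j else 0)
        + (c * c * w $ i * w $ j) * (w $ k * w $ k))"
      by (rule sum.cong) (auto simp: algebra_simps)
    also have "\<dots> = (if i = j then 1 else 0) - c * w $ i * w $ j - c * w $ i * w $ j
        + (c * c * w $ i * w $ j) * (w \<bullet> w)"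
      using ij by (simp add: sum.distrib sum_subtractf ww flip: sum_distrib_left del: sum.lessThan_Suc)
    also have "\<dots> = (if i = j then 1 else 0) + w $ i * w $ j * (c * c * (w \<bullet> w) - 2 * c)"
      by (simp add: algebra_simps)
    also have "\<dots> = 1\<^sub>m ?n $$ (i,j)" using ij c2 by simp
    finally show "(H * H) $$ (i,j) = 1\<^sub>m ?n $$ (i,j)" .
  qed (auto simp: H_def)
  have vv: "v $ 0 * v $ 0 + (\<Sum>k<m. v $ Suc k * v $ Suc k) = 1"
    using v by (simp add: scalar_prod_def atLeast0LessThan sum.lessThan_Suc_shift del: sum.lessThan_Suc)
  have wv: "w $ 0 = v $ 0 - 1" "\<And>k. k < m \<Longrightarrow> w $ Suc k = v $ Suc k"
    using v by (auto simp: w_def)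
  have wd: "w \<bullet> w = 2 - 2 * v $ 0"
  proof -
    have "w $ 0 * w $ 0 = v $ 0 * v $ 0 - 2 * v $ 0 + 1" by (simp add: wv(1) algebra_simps)
    thus ?thesis using vv wv(2) unfolding ww[symmetric] sum.lessThan_Suc_shift by simp
  qed
  have col: "col H 0 = v"
  proof (cases "v $ 0 = 1")
    case True
    hence "\<forall>k<m. v $ Suc k = 0" using vv by (simp add: sum_nonneg_eq_0_iff)
    hence "w $ i = 0" if "i < ?n" for i using that wv True by (cases i) auto
    hence w0: "w = 0\<^sub>v ?n" using w by (intro eq_vecI) auto
    have "v = unit_vec ?n 0 + w" using v w by (intro eq_vecI) (auto simp: w_def)
    hence "v = unit_vec ?n 0" using w0 by simp
    thus ?thesis using w0 by (intro eq_vecI) (auto simp: H_def)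
  next
    case False
    \<comment> \<open>Here w_0 = v_0 - 1 is minus half of \<open>w \<bullet> w\<close>.\<close>
    hence "c * w $ 0 = - 1" using wd by (simp add: c_def wv field_simps)
    hence c1: "c * x * w $ 0 = - x" for x by (metis mult.commute mult.assoc mult_minus1_right)
    show ?thesis
    proof (rule eq_vecI)
      fix i assume "i < dim_vec v"
      hence i: "i < ?n" using v by simp
      hence "w $ i = v $ i - (if i = 0 then 1 else 0)" using v by (simp add: w_def)
      moreover have "col H 0 $ i = (if i = 0 then 1 else 0) - c * w $ i * w $ 0"
        using i by (simp add: H_def)
      ultimately show "col H 0 $ i = v $ i" unfolding c1 by simp
    qed (use v in \<open>simp add: H_def\<close>)
  qed
  show thesis
    by (rule that[OF _ _ HH col]) (auto simp: H_def intro!: eq_matI)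
qed

text \<open>Deflation: conjugating by a reflection whose first column is an eigenvector clears the
  first column off the diagonal, and symmetry then clears the first row. The induction hypothesis
  diagonalizes the remaining block.\<close>

lemma real_symmetric_diagonalization:
  fixes G :: "real mat"
  assumes "G \<in> carrier_mat n n" "transpose_mat G = G"
  shows "\<exists>Q B. Q \<in> carrier_mat n n \<and> B \<in> carrier_mat n n \<and> transpose_mat Q * Q = 1\<^sub>m n \<and>
    Q * transpose_mat Q = 1\<^sub>m n \<and> diagonal_mat B \<and> G = Q * B * transpose_mat Q"
  using assms
proof (induction n arbitrary: G)
  case 0
  have "G = 1\<^sub>m 0 * G * transpose_mat (1\<^sub>m 0)"
    using 0(1) by (simp only: left_mult_one_mat right_mult_one_mat transpose_one)
  moreover have "diagonal_mat G" using 0(1) by (simp add: diagonal_mat_def)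
  ultimately show ?case
    using 0(1) one_carrier_mat[of 0] transpose_one[of 0] left_mult_one_mat[of "1\<^sub>m 0"] by metis
next
  case (Suc m G)
  let ?n = "Suc m"
  note G = Suc.prems(1) and sym = Suc.prems(2)
  obtain v e where v: "v \<in> carrier_vec ?n" "v \<bullet> v = 1" and ev: "G *\<^sub>v v = e \<cdot>\<^sub>v v"
    using real_symmetric_eigenvector[OF G sym zero_less_Suc] by blast
  obtain H where H: "H \<in> carrier_mat ?n ?n" and HT: "transpose_mat H = H" and HH: "H * H = 1\<^sub>m ?n"
    and c: "col H 0 = v"
    using householder_reflection[OF v] by blast
  define F where "F = H * G * H"
  have F: "F \<in> carrier_mat ?n ?n" using H G by (simp add: F_def)
  have HG: "H * G \<in> carrier_mat ?n ?n" using H G by simp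
  have FT: "transpose_mat F = F"
    unfolding F_def transpose_mult[OF HG H] transpose_mult[OF H G] HT sym
    by (rule assoc_mult_mat[OF H G H, symmetric])
  have GF: "G = H * F * H"
  proof -
    have "H * F = H * H * (G * H)"
      unfolding F_def assoc_mult_mat[OF H G H] by (rule assoc_mult_mat[symmetric]) (use H G in auto)
    hence "H * F = G * H" using H G by (simp add: HH)
    hence "H * F * H = G * (H * H)" by (simp only: assoc_mult_mat[OF G H H])
    thus ?thesis using G by (simp add: HH)
  qed
  have "col F 0 = e \<cdot>\<^sub>v unit_vec ?n 0"
  proof -
    have Hv: "H *\<^sub>v v = unit_vec ?n 0"
    proof -
      have "H *\<^sub>v v = col (H * H) 0" by (subst col_mult2[OF H H]) (auto simp: c)
      thus ?thesis by (simp add: HH)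
    qed
    have "col F 0 = (H * G) *\<^sub>v v" unfolding F_def by (subst col_mult2[OF HG H]) (auto simp: c)
    also have "\<dots> = H *\<^sub>v (e \<cdot>\<^sub>v v)" unfolding assoc_mult_mat_vec[OF H G v(1)] ev by (rule refl)
    also have "\<dots> = e \<cdot>\<^sub>v unit_vec ?n 0" unfolding mult_mat_vec[OF H v(1)] Hv by (rule refl)
    finally show ?thesis .
  qed
  hence col0: "F $$ (i,0) = (if i = 0 then e else 0)" if "i < ?n" for i
    using that F by (auto simp: col_def vec_eq_iff)
  have row0: "F $$ (0,i) = (if i = 0 then e else 0)" if "i < ?n" for i
    using arg_cong[OF FT, of "\<lambda>M. M $$ (0,i)"] that F col0[of i] by simp
  define F3 where "F3 = mat m m (\<lambda>(i,j). F $$ (Suc i, Suc j))"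
  have F3: "F3 \<in> carrier_mat m m" by (simp add: F3_def)
  have "transpose_mat F3 = F3"
  proof (rule eq_matI)
    fix i j assume "i < dim_row F3" "j < dim_col F3"
    thus "transpose_mat F3 $$ (i,j) = F3 $$ (i,j)"
      using arg_cong[OF FT, of "\<lambda>M. M $$ (Suc i, Suc j)"] F by (simp add: F3_def)
  qed (auto simp: F3_def)
  from Suc.IH[OF F3 this] obtain Q B where
    Q: "Q \<in> carrier_mat m m" and B: "B \<in> carrier_mat m m" and QTQ: "transpose_mat Q * Q = 1\<^sub>m m"
    and QQT: "Q * transpose_mat Q = 1\<^sub>m m" and dB: "diagonal_mat B"
    and F3Q: "F3 = Q * B * transpose_mat Q" by blast
  let ?blk = "\<lambda>x A. four_block_mat (mat 1 1 (\<lambda>_. x)) (0\<^sub>m 1 m) (0\<^sub>m m 1) (A :: real mat)"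
  have blk_mult: "?blk x A * ?blk y A' = ?blk (x * y) (A * A')"
    if "A \<in> carrier_mat m m" "A' \<in> carrier_mat m m" for x y A A'
  proof -
    have "mat 1 1 (\<lambda>_. x) * mat 1 1 (\<lambda>_. y) = mat 1 1 (\<lambda>_. x * y)"
      by (intro eq_matI) (auto simp: scalar_prod_def)
    thus ?thesis using that
      by (subst mult_four_block_mat[of _ 1 1 _ m _ m _ _ 1 _ m]) simp_all
  qed
  have blk_T: "transpose_mat (?blk x A) = ?blk x (transpose_mat A)" if "A \<in> carrier_mat m m" for x A
  proof -
    have "transpose_mat (mat 1 1 (\<lambda>_. x)) = mat 1 1 (\<lambda>_. x)" by (intro eq_matI) auto
    thus ?thesis using that
      by (subst transpose_four_block_mat[of _ 1 1 _ m _ m]) simp_all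
  qed
  have blk_1: "?blk 1 (1\<^sub>m m) = 1\<^sub>m ?n"
  proof (rule eq_matI)
    fix i j assume "i < dim_row (1\<^sub>m ?n :: real mat)" "j < dim_col (1\<^sub>m ?n :: real mat)"
    thus "?blk 1 (1\<^sub>m m) $$ (i,j) = 1\<^sub>m ?n $$ (i,j)" by (cases i; cases j) simp_all
  qed simp_all
  have blk_car: "?blk x A \<in> carrier_mat ?n ?n" if "A \<in> carrier_mat m m" for x A
    using four_block_carrier_mat[of "mat 1 1 (\<lambda>_. x)" 1 1 A m m "0\<^sub>m 1 m" "0\<^sub>m m 1"] that by simp
  have FB: "F = ?blk e F3"
  proof (rule eq_matI)
    fix i j assume "i < dim_row (?blk e F3)" "j < dim_col (?blk e F3)"
    hence "i < ?n" "j < ?n" by (auto simp: F3_def)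
    thus "F $$ (i,j) = ?blk e F3 $$ (i,j)"
      using col0[of i] row0[of j] by (cases i; cases j) (auto simp: F3_def)
  qed (use F in \<open>auto simp: F3_def\<close>)
  define P where "P = H * ?blk 1 Q"
  have P: "P \<in> carrier_mat ?n ?n" using H blk_car[OF Q] by (simp add: P_def)
  have PT: "transpose_mat P = ?blk 1 (transpose_mat Q) * H"
    unfolding P_def transpose_mult[OF H blk_car[OF Q]] HT blk_T[OF Q] by (rule refl)
  have QT: "transpose_mat Q \<in> carrier_mat m m" using Q by simp
  have cQ: "?blk 1 Q \<in> carrier_mat ?n ?n" and cQT: "?blk 1 (transpose_mat Q) \<in> carrier_mat ?n ?n"
    and cB: "?blk e B \<in> carrier_mat ?n ?n"
    by (rule blk_car, fact)+
  have e1: "?blk 1 Q * ?blk 1 (transpose_mat Q) = 1\<^sub>m ?n"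
    using blk_mult[OF Q QT, of 1 1] by (simp only: QQT blk_1 mult_1)
  have e2: "?blk 1 (transpose_mat Q) * ?blk 1 Q = 1\<^sub>m ?n"
    using blk_mult[OF QT Q, of 1 1] by (simp only: QTQ blk_1 mult_1)
  have e3: "F = ?blk 1 Q * ?blk e B * ?blk 1 (transpose_mat Q)"
    unfolding FB F3Q using blk_mult[OF Q B, of 1 e] blk_mult[OF mult_carrier_mat[OF Q B] QT, of e 1]
    by (simp only: mult_1 mult_1_right)
  show ?case
  proof (rule exI[of _ P], rule exI[of _ "?blk e B"], intro conjI)
    have "transpose_mat P * P = ?blk 1 (transpose_mat Q) * (H * (H * ?blk 1 Q))"
      unfolding PT unfolding P_def by (rule assoc_mult_mat[OF cQT H mult_carrier_mat[OF H cQ]])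
    also have "H * (H * ?blk 1 Q) = ?blk 1 Q"
      unfolding assoc_mult_mat[OF H H cQ, symmetric] HH using cQ by (rule left_mult_one_mat)
    finally show "transpose_mat P * P = 1\<^sub>m ?n" by (simp only: e2)
    have "P * transpose_mat P = H * (?blk 1 Q * (?blk 1 (transpose_mat Q) * H))"
      unfolding PT unfolding P_def by (rule assoc_mult_mat[OF H cQ mult_carrier_mat[OF cQT H]])
    also have "?blk 1 Q * (?blk 1 (transpose_mat Q) * H) = H"
      unfolding assoc_mult_mat[OF cQ cQT H, symmetric] e1 using H by (rule left_mult_one_mat)
    finally show "P * transpose_mat P = 1\<^sub>m ?n" by (simp only: HH)
    have "P * ?blk e B * transpose_mat P = H * (?blk 1 Q * ?blk e B) * (?blk 1 (transpose_mat Q) * H)"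
      unfolding PT unfolding P_def by (simp only: assoc_mult_mat[OF H cQ cB])
    also have "\<dots> = H * (?blk 1 Q * ?blk e B) * ?blk 1 (transpose_mat Q) * H"
      by (rule assoc_mult_mat[symmetric, OF mult_carrier_mat[OF H mult_carrier_mat[OF cQ cB]] cQT H])
    also have "\<dots> = H * F * H"
      unfolding e3 by (simp only: assoc_mult_mat[OF H mult_carrier_mat[OF cQ cB] cQT])
    finally show "G = P * ?blk e B * transpose_mat P" using GF by (simp only:)
    show "diagonal_mat (?blk e B)" using dB B by (auto simp: diagonal_mat_def)
  qed (use P cB in auto)
qed

section \<open>Eigenvalue counting through a principal submatrix\<close>

lemma sorted_list_nth_le:
  fixes M :: "real multiset"
  assumes "1 \<le> k" "k \<le> size (filter_mset (\<lambda>x. x \<le> c) M)"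
  shows "sorted_list_of_multiset M ! (k - 1) \<le> c"
proof (rule ccontr)
  let ?xs = "sorted_list_of_multiset M"
  assume "\<not> ?xs ! (k - 1) \<le> c"
  hence gt: "?xs ! i > c" if "i \<ge> k - 1" "i < length ?xs" for i
    using sorted_nth_mono[OF sorted_sorted_list_of_multiset, of "k - 1" i M] that by linarith
  have "size (filter_mset (\<lambda>x. x \<le> c) M) = size (filter_mset (\<lambda>x. x \<le> c) (mset ?xs))" by simp
  also have "\<dots> = length (filter (\<lambda>x. x \<le> c) ?xs)" by (simp only: size_mset flip: mset_filter)
  also have "\<dots> = card {i. i < length ?xs \<and> ?xs ! i \<le> c}" by (rule length_filter_conv_card)
  also have "\<dots> \<le> card {..<k - 1}"
    using gt by (intro card_mono) (auto simp: not_le[symmetric])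
  finally show False using assms by simp
qed

text \<open>If the \<open>k\<close>-th singular value exceeded \<open>c\<close>, all but \<open>k - 1\<close> eigenvalues of \<open>A\<^sup>T A\<close> would exceed
  \<open>c\<^sup>2\<close>, which is incompatible with the small trace of the principal submatrix on \<open>J\<close>.\<close>
lemma kth_smallest_singular_value_bound:
  fixes A :: "real mat"
  assumes A: "A \<in> carrier_mat N n" and c: "c > 0" and k: "1 \<le> k"
    and J: "J \<subseteq> {..<n}" "2 * k \<le> card J"
    and cols: "\<And>j. j \<in> J \<Longrightarrow> (\<Sum>i<N. (A $$ (i,j))\<^sup>2) \<le> c\<^sup>2 / 2"
  shows "0 \<le> kth_smallest_singular_value A k" "kth_smallest_singular_value A k \<le> c"
proof -
  define G where "G = transpose_mat A * A"
  have G: "G \<in> carrier_mat n n" using A by (simp add: G_def)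
  have "transpose_mat G = G" using A by (simp add: G_def transpose_mult[of _ n N _ n])
  from real_symmetric_diagonalization[OF G this] obtain Q B where
    Q: "Q \<in> carrier_mat n n" and B: "B \<in> carrier_mat n n" and QTQ: "transpose_mat Q * Q = 1\<^sub>m n"
    and QQT: "Q * transpose_mat Q = 1\<^sub>m n" and dB: "diagonal_mat B"
    and GQ: "G = Q * B * transpose_mat Q" by blast
  define d where "d l = B $$ (l,l)" for l
  have Bij: "B $$ (i,j) = (if i = j then d i else 0)" if "i < n" "j < n" for i j
    using dB B that by (auto simp: diagonal_mat_def d_def)
  \<comment> \<open>\<open>singular_values\<close> is defined by roots of the characteristic
    polynomial; similarity identifies them, with multiplicity, with the diagonal of
    \<open>B\<close>.\<close>
  have sim: "similar_mat G B"
    using G B Q QTQ QQT GQ by (intro similar_matI[of _ _ Q "transpose_mat Q" n]) auto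
  have ut: "upper_triangular B" using B by (auto simp: upper_triangular_def Bij)
  have "char_poly G = (\<Prod>a\<leftarrow>diag_mat B. [:- a, 1:])"
    using char_poly_similar[OF sim] char_poly_upper_triangular[OF B ut] by simp
  also have "proots \<dots> = mset (diag_mat B)"
  proof -
    have "proots (\<Prod>a\<leftarrow>xs. [:- a, 1:]) = mset xs" for xs :: "real list"
    proof (induction xs)
      case (Cons a xs)
      have "(\<Prod>a\<leftarrow>xs. [:- a, 1:]) \<noteq> 0" by (auto simp: prod_list_zero_iff)
      with Cons show ?case
        using proots_mult[of "[:- a, 1:]" "\<Prod>a\<leftarrow>xs. [:- a, 1:]"] by (simp del: mult_pCons_left)
    qed simp
    thus ?thesis .
  qed
  finally have roots: "proots (char_poly G) = mset (map d [0..<n])"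
    using B by (simp add: diag_mat_def d_def[abs_def])
  have Gjj: "G $$ (j,j) = (\<Sum>l<n. d l * (Q $$ (j,l))\<^sup>2)" if j: "j < n" for j
  proof -
    have "G $$ (j,j) = (\<Sum>i<n. Q $$ (j,i) * (\<Sum>l<n. B $$ (i,l) * Q $$ (j,l)))"
      using j Q B by (simp add: GQ scalar_prod_def atLeast0LessThan)
    also have "\<dots> = (\<Sum>i<n. Q $$ (j,i) * (\<Sum>l<n. if l = i then d i * Q $$ (j,i) else 0))"
      by (intro sum.cong arg_cong2[where f = "(*)"]) (auto simp: Bij)
    also have "\<dots> = (\<Sum>l<n. d l * (Q $$ (j,l))\<^sup>2)"
      by (intro sum.cong) (auto simp: power2_eq_square)
    finally show ?thesis .
  qed
  have Gcol: "G $$ (j,j) = (\<Sum>i<N. (A $$ (i,j))\<^sup>2)" if "j < n" for j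
    using that A by (simp add: G_def scalar_prod_def atLeast0LessThan power2_eq_square)
  have Qcol: "(\<Sum>j<n. (Q $$ (j,l))\<^sup>2) = 1" if "l < n" for l
    using arg_cong[OF QTQ, of "\<lambda>M. M $$ (l,l)"] that Q
    by (simp add: scalar_prod_def atLeast0LessThan power2_eq_square)
  have Qrow: "(\<Sum>l<n. (Q $$ (j,l))\<^sup>2) = 1" if "j < n" for j
    using arg_cong[OF QQT, of "\<lambda>M. M $$ (j,j)"] that Q
    by (simp add: scalar_prod_def atLeast0LessThan power2_eq_square)
  \<comment> \<open>\<open>B\<close> is the Gram matrix of \<open>A * Q\<close>, so
    \<open>d l\<close> is the squared norm of a column.\<close>
  have d0: "d l \<ge> 0" if l: "l < n" for l
  proof -
    have "B = transpose_mat Q * G * Q"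
    proof -
      have "transpose_mat Q * G * Q = (transpose_mat Q * Q) * B * (transpose_mat Q * Q)"
        unfolding GQ using Q B by (simp add: assoc_mult_mat[of _ n n _ n _ n])
      thus ?thesis using B QTQ by simp
    qed
    also have "\<dots> = transpose_mat (A * Q) * (A * Q)"
      unfolding G_def using Q A
      by (simp add: transpose_mult[of _ N n _ n] assoc_mult_mat[of _ n n _ N _ n]
          assoc_mult_mat[of _ n N _ n _ n] assoc_mult_mat[of _ n n _ n _ n])
    finally have "B $$ (l,l) = (\<Sum>i<N. ((A * Q) $$ (i,l))\<^sup>2)"
      using l A Q by (simp add: scalar_prod_def atLeast0LessThan power2_eq_square)
    thus ?thesis by (simp add: d_def sum_nonneg)
  qed
  define S where "S = {l. l < n \<and> sqrt (d l) \<le> c}"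
  \<comment> \<open>\<open>s l\<close> is the share of the \<open>l\<close>-th eigenvector carried
    by the coordinates in \<open>J\<close>: a weight in [0, 1], of total \<open>card J\<close>, such
    that the trace of \<open>G\<close> over \<open>J\<close> is the sum of
    \<open>d l * s l\<close>.\<close>
  define s where "s l = (\<Sum>j\<in>J. (Q $$ (j,l))\<^sup>2)" for l
  have finJ: "finite J" using J finite_subset by blast
  have s: "0 \<le> s l" "s l \<le> 1" if "l < n" for l
  proof -
    show "0 \<le> s l" by (simp add: s_def sum_nonneg)
    have "s l \<le> (\<Sum>j<n. (Q $$ (j,l))\<^sup>2)" unfolding s_def using J by (intro sum_mono2) auto
    thus "s l \<le> 1" using Qcol[OF that] by simp
  qed
  have sum_s: "(\<Sum>l<n. s l) = card J"
  proof -
    have "(\<Sum>l<n. s l) = (\<Sum>j\<in>J. \<Sum>l<n. (Q $$ (j,l))\<^sup>2)" unfolding s_def by (rule sum.swap)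
    also have "\<dots> = (\<Sum>j\<in>J. 1)" using J Qrow by (intro sum.cong) auto
    finally show ?thesis by simp
  qed
  \<comment> \<open>Indices outside \<open>S\<close> carry weight at least
    \<open>card J - card S\<close>, with eigenvalues at least c^2, whereas the trace over
    \<open>J\<close> is at most c^2 \<open>card J\<close> / 2. So \<open>S\<close> has at least
    \<open>card J\<close> / 2 elements, and this is at least \<open>k\<close>.\<close>
  have "card S \<ge> k"
  proof (rule ccontr)
    assume "\<not> card S \<ge> k"
    hence kS: "real (card S) < real k" by simp
    have "c\<^sup>2 * (real (card J) - card S) \<le> c\<^sup>2 * ((\<Sum>l<n. s l) - (\<Sum>l\<in>S. s l))"
    proof -
      have "(\<Sum>l\<in>S. s l) \<le> (\<Sum>l\<in>S. 1)" using s by (intro sum_mono) (auto simp: S_def)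
      thus ?thesis using sum_s by (intro mult_left_mono) auto
    qed
    also have "\<dots> = (\<Sum>l\<in>{..<n} - S. c\<^sup>2 * s l)"
      by (subst sum_diff) (auto simp: S_def right_diff_distrib simp flip: sum_distrib_left)
    also have "\<dots> \<le> (\<Sum>l\<in>{..<n} - S. d l * s l)"
    proof (intro sum_mono mult_right_mono)
      fix l assume l: "l \<in> {..<n} - S"
      hence "c \<le> sqrt (d l)" by (auto simp: S_def)
      hence "c\<^sup>2 \<le> (sqrt (d l))\<^sup>2" using c by (intro power_mono) auto
      thus "c\<^sup>2 \<le> d l" using l d0 by simp
    qed (use s in auto)
    also have "\<dots> \<le> (\<Sum>l<n. d l * s l)" using d0 s by (intro sum_mono2) auto
    also have "\<dots> = (\<Sum>l<n. \<Sum>j\<in>J. d l * (Q $$ (j,l))\<^sup>2)" by (simp add: s_def sum_distrib_left)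
    also have "\<dots> = (\<Sum>j\<in>J. G $$ (j,j))"
      using J Gjj by (subst sum.swap) (auto intro!: sum.cong)
    also have "\<dots> \<le> (\<Sum>j\<in>J. c\<^sup>2 / 2)"
      using J Gcol cols by (intro sum_mono) auto
    also have "\<dots> = c\<^sup>2 * (real (card J) / 2)" by simp
    finally have "real (card J) - card S \<le> real (card J) / 2" using c by simp
    thus False using kS J(2) by linarith
  qed
  moreover have "size (filter_mset (\<lambda>x. x \<le> c) (image_mset sqrt (proots (char_poly G)))) = card S"
  proof -
    have m: "image_mset sqrt (proots (char_poly G)) = mset (map (\<lambda>l. sqrt (d l)) [0..<n])"
      unfolding roots by (simp only: mset_map[symmetric] map_map comp_def)
    have "size (filter_mset (\<lambda>x. x \<le> c) (image_mset sqrt (proots (char_poly G))))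
        = length (filter (\<lambda>x. x \<le> c) (map (\<lambda>l. sqrt (d l)) [0..<n]))"
      by (simp only: m mset_filter[symmetric] size_mset)
    also have "\<dots> = card S"
      unfolding length_filter_conv_card S_def by (intro arg_cong[where f = card]) auto
    finally show ?thesis .
  qed
  ultimately show "kth_smallest_singular_value A k \<le> c"
    unfolding kth_smallest_singular_value_def singular_values_def G_def[symmetric]
    using k by (intro sorted_list_nth_le) auto
  \<comment> \<open>The position \<open>k - 1\<close> must lie inside the list, since
    \<open>nth\<close> beyond the end is unspecified and would carry no sign.\<close>
  have "card S \<le> n" unfolding S_def using card_mono[of "{..<n}" "{l. l < n \<and> sqrt (d l) \<le> c}"] by auto
  with \<open>card S \<ge> k\<close> k have kn: "k - 1 < n" by linarith
  let ?xs = "sorted_list_of_multiset (image_mset sqrt (proots (char_poly G)))"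
  have "length ?xs = n"
    using mset_sorted_list_of_multiset[of "image_mset sqrt (proots (char_poly G))"] roots
    by (metis size_mset size_image_mset length_map length_upt minus_nat.diff_0)
  hence "?xs ! (k - 1) \<in> set ?xs" using kn by (intro nth_mem) simp
  hence "?xs ! (k - 1) \<in> sqrt ` d ` {..<n}" by (auto simp: roots)
  thus "0 \<le> kth_smallest_singular_value A k"
    unfolding kth_smallest_singular_value_def singular_values_def G_def[symmetric] using d0 by auto
qed

subsection \<open>Heavy-tailed laws\<close>

lemma heavy_tailed_law_real_distribution:
  assumes "heavy_tailed_law \<alpha> D"
  shows "real_distribution D"
proof -
  have "prob_space D" "sets D = sets borel" using assms by (auto simp: heavy_tailed_law_def)
  moreover from this(2) have "space D = UNIV" by (metis sets_eq_imp_space_eq space_borel)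
  ultimately show ?thesis by (simp add: real_distribution_def real_distribution_axioms_def)
qed

text \<open>Below the threshold \<open>T\<close> the trivial bound 1 is at most T^\<alpha>
  s^(-\<alpha>), so enlarging the constant makes the tail bound valid at every scale.\<close>

lemma heavy_tailed_law_upper:
  assumes "heavy_tailed_law \<alpha> D"
  obtains C where "C > 0" "\<And>s. s > 0 \<Longrightarrow> measure D {x. \<bar>x\<bar> > s} \<le> C * s powr (- \<alpha>)"
proof -
  interpret real_distribution D by (rule heavy_tailed_law_real_distribution[OF assms])
  from assms obtain Cu T where C: "Cu > 0" "T > 0"
    and tail: "\<And>t. t \<ge> T \<Longrightarrow> measure D {x. \<bar>x\<bar> > t} \<le> Cu * t powr (- \<alpha>)" and \<alpha>: "\<alpha> > 0"
    unfolding heavy_tailed_law_def by blast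
  show thesis
  proof (rule that[of "Cu + T powr \<alpha>"])
    show "Cu + T powr \<alpha> > 0" using C by (simp add: add_pos_nonneg)
    fix s :: real assume s: "s > 0"
    show "measure D {x. \<bar>x\<bar> > s} \<le> (Cu + T powr \<alpha>) * s powr (- \<alpha>)"
    proof (cases "s \<ge> T")
      case True
      have "Cu * s powr (- \<alpha>) \<le> (Cu + T powr \<alpha>) * s powr (- \<alpha>)" by (intro mult_right_mono) auto
      with tail[OF True] show ?thesis by linarith
    next
      case False
      have "1 = T powr \<alpha> * T powr (- \<alpha>)" using C by (simp flip: powr_add)
      also have "\<dots> \<le> (Cu + T powr \<alpha>) * s powr (- \<alpha>)"
        using C s False \<alpha> by (intro mult_mono powr_mono2') auto
      finally show ?thesis using prob_le_1 by (meson order_trans)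
    qed
  qed
qed

text \<open>The scale \<open>t\<close> is halved repeatedly: the terms of the resulting geometric series decay because
  the tail exponent is below \<open>2\<close>.\<close>
lemma truncated_second_moment:
  assumes D: "real_distribution D" and \<alpha>: "0 < \<alpha>" "\<alpha> < 2" and C: "C > 0"
    and tail: "\<And>s. s > 0 \<Longrightarrow> measure D {x. \<bar>x\<bar> > s} \<le> C * s powr (- \<alpha>)" and t: "t > 0"
  shows "(\<integral>x. min 1 ((x / t)\<^sup>2) \<partial>D) \<le> C * 2 powr \<alpha> / (1 - 2 powr \<alpha> / 4) * t powr (- \<alpha>)"
proof -
  interpret real_distribution D by (rule D)
  define \<Phi> where "\<Phi> t = (\<integral>x. min 1 ((x / t)\<^sup>2) \<partial>D)" for t
  have int: "integrable D (\<lambda>x. min 1 ((x / t)\<^sup>2))" for t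
    by (rule integrable_const_bound[of _ 1]) auto
  have p4: "(2::real) powr \<alpha> < 4" using powr_less_mono[of \<alpha> 2 "2::real"] \<alpha> by simp
  \<comment> \<open>The fixed point of the halving recursion: inserting the bound K t^(-\<alpha>) at
    \<open>t / 2\<close> reproduces it at \<open>t\<close>. It is positive because 2^\<alpha> <
    4.\<close>
  define K where "K = C * 2 powr \<alpha> / (1 - 2 powr \<alpha> / 4)"
  have K: "C * 2 powr \<alpha> + K * 2 powr \<alpha> / 4 = K" using p4 by (simp add: K_def field_simps)
  have K0: "K \<ge> 0" using p4 C by (simp add: K_def)
  \<comment> \<open>For |x| at most t/2 the integrand at scale \<open>t\<close> is exactly a quarter
    of that at scale \<open>t / 2\<close>; elsewhere it is at most 1 and the tail bound
    pays.\<close>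
  have step: "\<Phi> t \<le> C * (t/2) powr (- \<alpha>) + \<Phi> (t/2) / 4" if t: "t > 0" for t
  proof -
    have "\<Phi> t \<le> (\<integral>x. indicator {x. \<bar>x\<bar> > t/2} x + min 1 ((x / (t/2))\<^sup>2) / 4 \<partial>D)"
      unfolding \<Phi>_def
    proof (rule integral_mono)
      show "integrable D (\<lambda>x. indicator {x. \<bar>x\<bar> > t/2} x + min 1 ((x / (t/2))\<^sup>2) / 4)"
        using int[of "t/2"] by (intro Bochner_Integration.integrable_add integrable_real_indicator)
          (auto simp: emeasure_eq_measure)
      fix x :: real
      show "min 1 ((x / t)\<^sup>2) \<le> indicator {x. \<bar>x\<bar> > t/2} x + min 1 ((x / (t/2))\<^sup>2) / 4"
      proof (cases "\<bar>x\<bar> > t/2")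
        case True
        have "0 \<le> min 1 ((x / (t/2))\<^sup>2)" by simp
        with True show ?thesis by (simp add: min.coboundedI1)
      next
        case False
        hence "\<bar>x / (t/2)\<bar> \<le> 1" using t by (simp add: field_simps)
        hence "(x / (t/2))\<^sup>2 \<le> 1" by (simp add: abs_square_le_1)
        hence "min 1 ((x / (t/2))\<^sup>2) = (x / (t/2))\<^sup>2" by simp
        moreover have "(x / (t/2))\<^sup>2 = 4 * (x/t)\<^sup>2" by (simp add: power2_eq_square field_simps)
        ultimately show ?thesis using False by simp
      qed
    qed (rule int)
    also have "\<dots> = measure D {x. \<bar>x\<bar> > t/2} + \<Phi> (t/2) / 4"
      unfolding \<Phi>_def using int[of "t/2"]
      by (subst Bochner_Integration.integral_add) (auto simp: emeasure_eq_measure)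
    also have "\<dots> \<le> C * (t/2) powr (- \<alpha>) + \<Phi> (t/2) / 4"
      using tail[of "t/2"] t by simp
    finally show ?thesis .
  qed
  \<comment> \<open>The induction starts from the trivial bound 1, whose contribution is divided by
    4 at each halving and vanishes in the limit.\<close>
  have "\<Phi> t \<le> K * t powr (- \<alpha>) + (1/4)^k" if "t > 0" for t k using that
  proof (induction k arbitrary: t)
    case 0
    have "\<Phi> t \<le> (\<integral>x. 1 \<partial>D)" unfolding \<Phi>_def by (rule integral_mono[OF int]) auto
    also have "\<dots> = 1" using prob_space by simp
    finally show ?case using K0 by (simp add: add_increasing)
  next
    case (Suc k)
    have h: "(t/2) powr (- \<alpha>) = 2 powr \<alpha> * t powr (- \<alpha>)"
      using Suc.prems by (simp add: powr_divide powr_minus field_simps)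
    have "\<Phi> t \<le> C * (t/2) powr (- \<alpha>) + \<Phi> (t/2) / 4" by (rule step[OF Suc.prems])
    also have "\<dots> \<le> C * (t/2) powr (- \<alpha>) + (K * (t/2) powr (- \<alpha>) + (1/4)^k) / 4"
      using Suc.IH[of "t/2"] Suc.prems by simp
    also have "\<dots> = (C * 2 powr \<alpha> + K * 2 powr \<alpha> / 4) * t powr (- \<alpha>) + (1/4)^Suc k"
      unfolding h by (simp add: algebra_simps)
    finally show ?case unfolding K .
  qed
  hence "\<forall>\<^sub>F k in sequentially. \<Phi> t \<le> K * t powr (- \<alpha>) + (1/4)^k" using t by simp
  moreover have "(\<lambda>k. K * t powr (- \<alpha>) + (1/4)^k) \<longlonglongrightarrow> K * t powr (- \<alpha>) + 0"
    by (intro tendsto_intros LIMSEQ_realpow_zero) auto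
  ultimately have "\<Phi> t \<le> K * t powr (- \<alpha>) + 0"
    by (intro tendsto_lowerbound[of "\<lambda>k. K * t powr (- \<alpha>) + (1/4)^k"]) auto
  thus ?thesis by (simp add: \<Phi>_def K_def)
qed

text \<open>Since exp(-l x^2) is at least 1 - min(1, l x^2), this is the truncated moment at scale
  l^(-1/2). The exponent \<alpha>/2 < 1 is what later makes sums of squares small with positive
  probability.\<close>

lemma laplace_square_heavy_tailed:
  assumes law: "heavy_tailed_law \<alpha> D" and \<alpha>: "0 < \<alpha>" "\<alpha> < 2"
  obtains K where "K > 0" "\<And>l. l > 0 \<Longrightarrow> (\<integral>x. exp (- l * x\<^sup>2) \<partial>D) \<ge> 1 - K * l powr (\<alpha> / 2)"
proof -
  interpret real_distribution D by (rule heavy_tailed_law_real_distribution[OF law])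
  obtain C where C: "C > 0" "\<And>s. s > 0 \<Longrightarrow> measure D {x. \<bar>x\<bar> > s} \<le> C * s powr (- \<alpha>)"
    using heavy_tailed_law_upper[OF law] by blast
  have p4: "(2::real) powr \<alpha> < 4" using powr_less_mono[of \<alpha> 2 "2::real"] \<alpha> by simp
  define K where "K = C * 2 powr \<alpha> / (1 - 2 powr \<alpha> / 4)"
  show thesis
  proof (rule that)
    show "K > 0" using p4 C by (simp add: K_def)
    fix l :: real assume l: "l > 0"
    define t where "t = l powr (- 1/2)"
    have t: "t > 0" using l by (simp add: t_def)
    have "t\<^sup>2 = l powr (- 1/2 + - 1/2)" unfolding t_def power2_eq_square powr_add ..
    hence t2: "t\<^sup>2 = 1 / l" using l by (simp add: powr_minus_divide)
    have ta: "t powr (- \<alpha>) = l powr (\<alpha>/2)" using l by (simp add: t_def powr_powr)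
    have int: "integrable D (\<lambda>x. min 1 ((x / t)\<^sup>2))"
      by (rule integrable_const_bound[of _ 1]) auto
    have "1 - K * l powr (\<alpha> / 2) \<le> 1 - (\<integral>x. min 1 ((x / t)\<^sup>2) \<partial>D)"
      using truncated_second_moment[OF real_distribution_axioms \<alpha> C t] by (simp add: K_def ta)
    also have "\<dots> = (\<integral>x. 1 - min 1 ((x / t)\<^sup>2) \<partial>D)" using int prob_space by simp
    also have "\<dots> \<le> (\<integral>x. exp (- l * x\<^sup>2) \<partial>D)"
    proof (rule integral_mono)
      show "integrable D (\<lambda>x. exp (- l * x\<^sup>2))"
        using l by (intro integrable_const_bound[of _ 1]) auto
      fix x :: real
      have "(x/t)\<^sup>2 = l * x\<^sup>2" using l by (simp add: power_divide t2)
      moreover have "1 - l * x\<^sup>2 \<le> exp (- l * x\<^sup>2)" using exp_ge_add_one_self[of "- l * x\<^sup>2"] by simp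
      ultimately show "1 - min 1 ((x / t)\<^sup>2) \<le> exp (- l * x\<^sup>2)" by (simp add: min_def)
    qed (use int in auto)
    finally show "(\<integral>x. exp (- l * x\<^sup>2) \<partial>D) \<ge> 1 - K * l powr (\<alpha> / 2)" .
  qed
qed

section \<open>Characteristic function near the origin\<close>

text \<open>Symmetry cancels the sine part. With a real characteristic function, an upper bound on
  the mean cosine bounds the modulus as soon as that mean is nonnegative.\<close>

lemma char_symmetric_law:
  assumes "real_distribution D" and symm: "symmetric_law D"
  shows "char D s = complex_of_real (\<integral>x. cos (s * x) \<partial>D)"
proof -
  interpret real_distribution D by fact
  have "(\<integral>x. sin (s * x) \<partial>D) = (\<integral>x. sin (s * x) \<partial>distr D borel (\<lambda>x. x))"
    by (subst integral_distr) auto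
  also have "\<dots> = (\<integral>x. sin (s * x) \<partial>distr D borel uminus)"
    using symm by (simp add: symmetric_law_def)
  also have "\<dots> = - (\<integral>x. sin (s * x) \<partial>D)"
    by (subst integral_distr) auto
  finally have sin: "(\<integral>x. sin (s * x) \<partial>D) = 0" by simp
  have int: "integrable D (\<lambda>x. iexp (s * x))" by (intro integrable_iexp) auto
  have "Re (char D s) = (\<integral>x. cos (s * x) \<partial>D)"
    unfolding char_def by (subst integral_Re[OF int, symmetric]) (simp add: Re_exp)
  moreover have "Im (char D s) = (\<integral>x. sin (s * x) \<partial>D)"
    unfolding char_def by (subst integral_Im[OF int, symmetric]) (simp add: Im_exp)
  ultimately show ?thesis using sin by (simp add: complex_eq_iff)
qed

text \<open>The shell \<eta>/|s| < |x| \<le> 1/|s| has mass at least |s|^\<alpha>, and on it the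
  cosine is at most cos \<eta> < 1. This lowers the mean cosine by a multiple of
  |s|^\<alpha>.\<close>

lemma char_decay_heavy_tailed:
  assumes law: "heavy_tailed_law \<alpha> D" and symm: "symmetric_law D"
  obtains c s0 where "c > 0" "s0 > 0"
    "\<And>s. 0 < \<bar>s\<bar> \<Longrightarrow> \<bar>s\<bar> \<le> s0 \<Longrightarrow> norm (char D s) \<le> exp (- c * \<bar>s\<bar> powr \<alpha>)"
proof -
  interpret real_distribution D by (rule heavy_tailed_law_real_distribution[OF law])
  from law obtain Cl Cu T where C: "Cl > 0" "Cu > 0" "T > 0"
    and lo: "\<And>t. t \<ge> T \<Longrightarrow> Cl * t powr (- \<alpha>) \<le> measure D {x. \<bar>x\<bar> > t}"
    and up: "\<And>t. t \<ge> T \<Longrightarrow> measure D {x. \<bar>x\<bar> > t} \<le> Cu * t powr (- \<alpha>)" and \<alpha>: "\<alpha> > 0"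
    unfolding heavy_tailed_law_def by blast
  have "Cl * T powr (- \<alpha>) \<le> Cu * T powr (- \<alpha>)" using lo[of T] up[of T] by linarith
  hence "Cl \<le> Cu" using C by simp
  \<comment> \<open>Chosen so that Cl \<eta>^(-\<alpha>) = Cu + 1: the tail beyond \<eta>/|s| then
    exceeds the tail beyond 1/|s| by |s|^\<alpha>, however far apart the two constants are.\<close>
  define q where "q = (Cu + 1) / Cl"
  define \<eta> where "\<eta> = q powr (- 1 / \<alpha>)"
  have q: "q > 1" using C \<open>Cl \<le> Cu\<close> by (simp add: q_def)
  have \<eta>: "0 < \<eta>" "\<eta> < 1" using q \<alpha> powr_less_cancel_iff[of q "-1/\<alpha>" 0] by (auto simp: \<eta>_def)
  have \<eta>q: "\<eta> powr (- \<alpha>) = q" using q \<alpha> by (simp add: \<eta>_def powr_powr)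
  define c where "c = 1 - cos \<eta>"
  have "cos \<eta> < cos 0" using \<eta> pi_gt3 by (intro cos_monotone_0_pi) auto
  hence c: "c > 0" by (simp add: c_def)
  have "\<forall>\<^sub>F s in at 0. norm (char D s - 1) < 1"
    using isCont_char[of 0] char_zero unfolding isCont_def tendsto_iff dist_norm by fastforce
  then obtain d where d: "d > 0" "\<And>s. s \<noteq> 0 \<Longrightarrow> \<bar>s\<bar> < d \<Longrightarrow> norm (char D s - 1) < 1"
    unfolding eventually_at by (auto simp: dist_norm)
  \<comment> \<open>Below \<open>d\<close> the characteristic function stays within 1 of the value
    1, hence nonnegative; below \<eta>/T both radii of the shell exceed \<open>T\<close>, where the
    tail bounds apply.\<close>
  define s0 where "s0 = min (d/2) (\<eta> / T)"
  show thesis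
  proof (rule that[of c s0])
    show "c > 0" "s0 > 0" using c d \<eta> C by (auto simp: s0_def)
    fix s :: real assume s: "0 < \<bar>s\<bar>" "\<bar>s\<bar> \<le> s0"
    have T1: "\<eta> / \<bar>s\<bar> \<ge> T" using s C by (simp add: s0_def field_simps)
    have "\<eta> / \<bar>s\<bar> \<le> 1 / \<bar>s\<bar>" using s \<eta> by (intro divide_right_mono) auto
    with T1 have T2: "1 / \<bar>s\<bar> \<ge> T" by linarith
    define A where "A = {x::real. \<bar>x\<bar> > \<eta> / \<bar>s\<bar>}"
    define B where "B = {x::real. \<bar>x\<bar> > 1 / \<bar>s\<bar>}"
    have meas: "A \<in> sets borel" "B \<in> sets borel" by (auto simp: A_def B_def)
    have BA: "B \<subseteq> A" using \<open>\<eta> / \<bar>s\<bar> \<le> 1 / \<bar>s\<bar>\<close> by (auto simp: A_def B_def)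
    have "measure D (A - B) = measure D A - measure D B"
      using BA meas by (intro finite_measure_Diff) auto
    moreover have "Cl * (\<eta> / \<bar>s\<bar>) powr (- \<alpha>) = (Cu + 1) * \<bar>s\<bar> powr \<alpha>"
      using s \<eta> C \<eta>q by (simp add: powr_divide powr_minus q_def field_simps)
    moreover have "Cu * (1 / \<bar>s\<bar>) powr (- \<alpha>) = Cu * \<bar>s\<bar> powr \<alpha>"
      using s by (simp add: powr_divide powr_minus)
    ultimately have AB: "measure D (A - B) \<ge> \<bar>s\<bar> powr \<alpha>"
      using lo[OF T1] up[OF T2] unfolding A_def B_def distrib_right by linarith
    have int: "integrable D (\<lambda>x. cos (s * x))" by (rule integrable_const_bound[of _ 1]) auto
    have "(\<integral>x. cos (s * x) \<partial>D) \<le> (\<integral>x. 1 - c * indicator (A - B) x \<partial>D)"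
    proof (rule integral_mono[OF int])
      have "A - B \<in> sets borel" using meas by auto
      hence "(\<lambda>x. 1 - c * indicator (A - B) x) \<in> borel_measurable borel" by measurable
      moreover have "AE x in D. norm (1 - c * indicator (A - B) x) \<le> 1 + c"
        using c by (auto simp: indicator_def)
      ultimately show "integrable D (\<lambda>x. 1 - c * indicator (A - B) x)"
        by (intro integrable_const_bound[of _ "1 + c"]) auto
      fix x :: real
      show "cos (s * x) \<le> 1 - c * indicator (A - B) x"
      proof (cases "x \<in> A - B")
        case True
        hence "\<eta> \<le> \<bar>s * x\<bar>" "\<bar>s * x\<bar> \<le> pi" using s pi_gt3
          by (auto simp: A_def B_def abs_mult field_simps)
        hence "cos \<bar>s * x\<bar> \<le> cos \<eta>" using \<eta> by (intro cos_monotone_0_pi_le) auto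
        thus ?thesis using True by (simp add: c_def)
      qed simp
    qed
    also have "\<dots> = 1 - c * measure D (A - B)"
    proof -
      have "integrable D (indicator (A - B) :: real \<Rightarrow> real)"
        using meas by (intro integrable_real_indicator) (auto simp: emeasure_eq_measure)
      thus ?thesis using prob_space by simp
    qed
    also have "\<dots> \<le> 1 - c * \<bar>s\<bar> powr \<alpha>" using AB c by simp
    also have "\<dots> \<le> exp (- c * \<bar>s\<bar> powr \<alpha>)" using exp_ge_add_one_self[of "- c * \<bar>s\<bar> powr \<alpha>"] by simp
    finally have "(\<integral>x. cos (s * x) \<partial>D) \<le> exp (- c * \<bar>s\<bar> powr \<alpha>)" .
    moreover have "(\<integral>x. cos (s * x) \<partial>D) \<ge> 0"
    proof -
      have "\<bar>s\<bar> < d" using s d by (simp add: s0_def)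
      hence "norm (char D s - 1) < 1" using d s by auto
      hence "\<bar>(\<integral>x. cos (s * x) \<partial>D) - 1\<bar> < 1"
        unfolding char_symmetric_law[OF real_distribution_axioms symm]
        by (metis norm_of_real of_real_1 of_real_diff real_norm_def)
      thus ?thesis by linarith
    qed
    ultimately show "norm (char D s) \<le> exp (- c * \<bar>s\<bar> powr \<alpha>)"
      unfolding char_symmetric_law[OF real_distribution_axioms symm] by simp
  qed
qed

subsection \<open>Small ball probabilities\<close>

text \<open>An Esseen-type inequality. The indicator of the ball is dominated by exp(1/2) times the
  Gaussian exp(-(x/\<tau>)^2/2), which is itself the standard normal characteristic function at
  x/\<tau>; Fubini moves the transform to \<mu>.\<close>

lemma small_ball_le_char:
  assumes \<mu>: "real_distribution \<mu>" and \<tau>: "\<tau> > 0"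
  shows "measure \<mu> {x. \<bar>x\<bar> \<le> \<tau>} \<le> exp (1/2) * (\<integral>z. norm (char \<mu> (z / \<tau>)) \<partial>std_normal_distribution)"
proof -
  interpret \<mu>: real_distribution \<mu> by (rule \<mu>)
  interpret N: real_distribution std_normal_distribution by (rule real_dist_normal_dist)
  interpret pair_prob_space \<mu> std_normal_distribution ..
  have int: "integrable \<mu> (\<lambda>x. exp (- (x/\<tau>)\<^sup>2 / 2))"
    by (rule \<mu>.integrable_const_bound[of _ 1]) auto
  have intc: "integrable (\<mu> \<Otimes>\<^sub>M std_normal_distribution) (case_prod (\<lambda>x z. iexp (x / \<tau> * z)))"
    by (rule P.integrable_const_bound[of _ 1]) (auto simp: split_beta simp del: of_real_mult)
  have intn: "integrable std_normal_distribution (\<lambda>z. norm (char \<mu> (z / \<tau>)))"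
    by (rule N.integrable_const_bound[of _ 1]) (auto simp: \<mu>.cmod_char_le_1)
  have "exp (- 1/2) * measure \<mu> {x. \<bar>x\<bar> \<le> \<tau>} = (\<integral>x. exp (- 1/2) * indicator {x. \<bar>x\<bar> \<le> \<tau>} x \<partial>\<mu>)"
    by simp
  also have "\<dots> \<le> (\<integral>x. exp (- (x/\<tau>)\<^sup>2 / 2) \<partial>\<mu>)"
  proof (rule integral_mono[OF _ int])
    show "integrable \<mu> (\<lambda>x. exp (- 1/2) * indicator {x. \<bar>x\<bar> \<le> \<tau>} x :: real)"
      by (rule \<mu>.integrable_const_bound[of _ 1]) (auto simp: indicator_def)
    fix x :: real
    have "(x/\<tau>)\<^sup>2 \<le> 1" if "\<bar>x\<bar> \<le> \<tau>" using that \<tau> by (simp add: abs_square_le_1)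
    thus "exp (- 1/2) * indicator {x. \<bar>x\<bar> \<le> \<tau>} x \<le> exp (- (x/\<tau>)\<^sup>2 / 2)"
      by (auto simp: indicator_def)
  qed
  also have "\<dots> = norm (complex_of_real (\<integral>x. exp (- (x/\<tau>)\<^sup>2 / 2) \<partial>\<mu>))"
    by (simp add: integral_nonneg_AE)
  also have "complex_of_real (\<integral>x. exp (- (x/\<tau>)\<^sup>2 / 2) \<partial>\<mu>) =
      (\<integral>x. char std_normal_distribution (x/\<tau>) \<partial>\<mu>)"
    by (simp only: char_std_normal_distribution integral_complex_of_real)
  also have "\<dots> = (\<integral>x. (\<integral>z. iexp (x/\<tau> * z) \<partial>std_normal_distribution) \<partial>\<mu>)"
    by (simp only: char_def)
  also have "\<dots> = (\<integral>z. (\<integral>x. iexp (x/\<tau> * z) \<partial>\<mu>) \<partial>std_normal_distribution)"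
    by (rule Fubini_integral[OF intc, symmetric])
  also have "\<dots> = (\<integral>z. char \<mu> (z/\<tau>) \<partial>std_normal_distribution)"
    unfolding char_def by (simp add: mult.commute)
  also have "norm \<dots> \<le> (\<integral>z. norm (char \<mu> (z/\<tau>)) \<partial>std_normal_distribution)"
    by (rule integral_norm_bound)
  finally have "exp (- 1/2) * measure \<mu> {x. \<bar>x\<bar> \<le> \<tau>} \<le> (\<integral>z. norm (char \<mu> (z/\<tau>)) \<partial>std_normal_distribution)" .
  hence "exp (1/2) * (exp (- 1/2) * measure \<mu> {x. \<bar>x\<bar> \<le> \<tau>}) \<le>
      exp (1/2) * (\<integral>z. norm (char \<mu> (z/\<tau>)) \<partial>std_normal_distribution)"
    by (intro mult_left_mono) auto
  thus ?thesis by (simp add: mult.assoc[symmetric] exp_minus_inverse flip: exp_add)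
qed

text \<open>From (u/m)^m \<le> exp u with m \<alpha> at least 2, the integrand decays at least like
  y^(-2), so a multiple of 1/(1 + y^2) dominates it.\<close>

lemma integrable_exp_minus_powr:
  fixes c \<alpha> :: real
  assumes "c > 0" "\<alpha> > 0"
  shows "integrable lborel (\<lambda>y::real. exp (- c * \<bar>y\<bar> powr \<alpha>))"
proof -
  obtain m :: nat where m: "real m * \<alpha> \<ge> 2" "m > 0"
  proof
    show "real (nat \<lceil>2 / \<alpha>\<rceil>) * \<alpha> \<ge> 2"
      using assms real_nat_ceiling_ge[of "2/\<alpha>"] by (simp only: pos_divide_le_eq)
    show "nat \<lceil>2 / \<alpha>\<rceil> > 0" using assms by simp
  qed
  define K where "K = 2 * (1 + (real m / c) ^ m)"
  have K: "K \<ge> 2" using assms by (simp add: K_def)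
  have bound: "exp (- c * \<bar>y\<bar> powr \<alpha>) \<le> K * inverse (1 + y\<^sup>2)" for y :: real
  proof (cases "\<bar>y\<bar> \<le> 1")
    case True
    hence "y\<^sup>2 \<le> 1" by (simp add: abs_square_le_1)
    hence "inverse 2 \<le> inverse (1 + y\<^sup>2)" by (intro le_imp_inverse_le) (auto simp: add_pos_nonneg)
    hence "2 * inverse 2 \<le> K * inverse (1 + y\<^sup>2)" using K by (intro mult_mono) auto
    moreover have "exp (- c * \<bar>y\<bar> powr \<alpha>) \<le> 1" using assms by simp
    moreover have "(2::real) * inverse 2 = 1" by simp
    ultimately show ?thesis by linarith
  next
    case False
    define u where "u = c * \<bar>y\<bar> powr \<alpha>"
    have u: "u > 0" using False assms by (simp add: u_def)
    have "u / m \<le> exp (u / m)" using exp_ge_add_one_self[of "u/m"] by linarith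
    hence "(u / m) ^ m \<le> (exp (u / m)) ^ m" using u by (intro power_mono) auto
    also have "\<dots> = exp u" using m by (simp flip: exp_of_nat_mult)
    finally have e: "(u / m) ^ m \<le> exp u" .
    have "exp (- u) \<le> (m / u) ^ m"
      using le_imp_inverse_le[OF e] u m by (simp add: exp_minus power_divide)
    also have "\<dots> = (m / c) ^ m * (\<bar>y\<bar> powr (- (\<alpha> * m)))"
      using False by (simp add: u_def power_divide power_mult_distrib powr_minus field_simps
          flip: powr_realpow powr_powr)
    also have "\<dots> \<le> (m / c) ^ m * (\<bar>y\<bar> powr (- 2))"
      using False assms m by (intro mult_left_mono powr_mono) (auto simp: mult.commute)
    also have "\<dots> \<le> (m / c) ^ m * (2 * inverse (1 + y\<^sup>2))"
    proof (rule mult_left_mono)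
      have "1 < y\<^sup>2" using False by (simp add: abs_square_le_1 flip: not_le)
      hence "inverse (2 * y\<^sup>2) \<le> inverse (1 + y\<^sup>2)"
        by (intro le_imp_inverse_le) (auto simp: add_pos_nonneg)
      thus "\<bar>y\<bar> powr (- 2) \<le> 2 * inverse (1 + y\<^sup>2)" using False by (simp add: powr_minus)
    qed (use assms in auto)
    finally have "exp (- u) \<le> 2 * (m / c) ^ m * inverse (1 + y\<^sup>2)" using assms by (simp add: mult_ac)
    also have "\<dots> \<le> K * inverse (1 + y\<^sup>2)" by (intro mult_right_mono) (auto simp: K_def)
    finally show ?thesis by (simp add: u_def)
  qed
  have "integrable lborel (\<lambda>y::real. inverse (1 + y\<^sup>2))"
    using integrable_inverse_1_plus_square by (simp add: set_integrable_def)
  hence "integrable lborel (\<lambda>y::real. K * inverse (1 + y\<^sup>2))" by simp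
  thus ?thesis
    by (rule Bochner_Integration.integrable_bound) (use bound K in \<open>auto intro!: AE_I2\<close>)
qed

text \<open>The source of the linear factor \<tau>: the normal density is at most 1, so the Gaussian
  mean is at most a Lebesgue integral, and the substitution y = z/\<tau> produces \<tau>.\<close>

lemma gaussian_integral_scale:
  fixes g :: "real \<Rightarrow> real"
  assumes g: "integrable lborel g" and nn: "\<And>y. g y \<ge> 0" and \<tau>: "\<tau> > 0"
  shows "integrable std_normal_distribution (\<lambda>z. g (z / \<tau>))"
    and "(\<integral>z. g (z / \<tau>) \<partial>std_normal_distribution) \<le> \<tau> * (\<integral>y. g y \<partial>lborel)"
proof -
  have [measurable]: "g \<in> borel_measurable borel" using g by auto
  have int: "integrable lborel (\<lambda>z. g (z / \<tau>))"
    using lborel_integrable_real_affine[OF g, of "1/\<tau>" 0] \<tau> by simp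
  have dens: "std_normal_density z \<le> 1" for z
  proof -
    have "1 \<le> sqrt (2 * pi)" using pi_gt3 by simp
    moreover have "exp (- z\<^sup>2 / 2) \<le> 1" by simp
    ultimately have "exp (- z\<^sup>2 / 2) \<le> sqrt (2 * pi)" by linarith
    thus ?thesis using pi_gt3 by (simp add: normal_density_def field_simps)
  qed
  have int2: "integrable lborel (\<lambda>z. std_normal_density z * g (z / \<tau>))"
    using int by (rule Bochner_Integration.integrable_bound)
      (auto intro!: AE_I2 mult_left_le_one_le simp: abs_mult nn dens)
  show "integrable std_normal_distribution (\<lambda>z. g (z / \<tau>))"
    by (subst integrable_density) (use int2 in auto)
  have "(\<integral>z. g (z / \<tau>) \<partial>std_normal_distribution) = (\<integral>z. std_normal_density z * g (z / \<tau>) \<partial>lborel)"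
    by (subst integral_density) auto
  also have "\<dots> \<le> (\<integral>z. g (z / \<tau>) \<partial>lborel)"
    using int2 int by (rule integral_mono) (auto intro!: mult_left_le_one_le simp: nn dens)
  also have "\<dots> = \<tau> * (\<integral>y. g y \<partial>lborel)"
    using lborel_integral_real_affine[of "1/\<tau>" g 0] \<tau> by (simp add: field_simps)
  finally show "(\<integral>z. g (z / \<tau>) \<partial>std_normal_distribution) \<le> \<tau> * (\<integral>y. g y \<partial>lborel)" .
qed

text \<open>The constant \<open>C\<close> does not depend on \<open>\<tau>\<close>; this linear bound, uniform down to a fixed scale,
  is what lets the net argument work for every aspect ratio above \<open>1\<close>.\<close>
lemma small_ball_linear_combination:
  fixes D :: "real measure"
  assumes \<alpha>: "\<alpha> > 0" and D: "real_distribution D"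
    and c: "c > 0" "s0 > 0"
    and decay: "\<And>s. 0 < \<bar>s\<bar> \<Longrightarrow> \<bar>s\<bar> \<le> s0 \<Longrightarrow> norm (char D s) \<le> exp (- c * \<bar>s\<bar> powr \<alpha>)"
    and k: "\<kappa>1 > 0" "\<kappa>2 > 0" "\<zeta> > 0"
  shows "\<exists>C>0. \<forall>\<tau>>0. \<exists>n0. \<forall>n\<ge>n0. \<forall>(M :: 'w measure) X w.
     prob_space M \<longrightarrow> prob_space.indep_vars M (\<lambda>_. borel) X {..<n} \<longrightarrow>
     (\<forall>j<n. distr M borel (X j) = D) \<longrightarrow>
     \<zeta> * real n \<le> real (card {j. j < n \<and> \<kappa>1 \<le> \<bar>w j\<bar> \<and> \<bar>w j\<bar> \<le> \<kappa>2}) \<longrightarrow>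
     measure M {\<omega> \<in> space M. \<bar>\<Sum>j<n. X j \<omega> * w j\<bar> \<le> \<tau> * real n powr (1 / \<alpha>)} \<le> C * \<tau>"
proof -
  interpret D: real_distribution D by (rule D)
  define c' where "c' = c * \<zeta> * \<kappa>1 powr \<alpha>"
  define g where "g = (\<lambda>y. exp (- c' * \<bar>y\<bar> powr \<alpha>))"
  have c': "c' > 0" using c k by (simp add: c'_def)
  have g: "integrable lborel g" unfolding g_def by (rule integrable_exp_minus_powr[OF c' \<alpha>])
  define C where "C = exp (1/2) * ((\<integral>y. g y \<partial>lborel) + 1)"
  have "(\<integral>y. g y \<partial>lborel) \<ge> 0" by (rule integral_nonneg_AE) (auto simp: g_def)
  hence C0: "C > 0" by (simp add: C_def add_nonneg_pos)
  show ?thesis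
  proof (intro exI[of _ C] conjI allI impI C0)
    fix \<tau> :: real assume \<tau>: "\<tau> > 0"
    \<comment> \<open>Cut-off for the Gaussian variable. The decay bound is available for |z| up to
      \<open>R\<close>; beyond, the modulus is at most 1 and Chebyshev charges 1/R^2 = \<tau>, again
      linear.\<close>
    define R where "R = 1 / sqrt \<tau>"
    have R: "R > 0" using \<tau> by (simp add: R_def)
    have R2: "1 / R\<^sup>2 = \<tau>" using \<tau> by (simp add: R_def power_divide)
    \<comment> \<open>Once \<open>b\<close> is at least \<open>m\<close>, every argument t w_j / b
      with |t| at most R/\<tau> and |w_j| at most \<kappa>2 lies in the range [-s0, s0] of
      \<open>decay\<close>. The threshold \<open>n0\<close> depends on \<tau>, the constant
      \<open>C\<close> does not.\<close>
    define m where "m = R / \<tau> * \<kappa>2 / s0"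
    have m: "m > 0" using R \<tau> k c by (simp add: m_def)
    define n0 where "n0 = nat \<lceil>m powr \<alpha>\<rceil> + 1"
    show "\<exists>n0. \<forall>n\<ge>n0. \<forall>(M :: 'w measure) X w.
     prob_space M \<longrightarrow> prob_space.indep_vars M (\<lambda>_. borel) X {..<n} \<longrightarrow>
     (\<forall>j<n. distr M borel (X j) = D) \<longrightarrow>
     \<zeta> * real n \<le> real (card {j. j < n \<and> \<kappa>1 \<le> \<bar>w j\<bar> \<and> \<bar>w j\<bar> \<le> \<kappa>2}) \<longrightarrow>
     measure M {\<omega> \<in> space M. \<bar>\<Sum>j<n. X j \<omega> * w j\<bar> \<le> \<tau> * real n powr (1 / \<alpha>)} \<le> C * \<tau>"
    proof (rule exI[of _ n0], intro allI impI)
      fix n :: nat and M :: "'w measure" and X :: "nat \<Rightarrow> 'w \<Rightarrow> real" and w :: "nat \<Rightarrow> real"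
      assume n: "n \<ge> n0" and "prob_space M" and ind: "prob_space.indep_vars M (\<lambda>_. borel) X {..<n}"
        and law: "\<forall>j<n. distr M borel (X j) = D"
        and card: "\<zeta> * real n \<le> real (card {j. j < n \<and> \<kappa>1 \<le> \<bar>w j\<bar> \<and> \<bar>w j\<bar> \<le> \<kappa>2})"
      interpret prob_space M by fact
      define b where "b = real n powr (1 / \<alpha>)"
      have n1: "n \<ge> 1" using n by (simp add: n0_def)
      have b: "b > 0" using n1 by (simp add: b_def)
      have b\<alpha>: "b powr \<alpha> = n" using n1 \<alpha> by (simp add: b_def powr_powr)
      have mb: "m \<le> b"
      proof -
        have "m powr \<alpha> \<le> n" using n unfolding n0_def by linarith
        hence "(m powr \<alpha>) powr (1/\<alpha>) \<le> n powr (1/\<alpha>)" using \<alpha> by (intro powr_mono2) auto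
        thus ?thesis using \<alpha> m by (simp add: powr_powr b_def)
      qed
      have Xm: "random_variable borel (X j)" if "j < n" for j
        using ind that by (auto simp: indep_vars_def)
      define Y where "Y j \<omega> = w j / b * X j \<omega>" for j \<omega>
      have Ym: "random_variable borel (Y j)" if "j < n" for j
        unfolding Y_def using Xm[OF that] by measurable
      have indY: "indep_vars (\<lambda>_. borel) Y {..<n}"
        unfolding Y_def by (rule indep_vars_compose2[OF ind]) auto
      define S where "S \<omega> = (\<Sum>j<n. Y j \<omega>)" for \<omega>
      have Sm[measurable]: "random_variable borel S" unfolding S_def using Ym by measurable
      define \<mu> where "\<mu> = distr M borel S"
      have rd: "real_distribution \<mu>" unfolding \<mu>_def by (rule real_distribution_distr[OF Sm])
      interpret \<mu>: real_distribution \<mu> by (rule rd)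
      define J where "J = {j. j < n \<and> \<kappa>1 \<le> \<bar>w j\<bar> \<and> \<bar>w j\<bar> \<le> \<kappa>2}"
      have J: "J \<subseteq> {..<n}" "finite J" by (auto simp: J_def)
      have charY: "char (distr M borel (Y j)) t = char D (t * (w j / b))" if j: "j < n" for j t
      proof -
        have "char (distr M borel (Y j)) t = (\<integral>\<omega>. iexp (t * Y j \<omega>) \<partial>M)"
          unfolding char_def using Ym[OF j] by (subst integral_distr) auto
        also have "\<dots> = (\<integral>\<omega>. iexp ((t * (w j / b)) * X j \<omega>) \<partial>M)"
          by (simp add: Y_def mult_ac)
        also have "\<dots> = char (distr M borel (X j)) (t * (w j / b))"
          unfolding char_def using Xm[OF j] by (subst integral_distr) auto
        finally show ?thesis using law j by simp
      qed
      \<comment> \<open>Factors outside \<open>J\<close> are bounded by 1. Each factor in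
        \<open>J\<close> decays at rate |t|^\<alpha> / n because b^\<alpha> = n, and the proportion
        \<zeta> of such indices turns the product into a bound free of \<open>n\<close>.\<close>
      have char\<mu>: "norm (char \<mu> t) \<le> g t" if t: "\<bar>t\<bar> \<le> R / \<tau>" for t
      proof (cases "t = 0")
        case True
        thus ?thesis using \<mu>.cmod_char_le_1[of t] by (simp add: g_def)
      next
        case False
        have each: "norm (char D (t * (w j / b))) \<le> exp (- c * \<kappa>1 powr \<alpha> * \<bar>t\<bar> powr \<alpha> / n)"
          if j: "j \<in> J" for j
        proof -
          have wj: "\<kappa>1 \<le> \<bar>w j\<bar>" "\<bar>w j\<bar> \<le> \<kappa>2" using j by (auto simp: J_def)
          have a: "\<bar>t * (w j / b)\<bar> = \<bar>t\<bar> * \<bar>w j\<bar> / b" using b by (simp add: abs_mult)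
          have "\<bar>t\<bar> * \<bar>w j\<bar> / b \<le> R / \<tau> * \<kappa>2 / b"
            using t wj b by (intro divide_right_mono mult_mono) auto
          also have "\<dots> = m * s0 / b" using c by (simp add: m_def)
          also have "\<dots> \<le> s0" using mb b c by (simp add: field_simps)
          finally have up: "\<bar>t * (w j / b)\<bar> \<le> s0" using a by simp
          have "norm (char D (t * (w j / b))) \<le> exp (- c * \<bar>t * (w j / b)\<bar> powr \<alpha>)"
            using False wj k b by (intro decay up) auto
          also have "\<dots> \<le> exp (- c * (\<bar>t\<bar> * \<kappa>1 / b) powr \<alpha>)"
            unfolding a using c \<alpha> wj b k
            by (simp add: powr_mono2 divide_right_mono mult_left_mono)
          also have "(\<bar>t\<bar> * \<kappa>1 / b) powr \<alpha> = \<kappa>1 powr \<alpha> * \<bar>t\<bar> powr \<alpha> / n"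
            using k b by (simp add: powr_divide powr_mult b\<alpha>)
          finally show ?thesis by (simp add: mult.assoc)
        qed
        have "norm (char \<mu> t) = (\<Prod>j<n. norm (char D (t * (w j / b))))"
          unfolding \<mu>_def S_def by (subst char_distr_sum[OF indY]) (simp add: charY prod_norm)
        also have "\<dots> = (\<Prod>j\<in>J. norm (char D (t * (w j / b)))) * (\<Prod>j\<in>{..<n}-J. norm (char D (t * (w j / b))))"
          using J by (subst mult.commute, intro prod.subset_diff) auto
        also have "\<dots> \<le> (\<Prod>j\<in>J. norm (char D (t * (w j / b))))"
          by (intro mult_left_le prod_nonneg prod_le_1) (auto simp: D.cmod_char_le_1)
        also have "\<dots> \<le> (\<Prod>j\<in>J. exp (- c * \<kappa>1 powr \<alpha> * \<bar>t\<bar> powr \<alpha> / n))"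
          by (intro prod_mono conjI each) auto
        also have "\<dots> = exp (- (c * \<kappa>1 powr \<alpha> * \<bar>t\<bar> powr \<alpha>) * (card J / n))"
          by (simp flip: exp_of_nat_mult)
        also have "\<dots> \<le> exp (- (c * \<kappa>1 powr \<alpha> * \<bar>t\<bar> powr \<alpha>) * \<zeta>)"
        proof -
          have "\<zeta> \<le> card J / n" using card n1 by (simp add: J_def field_simps)
          hence "(c * \<kappa>1 powr \<alpha> * \<bar>t\<bar> powr \<alpha>) * \<zeta> \<le> (c * \<kappa>1 powr \<alpha> * \<bar>t\<bar> powr \<alpha>) * (card J / n)"
            using c by (intro mult_left_mono) auto
          thus ?thesis by simp
        qed
        also have "\<dots> = g t" by (simp add: g_def c'_def mult_ac)
        finally show ?thesis .
      qed
      interpret N: real_distribution std_normal_distribution by (rule real_dist_normal_dist)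
      have mom: "integrable std_normal_distribution (\<lambda>z. z\<^sup>2)" "(\<integral>z. z\<^sup>2 \<partial>std_normal_distribution) = 1"
        using std_normal_distribution_even_moments[of 1] by (simp_all add: power2_eq_square)
      note gs = gaussian_integral_scale[OF g _ \<tau>]
      have g0: "g y \<ge> 0" for y by (simp add: g_def)
      have "measure \<mu> {x. \<bar>x\<bar> \<le> \<tau>} \<le> exp (1/2) * (\<integral>z. norm (char \<mu> (z / \<tau>)) \<partial>std_normal_distribution)"
        by (rule small_ball_le_char[OF rd \<tau>])
      also have "(\<integral>z. norm (char \<mu> (z / \<tau>)) \<partial>std_normal_distribution)
          \<le> (\<integral>z. g (z / \<tau>) + z\<^sup>2 / R\<^sup>2 \<partial>std_normal_distribution)"
      proof (rule integral_mono)
        show "integrable std_normal_distribution (\<lambda>z. norm (char \<mu> (z / \<tau>)))"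
          by (rule N.integrable_const_bound[of _ 1]) (auto simp: \<mu>.cmod_char_le_1)
        show "integrable std_normal_distribution (\<lambda>z. g (z / \<tau>) + z\<^sup>2 / R\<^sup>2)"
          using gs(1)[OF g0] mom by auto
        fix z :: real
        show "norm (char \<mu> (z / \<tau>)) \<le> g (z / \<tau>) + z\<^sup>2 / R\<^sup>2"
        proof (cases "\<bar>z\<bar> \<le> R")
          case True
          hence "norm (char \<mu> (z / \<tau>)) \<le> g (z / \<tau>)"
            using \<tau> by (intro char\<mu>) (auto simp: divide_right_mono)
          thus ?thesis by (simp add: add_increasing2)
        next
          case False
          hence "R\<^sup>2 \<le> \<bar>z\<bar>\<^sup>2" using R by (intro power_mono) auto
          hence "1 \<le> z\<^sup>2 / R\<^sup>2" using R by simp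
          thus ?thesis using \<mu>.cmod_char_le_1[of "z/\<tau>"] g0[of "z/\<tau>"] by linarith
        qed
      qed
      also have "\<dots> = (\<integral>z. g (z / \<tau>) \<partial>std_normal_distribution) + \<tau>"
        using gs(1)[OF g0] mom R2 by simp
      also have "\<dots> \<le> \<tau> * (\<integral>y. g y \<partial>lborel) + \<tau>" using gs(2)[OF g0] by simp
      finally have "measure \<mu> {x. \<bar>x\<bar> \<le> \<tau>} \<le> C * \<tau>" by (simp add: C_def algebra_simps)
      moreover have "measure \<mu> {x. \<bar>x\<bar> \<le> \<tau>} = measure M {\<omega> \<in> space M. \<bar>\<Sum>j<n. X j \<omega> * w j\<bar> \<le> \<tau> * b}"
      proof -
        have "S \<omega> = (\<Sum>j<n. X j \<omega> * w j) / b" for \<omega>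
          by (simp add: S_def Y_def sum_divide_distrib mult.commute)
        hence "\<bar>S \<omega>\<bar> \<le> \<tau> \<longleftrightarrow> \<bar>\<Sum>j<n. X j \<omega> * w j\<bar> \<le> \<tau> * b" for \<omega>
          using b by (simp add: abs_divide pos_divide_le_eq)
        thus ?thesis unfolding \<mu>_def by (subst measure_distr) (auto simp: vimage_def Int_def conj_commute)
      qed
      ultimately show "measure M {\<omega> \<in> space M. \<bar>\<Sum>j<n. X j \<omega> * w j\<bar> \<le> \<tau> * real n powr (1 / \<alpha>)} \<le> C * \<tau>"
        by (simp add: b_def)
    qed
  qed
qed

subsection \<open>Lattice approximation\<close>

text \<open>The average of \<open>\<parallel>p + d \<cdot> a\<parallel>\<^sup>2\<close> over the two roundings of \<open>x\<close>, weighted so that \<open>d\<close> has mean zero,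
  has no cross term; so one of the two choices is good.\<close>
lemma rounding_step:
  fixes p a :: "nat \<Rightarrow> real" and x :: real
  shows "\<exists>z::int. \<bar>real_of_int z - x\<bar> \<le> 1 \<and>
    (\<Sum>i\<in>I. (p i + (real_of_int z - x) * a i)\<^sup>2) \<le> (\<Sum>i\<in>I. (p i)\<^sup>2) + (\<Sum>i\<in>I. (a i)\<^sup>2)"
proof -
  define t where "t = x - of_int \<lfloor>x\<rfloor>"
  have t: "0 \<le> t" "t \<le> 1" unfolding t_def by linarith+
  define P where "P = (\<Sum>i\<in>I. (p i)\<^sup>2)"
  define Q where "Q = (\<Sum>i\<in>I. p i * a i)"
  define A where "A = (\<Sum>i\<in>I. (a i)\<^sup>2)"
  have A: "A \<ge> 0" by (simp add: A_def sum_nonneg)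
  have expand: "(\<Sum>i\<in>I. (p i + d * a i)\<^sup>2) = P + 2 * d * Q + d\<^sup>2 * A" for d
    by (simp add: P_def Q_def A_def power2_sum power_mult_distrib sum.distrib sum_distrib_left algebra_simps)
  have sq: "d\<^sup>2 * A \<le> A" if "\<bar>d\<bar> \<le> 1" for d
  proof -
    have "d\<^sup>2 \<le> 1" using that by (simp add: abs_square_le_1)
    thus ?thesis using A mult_right_mono[of "d\<^sup>2" 1 A] by simp
  qed
  show ?thesis
  \<comment> \<open>The sign of \<open>Q\<close> identifies the good choice directly: rounding down
    has d = -t, rounding up has d = 1 - t, and one of them makes the cross term 2 d Q
    nonpositive.\<close>
  proof (cases "Q \<ge> 0")
    case True
    have "2 * (- t) * Q \<le> 0" using True t by (simp add: mult_nonneg_nonneg)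
    thus ?thesis using t sq[of "- t"] expand[of "- t"]
      by (intro exI[of _ "\<lfloor>x\<rfloor>"]) (auto simp: t_def P_def A_def)
  next
    case False
    have "2 * (1 - t) * Q \<le> 0" using False t by (intro mult_nonneg_nonpos) auto
    moreover have "real_of_int (\<lfloor>x\<rfloor> + 1) - x = 1 - t" by (simp add: t_def)
    ultimately show ?thesis using t sq[of "1 - t"] expand[of "1 - t"]
      by (intro exI[of _ "\<lfloor>x\<rfloor> + 1"]) (simp only: P_def[symmetric] A_def[symmetric], auto)
  qed
qed

text \<open>Coordinates are rounded one after another, each time against the error accumulated so
  far. A step adds at most the squared norm of its column, and these add up to the squared
  Hilbert-Schmidt norm.\<close>

lemma lattice_rounding:
  fixes A :: "nat \<Rightarrow> nat \<Rightarrow> real" and x :: "nat \<Rightarrow> real"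
  shows "\<exists>z :: nat \<Rightarrow> int. (\<forall>j<n. \<bar>real_of_int (z j) - x j\<bar> \<le> 1) \<and>
    (\<Sum>i\<in>I. (\<Sum>j<n. A i j * (real_of_int (z j) - x j))\<^sup>2) \<le> (\<Sum>i\<in>I. \<Sum>j<n. (A i j)\<^sup>2)"
proof (induction n)
  case 0
  show ?case by simp
next
  case (Suc n)
  then obtain z where z: "\<forall>j<n. \<bar>real_of_int (z j) - x j\<bar> \<le> 1"
    and le: "(\<Sum>i\<in>I. (\<Sum>j<n. A i j * (real_of_int (z j) - x j))\<^sup>2) \<le> (\<Sum>i\<in>I. \<Sum>j<n. (A i j)\<^sup>2)"
    by blast
  obtain y where y: "\<bar>real_of_int y - x n\<bar> \<le> 1"
    and le2: "(\<Sum>i\<in>I. ((\<Sum>j<n. A i j * (real_of_int (z j) - x j)) + (real_of_int y - x n) * A i n)\<^sup>2) \<le>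
      (\<Sum>i\<in>I. (\<Sum>j<n. A i j * (real_of_int (z j) - x j))\<^sup>2) + (\<Sum>i\<in>I. (A i n)\<^sup>2)"
    using rounding_step[where x = "x n" and I = I and a = "\<lambda>i. A i n" and
      p = "\<lambda>i. \<Sum>j<n. A i j * (real_of_int (z j) - x j)"] by blast
  define z' where "z' = z(n := y)"
  have "(\<Sum>j<Suc n. A i j * (real_of_int (z' j) - x j)) =
      (\<Sum>j<n. A i j * (real_of_int (z j) - x j)) + (real_of_int y - x n) * A i n" for i
    by (simp add: z'_def mult.commute)
  hence "(\<Sum>i\<in>I. (\<Sum>j<Suc n. A i j * (real_of_int (z' j) - x j))\<^sup>2) \<le> (\<Sum>i\<in>I. \<Sum>j<Suc n. (A i j)\<^sup>2)"
    using le le2 by (simp add: sum.distrib)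
  moreover have "\<forall>j<Suc n. \<bar>real_of_int (z' j) - x j\<bar> \<le> 1" using z y by (auto simp: z'_def less_Suc_eq)
  ultimately show ?case by blast
qed

text \<open>With q = exp(-1/R), each side of the sum is at most q/(1 - q) = 1/(exp(1/R) - 1), which
  is at most \<open>R\<close>.\<close>

lemma sum_geometric_symmetric_le:
  fixes R :: real
  assumes R: "R > 0"
  shows "(\<Sum>z\<in>{-int m..int m}. exp (- \<bar>real_of_int z\<bar> / R)) \<le> 1 + 2 * R"
proof -
  define q where "q = exp (- 1 / R)"
  have q: "0 < q" "q < 1" using R by (auto simp: q_def)
  have qR: "q / (1 - q) \<le> R"
  proof -
    have "1 + 1 / R \<le> exp (1 / R)" by (rule exp_ge_add_one_self)
    hence "1 + 1 / R \<le> 1 / q" by (simp add: q_def exp_minus field_simps)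
    hence "q * (1 + 1 / R) \<le> 1" using q by (simp add: field_simps)
    hence "q / R \<le> 1 - q" by (simp add: algebra_simps)
    thus ?thesis using q R by (simp add: field_simps)
  qed
  have e: "exp (- (real k / R)) = q ^ k" for k :: nat
    by (simp add: q_def flip: exp_of_nat_mult)
  have geo: "(\<Sum>k=1..m. q ^ k) \<le> R"
  proof -
    have "(\<Sum>k=1..m. q ^ k) = q * (\<Sum>k<m. q ^ k)"
      by (simp add: sum.atLeast1_atMost_eq sum_distrib_left)
    also have "\<dots> = q * ((1 - q ^ m) / (1 - q))"
      using q by (simp add: sum_gp_strict)
    also have "\<dots> \<le> q * (1 / (1 - q))"
      using q by (intro mult_left_mono divide_right_mono) auto
    finally show ?thesis using qR by simp
  qed
  have split: "{-int m..int m} = insert 0 (int ` {1..m} \<union> (\<lambda>k. - int k) ` {1..m})"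
  proof (intro equalityI subsetI)
    fix z :: int assume z: "z \<in> {-int m..int m}"
    show "z \<in> insert 0 (int ` {1..m} \<union> (\<lambda>k. - int k) ` {1..m})"
    proof (cases z "0 :: int" rule: linorder_cases)
      case less
      hence "z = - int (nat (- z))" "nat (-z) \<in> {1..m}" using z by auto
      thus ?thesis by blast
    next
      case greater
      hence "z = int (nat z)" "nat z \<in> {1..m}" using z by auto
      thus ?thesis by blast
    qed simp
  qed auto
  have "(\<Sum>z\<in>{-int m..int m}. exp (- \<bar>real_of_int z\<bar> / R)) =
      1 + ((\<Sum>k=1..m. q ^ k) + (\<Sum>k=1..m. q ^ k))"
    unfolding split
    by (subst sum.insert, simp, force, subst sum.union_disjoint)
      (auto simp: sum.reindex inj_on_def e)
  thus ?thesis using geo by simp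
qed

text \<open>An exponential Markov bound for counting: the weight exp(n - |z|_1/R) is at least 1 on
  \<open>Z\<close>, and its sum over the box factorizes over coordinates. The result is uniform in
  the box size \<open>m\<close>.\<close>

lemma card_lattice_l1_ball:
  fixes R :: real and m n :: nat
  assumes R: "R > 0"
  defines "Z \<equiv> {z \<in> {..<n} \<rightarrow>\<^sub>E {-int m..int m}. (\<Sum>j<n. \<bar>real_of_int (z j)\<bar>) \<le> R * real n}"
  shows "finite Z" "real (card Z) \<le> (exp 1 * (1 + 2 * R)) ^ n"
proof -
  let ?E = "{..<n} \<rightarrow>\<^sub>E {-int m..int m}"
  have fin: "finite ?E" by (intro finite_PiE) auto
  thus finZ: "finite Z" by (simp add: Z_def)
  have "real (card Z) = (\<Sum>z\<in>Z. 1)" by simp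
  also have "\<dots> \<le> (\<Sum>z\<in>Z. exp (real n) * (\<Prod>j<n. exp (- \<bar>real_of_int (z j)\<bar> / R)))"
  proof (rule sum_mono)
    fix z assume "z \<in> Z"
    hence "(\<Sum>j<n. \<bar>real_of_int (z j)\<bar>) / R \<le> n" using R by (simp add: Z_def field_simps)
    hence "0 \<le> real n + (\<Sum>j<n. - \<bar>real_of_int (z j)\<bar> / R)"
      by (simp add: sum_divide_distrib sum_negf)
    moreover have "exp (real n) * (\<Prod>j<n. exp (- \<bar>real_of_int (z j)\<bar> / R)) =
        exp (real n + (\<Sum>j<n. - \<bar>real_of_int (z j)\<bar> / R))"
      by (simp add: exp_add exp_sum)
    ultimately show "1 \<le> exp (real n) * (\<Prod>j<n. exp (- \<bar>real_of_int (z j)\<bar> / R))"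
      by simp
  qed
  also have "\<dots> \<le> (\<Sum>z\<in>?E. exp (real n) * (\<Prod>j<n. exp (- \<bar>real_of_int (z j)\<bar> / R)))"
    by (rule sum_mono2[OF fin]) (simp_all add: Z_def prod_nonneg)
  also have "\<dots> = exp (real n) * (\<Prod>j<n. \<Sum>y\<in>{-int m..int m}. exp (- \<bar>real_of_int y\<bar> / R))"
    by (subst prod_sum_PiE) (auto simp: sum_distrib_left)
  also have "\<dots> \<le> exp (real n) * (\<Prod>j<n. 1 + 2 * R)"
    using sum_geometric_symmetric_le[OF R]
    by (intro mult_left_mono prod_mono conjI sum_nonneg) auto
  also have "\<dots> = (exp 1 * (1 + 2 * R)) ^ n"
    by (simp add: power_mult_distrib flip: exp_of_nat_mult)
  finally show "real (card Z) \<le> (exp 1 * (1 + 2 * R)) ^ n" .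
qed

subsection \<open>Independent events and sums of squares\<close>

context prob_space
begin

text \<open>The generating function of the number of events that occur, from which both tail bounds
  below follow. Independence of the events is phrased through real indicators so that the product
  rule for expectations applies.\<close>

lemma expectation_power_count:
  fixes A :: "'i \<Rightarrow> 'a \<Rightarrow> bool" and t :: real
  assumes I: "finite I" and t: "t \<ge> 0"
    and ind: "indep_vars (\<lambda>_. borel) (\<lambda>i \<omega>. of_bool (A i \<omega>) :: real) I"
  shows "expectation (\<lambda>\<omega>. t ^ card {i \<in> I. A i \<omega>}) = (\<Prod>i\<in>I. 1 + (t - 1) * prob {\<omega> \<in> space M. A i \<omega>})"
    and "integrable M (\<lambda>\<omega>. t ^ card {i \<in> I. A i \<omega>})"
proof -
  define Z where "Z i \<omega> = 1 + (t - 1) * of_bool (A i \<omega>)" for i \<omega>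
  have rv: "random_variable borel (\<lambda>\<omega>. of_bool (A i \<omega>) :: real)" if "i \<in> I" for i
    using ind that by (auto simp: indep_vars_def)
  have indZ: "indep_vars (\<lambda>_. borel) Z I"
    unfolding Z_def by (rule indep_vars_compose2[OF ind]) auto
  have intA: "integrable M (\<lambda>\<omega>. of_bool (A i \<omega>) :: real)" if "i \<in> I" for i
    by (rule integrable_const_bound[of _ 1]) (use rv[OF that] in auto)
  have intZ: "integrable M (Z i)" if "i \<in> I" for i
    unfolding Z_def using intA[OF that] by auto
  have eZ: "expectation (Z i) = 1 + (t - 1) * prob {\<omega> \<in> space M. A i \<omega>}" if i: "i \<in> I" for i
  proof -
    have "(\<lambda>\<omega>. of_bool (A i \<omega>) :: real) -` {1} \<inter> space M \<in> events"
      using rv[OF i] by (rule measurable_sets) auto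
    also have "(\<lambda>\<omega>. of_bool (A i \<omega>) :: real) -` {1} \<inter> space M = {\<omega> \<in> space M. A i \<omega>}" by auto
    finally have "{\<omega> \<in> space M. A i \<omega>} \<in> events" .
    have "expectation (\<lambda>\<omega>. of_bool (A i \<omega>) :: real) = expectation (indicator {\<omega> \<in> space M. A i \<omega>})"
      by (rule Bochner_Integration.integral_cong) (auto simp: indicator_def)
    also have "\<dots> = prob {\<omega> \<in> space M. A i \<omega>}" using \<open>{\<omega> \<in> space M. A i \<omega>} \<in> events\<close> by simp
    finally show ?thesis unfolding Z_def using intA[OF i] prob_space by simp
  qed
  have pw: "(\<Prod>i\<in>I. Z i \<omega>) = t ^ card {i \<in> I. A i \<omega>}" for \<omega>
  proof -
    have "(\<Prod>i\<in>I. Z i \<omega>) = (\<Prod>i\<in>I. if A i \<omega> then t else 1)"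
      by (rule prod.cong) (auto simp: Z_def)
    also have "\<dots> = t ^ card {i \<in> I. A i \<omega>}"
      using I by (simp add: prod.If_cases Int_def)
    finally show ?thesis .
  qed
  show "expectation (\<lambda>\<omega>. t ^ card {i \<in> I. A i \<omega>}) = (\<Prod>i\<in>I. 1 + (t - 1) * prob {\<omega> \<in> space M. A i \<omega>})"
    using indep_vars_lebesgue_integral[OF I indZ intZ] eZ by (simp add: pw)
  show "integrable M (\<lambda>\<omega>. t ^ card {i \<in> I. A i \<omega>})"
    using indep_vars_integrable[OF I indZ intZ] by (simp add: pw)
qed

text \<open>Read off from the measurability of 2^count, since the power is strictly
  increasing.\<close>

lemma count_ge_event:
  fixes A :: "'i \<Rightarrow> 'a \<Rightarrow> bool"
  assumes I: "finite I" and ind: "indep_vars (\<lambda>_. borel) (\<lambda>i \<omega>. of_bool (A i \<omega>) :: real) I"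
  shows "{\<omega> \<in> space M. m \<le> card {i \<in> I. A i \<omega>}} \<in> events"
proof -
  have "(\<lambda>\<omega>. (2::real) ^ card {i \<in> I. A i \<omega>}) \<in> borel_measurable M"
    using expectation_power_count(2)[OF I _ ind, of 2] by auto
  hence "{\<omega> \<in> space M. 2 ^ m \<le> (2::real) ^ card {i \<in> I. A i \<omega>}} \<in> events"
    unfolding borel_measurable_iff_ge by blast
  thus ?thesis by simp
qed

text \<open>Exponential Markov with t = 1/p, for which each factor 1 + (1/p - 1) p is at most 2. The
  full power p^m survives, and this is what competes with the size of the net.\<close>

lemma prob_count_ge_le:
  fixes A :: "'i \<Rightarrow> 'a \<Rightarrow> bool"
  assumes I: "finite I" and ind: "indep_vars (\<lambda>_. borel) (\<lambda>i \<omega>. of_bool (A i \<omega>) :: real) I"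
    and p: "0 < p" "p \<le> 1" "\<And>i. i \<in> I \<Longrightarrow> prob {\<omega> \<in> space M. A i \<omega>} \<le> p"
  shows "prob {\<omega> \<in> space M. m \<le> card {i \<in> I. A i \<omega>}} \<le> 2 ^ card I * p ^ m"
proof -
  have t: "1 / p \<ge> 0" "1 / p \<ge> 1" using p by auto
  note ex = expectation_power_count[OF I t(1) ind]
  have "prob {\<omega> \<in> space M. m \<le> card {i \<in> I. A i \<omega>}} \<le>
      prob {\<omega> \<in> space M. (1 / p) ^ m \<le> (1 / p) ^ card {i \<in> I. A i \<omega>}}"
    using ex(2) t by (intro finite_measure_mono) (auto intro!: power_increasing)
  also have "\<dots> \<le> expectation (\<lambda>\<omega>. (1 / p) ^ card {i \<in> I. A i \<omega>}) / (1 / p) ^ m"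
    using ex(2) t p by (intro integral_Markov_inequality_measure[where A = "{}"]) auto
  also have "\<dots> = (\<Prod>i\<in>I. 1 + (1 / p - 1) * prob {\<omega> \<in> space M. A i \<omega>}) * p ^ m"
    unfolding ex(1) using p by (simp add: power_divide)
  also have "\<dots> \<le> (\<Prod>i\<in>I. 2) * p ^ m"
  proof (intro mult_right_mono prod_mono conjI)
    fix i assume i: "i \<in> I"
    show "0 \<le> 1 + (1 / p - 1) * prob {\<omega> \<in> space M. A i \<omega>}" using t by (simp add: add_nonneg_nonneg)
    have "(1 / p - 1) * prob {\<omega> \<in> space M. A i \<omega>} \<le> (1 / p - 1) * p"
      using p(3)[OF i] t by (intro mult_left_mono) auto
    also have "\<dots> \<le> 1" using p by (simp add: field_simps)
    finally show "1 + (1 / p - 1) * prob {\<omega> \<in> space M. A i \<omega>} \<le> 2" by simp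
  qed (use p in auto)
  finally show ?thesis by simp
qed

text \<open>Exponential Markov with t = 1/2. The factor \<open>2 ^ m\<close> is affordable when
  \<open>m\<close> is small compared with \<open>card I\<close>, as for m = 2k = o(n).\<close>

lemma prob_count_less_le:
  fixes A :: "'i \<Rightarrow> 'a \<Rightarrow> bool"
  assumes I: "finite I" and ind: "indep_vars (\<lambda>_. borel) (\<lambda>i \<omega>. of_bool (A i \<omega>) :: real) I"
    and p: "0 < p" "\<And>i. i \<in> I \<Longrightarrow> prob {\<omega> \<in> space M. A i \<omega>} \<ge> p"
  shows "prob {\<omega> \<in> space M. card {i \<in> I. A i \<omega>} < m} \<le> 2 ^ m * (1 - p / 2) ^ card I"
proof -
  have t: "1 / 2 \<ge> (0::real)" by simp
  note ex = expectation_power_count[OF I t ind]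
  have "prob {\<omega> \<in> space M. card {i \<in> I. A i \<omega>} < m} \<le>
      prob {\<omega> \<in> space M. (1 / 2) ^ m \<le> (1 / 2 :: real) ^ card {i \<in> I. A i \<omega>}}"
  proof (rule finite_measure_mono)
    show "{\<omega> \<in> space M. (1 / 2) ^ m \<le> (1 / 2 :: real) ^ card {i \<in> I. A i \<omega>}} \<in> events"
      using borel_measurable_integrable[OF ex(2)] by measurable
  qed (auto intro!: power_decreasing)
  also have "\<dots> \<le> expectation (\<lambda>\<omega>. (1 / 2) ^ card {i \<in> I. A i \<omega>}) / (1 / 2) ^ m"
    using ex(2) by (intro integral_Markov_inequality_measure[where A = "{}"]) auto
  also have "\<dots> = 2 ^ m * (\<Prod>i\<in>I. 1 + (1 / 2 - 1) * prob {\<omega> \<in> space M. A i \<omega>})"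
    unfolding ex(1) by (simp add: power_divide)
  also have "\<dots> \<le> 2 ^ m * (\<Prod>i\<in>I. 1 - p / 2)"
  proof (intro mult_left_mono prod_mono conjI)
    fix i assume i: "i \<in> I"
    have h: "1 + (1 / 2 - 1) * prob {\<omega> \<in> space M. A i \<omega>} = 1 - prob {\<omega> \<in> space M. A i \<omega>} / 2"
      by simp
    have "prob {\<omega> \<in> space M. A i \<omega>} \<le> 1" by simp
    thus "0 \<le> 1 + (1 / 2 - 1) * prob {\<omega> \<in> space M. A i \<omega>}" unfolding h by linarith
    show "1 + (1 / 2 - 1) * prob {\<omega> \<in> space M. A i \<omega>} \<le> 1 - p / 2"
      unfolding h using p(2)[OF i] by linarith
  qed auto
  finally show ?thesis by simp
qed

section \<open>Sums of squares through the Laplace transform\<close>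

lemma laplace_sum_squares:
  fixes X :: "'i \<Rightarrow> 'a \<Rightarrow> real"
  assumes I: "finite I" and ind: "indep_vars (\<lambda>_. borel) X I"
    and law: "\<And>i. i \<in> I \<Longrightarrow> distr M borel (X i) = D" and l: "l > 0"
    and K: "(\<integral>x. exp (- l * x\<^sup>2) \<partial>D) \<ge> 1 - \<epsilon>" "\<epsilon> \<le> 1"
  shows "(1 - \<epsilon>) ^ card I \<le> expectation (\<lambda>\<omega>. exp (- l * (\<Sum>i\<in>I. (X i \<omega>)\<^sup>2)))"
    and "integrable M (\<lambda>\<omega>. exp (- l * (\<Sum>i\<in>I. (X i \<omega>)\<^sup>2)))"
proof -
  define Z where "Z i \<omega> = exp (- l * (X i \<omega>)\<^sup>2)" for i \<omega>
  have rv: "random_variable borel (X i)" if "i \<in> I" for i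
    using ind that by (auto simp: indep_vars_def)
  have indZ: "indep_vars (\<lambda>_. borel) Z I"
    unfolding Z_def by (rule indep_vars_compose2[OF ind]) auto
  have intZ: "integrable M (Z i)" if "i \<in> I" for i
    unfolding Z_def using l by (intro integrable_const_bound[of _ 1]) (use rv[OF that] in auto)
  have eZ: "expectation (Z i) \<ge> 1 - \<epsilon>" if i: "i \<in> I" for i
  proof -
    have "(\<integral>x. exp (- l * x\<^sup>2) \<partial>D) = expectation (Z i)"
      unfolding law[OF i, symmetric] Z_def using rv[OF i] by (subst integral_distr) auto
    thus ?thesis using K by simp
  qed
  have pw: "(\<Prod>i\<in>I. Z i \<omega>) = exp (- l * (\<Sum>i\<in>I. (X i \<omega>)\<^sup>2))" for \<omega>
    unfolding Z_def by (simp add: exp_sum[OF I, symmetric] sum_distrib_left sum_negf)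
  have "(1 - \<epsilon>) ^ card I = (\<Prod>i\<in>I. 1 - \<epsilon>)" by simp
  also have "\<dots> \<le> (\<Prod>i\<in>I. expectation (Z i))"
    using K eZ by (intro prod_mono) auto
  also have "\<dots> = expectation (\<lambda>\<omega>. exp (- l * (\<Sum>i\<in>I. (X i \<omega>)\<^sup>2)))"
    using indep_vars_lebesgue_integral[OF I indZ intZ] by (simp add: pw)
  finally show "(1 - \<epsilon>) ^ card I \<le> expectation (\<lambda>\<omega>. exp (- l * (\<Sum>i\<in>I. (X i \<omega>)\<^sup>2)))" .
  show "integrable M (\<lambda>\<omega>. exp (- l * (\<Sum>i\<in>I. (X i \<omega>)\<^sup>2)))"
    using indep_vars_integrable[OF I indZ intZ] by (simp add: pw)
qed

text \<open>Expectation of exp(-l S) \<le> 1[S \<le> r] + exp(-l r). Informative when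
  \<open>l\<close> is so large that the last term loses against the transform.\<close>

lemma prob_sum_squares_le:
  fixes X :: "'i \<Rightarrow> 'a \<Rightarrow> real"
  assumes I: "finite I" and ind: "indep_vars (\<lambda>_. borel) X I"
    and law: "\<And>i. i \<in> I \<Longrightarrow> distr M borel (X i) = D" and l: "l > 0"
    and K: "(\<integral>x. exp (- l * x\<^sup>2) \<partial>D) \<ge> 1 - \<epsilon>" "\<epsilon> \<le> 1"
  shows "prob {\<omega> \<in> space M. (\<Sum>i\<in>I. (X i \<omega>)\<^sup>2) \<le> r} \<ge> (1 - \<epsilon>) ^ card I - exp (- l * r)"
proof -
  have [measurable]: "random_variable borel (\<lambda>\<omega>. \<Sum>i\<in>I. (X i \<omega>)\<^sup>2)"
    using ind by (intro borel_measurable_sum borel_measurable_power) (auto simp: indep_vars_def)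
  define B where "B = {\<omega> \<in> space M. (\<Sum>i\<in>I. (X i \<omega>)\<^sup>2) \<le> r}"
  have B[measurable]: "B \<in> events" unfolding B_def by measurable
  note lap = laplace_sum_squares[OF assms]
  have "(1 - \<epsilon>) ^ card I \<le> expectation (\<lambda>\<omega>. exp (- l * (\<Sum>i\<in>I. (X i \<omega>)\<^sup>2)))" by (rule lap(1))
  also have "\<dots> \<le> expectation (\<lambda>\<omega>. indicator B \<omega> + exp (- l * r))"
  proof (rule integral_mono[OF lap(2)])
    show "integrable M (\<lambda>\<omega>. indicator B \<omega> + exp (- l * r))"
      using B by (intro Bochner_Integration.integrable_add integrable_real_indicator)
        (auto simp: emeasure_eq_measure)
    fix \<omega> assume "\<omega> \<in> space M"
    show "exp (- l * (\<Sum>i\<in>I. (X i \<omega>)\<^sup>2)) \<le> indicator B \<omega> + exp (- l * r)"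
    proof (cases "\<omega> \<in> B")
      case True
      have "exp (- l * (\<Sum>i\<in>I. (X i \<omega>)\<^sup>2)) \<le> 1" using l by (simp add: sum_nonneg)
      thus ?thesis using True by (simp add: add_increasing2)
    next
      case False
      thus ?thesis using l \<open>\<omega> \<in> space M\<close> by (simp add: B_def)
    qed
  qed
  also have "\<dots> = prob B + exp (- l * r)"
  proof -
    have "integrable M (indicator B :: 'a \<Rightarrow> real)"
      using B by (intro integrable_real_indicator) (auto simp: emeasure_eq_measure)
    thus ?thesis using B prob_space by simp
  qed
  finally show ?thesis by (simp add: B_def)
qed

text \<open>At l = 1/r the exponential is at most 1/e, hence at most 1/2, on the event, so the event
  takes at least half of its probability away from the transform. Bernoulli's inequality bounds the
  transform from below.\<close>

lemma prob_sum_squares_gt: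
  fixes X :: "'i \<Rightarrow> 'a \<Rightarrow> real"
  assumes I: "finite I" and ind: "indep_vars (\<lambda>_. borel) X I"
    and law: "\<And>i. i \<in> I \<Longrightarrow> distr M borel (X i) = D" and r: "r > 0"
    and K: "(\<integral>x. exp (- (1 / r) * x\<^sup>2) \<partial>D) \<ge> 1 - \<epsilon>" "\<epsilon> \<le> 1"
  shows "prob {\<omega> \<in> space M. (\<Sum>i\<in>I. (X i \<omega>)\<^sup>2) > r} \<le> 2 * (real (card I) * \<epsilon>)"
proof -
  have [measurable]: "random_variable borel (\<lambda>\<omega>. \<Sum>i\<in>I. (X i \<omega>)\<^sup>2)"
    using ind by (intro borel_measurable_sum borel_measurable_power) (auto simp: indep_vars_def)
  define B where "B = {\<omega> \<in> space M. (\<Sum>i\<in>I. (X i \<omega>)\<^sup>2) > r}"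
  have B[measurable]: "B \<in> events" unfolding B_def by measurable
  have intB: "integrable M (indicator B :: 'a \<Rightarrow> real)"
    using B by (intro integrable_real_indicator) (auto simp: emeasure_eq_measure)
  have l: "1 / r > 0" using r by simp
  note lap = laplace_sum_squares[OF I ind law l K]
  have "1 - real (card I) * \<epsilon> \<le> (1 - \<epsilon>) ^ card I"
    using Bernoulli_inequality[of "- \<epsilon>" "card I"] K by simp
  also have "\<dots> \<le> expectation (\<lambda>\<omega>. exp (- (1 / r) * (\<Sum>i\<in>I. (X i \<omega>)\<^sup>2)))" by (rule lap(1))
  also have "\<dots> \<le> expectation (\<lambda>\<omega>. 1 - 1 / 2 * indicator B \<omega>)"
  proof (rule integral_mono[OF lap(2)])
    show "integrable M (\<lambda>\<omega>. 1 - 1 / 2 * indicator B \<omega> :: real)" using intB by simp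
    fix \<omega> assume "\<omega> \<in> space M"
    show "exp (- (1 / r) * (\<Sum>i\<in>I. (X i \<omega>)\<^sup>2)) \<le> 1 - 1 / 2 * indicator B \<omega>"
    proof (cases "\<omega> \<in> B")
      case True
      hence "1 \<le> 1 / r * (\<Sum>i\<in>I. (X i \<omega>)\<^sup>2)" using r by (simp add: B_def)
      hence "exp (- (1 / r) * (\<Sum>i\<in>I. (X i \<omega>)\<^sup>2)) \<le> exp (- 1)" by simp
      also have "\<dots> \<le> 1 / (2::real)" using exp_ge_add_one_self[of "1::real"] by (simp add: exp_minus field_simps)
      finally show ?thesis using True by simp
    next
      case False
      thus ?thesis using r by (simp add: sum_nonneg)
    qed
  qed
  also have "\<dots> = 1 - 1 / 2 * prob B" using intB B prob_space by simp
  finally show ?thesis by (simp add: B_def)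
qed

end

section \<open>Independence along rows and columns\<close>

lemma iid_random_matrix_row:
  assumes X: "iid_random_matrix M D N n X" and i: "i < N"
  shows "prob_space.indep_vars M (\<lambda>_. borel) (\<lambda>j \<omega>. X \<omega> $$ (i, j)) {..<n}"
    and "j < n \<Longrightarrow> distr M borel (\<lambda>\<omega>. X \<omega> $$ (i, j)) = D"
proof -
  interpret prob_space M using X by (simp add: iid_random_matrix_def)
  have ind: "indep_vars (\<lambda>_. borel) (\<lambda>ij \<omega>. X \<omega> $$ ij) ({..<N} \<times> {..<n})"
    using X by (simp add: iid_random_matrix_def)
  show "indep_vars (\<lambda>_. borel) (\<lambda>j \<omega>. X \<omega> $$ (i, j)) {..<n}"
    by (rule indep_vars_compose2[OF indep_vars_restrict[OF ind, where L = "{..<n}" and K = "\<lambda>j. {(i, j)}"],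
        where Y = "\<lambda>j x. x (i, j)" and N = "\<lambda>_. borel", simplified])
      (use i in \<open>auto simp: disjoint_family_on_def\<close>)
  show "j < n \<Longrightarrow> distr M borel (\<lambda>\<omega>. X \<omega> $$ (i, j)) = D"
    using X i by (auto simp: iid_random_matrix_def)
qed

lemma iid_random_matrix_column:
  assumes X: "iid_random_matrix M D N n X" and j: "j < n"
  shows "prob_space.indep_vars M (\<lambda>_. borel) (\<lambda>i \<omega>. X \<omega> $$ (i, j)) {..<N}"
proof -
  interpret prob_space M using X by (simp add: iid_random_matrix_def)
  have ind: "indep_vars (\<lambda>_. borel) (\<lambda>ij \<omega>. X \<omega> $$ ij) ({..<N} \<times> {..<n})"
    using X by (simp add: iid_random_matrix_def)
  show "indep_vars (\<lambda>_. borel) (\<lambda>i \<omega>. X \<omega> $$ (i, j)) {..<N}"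
    by (rule indep_vars_compose2[OF indep_vars_restrict[OF ind, where L = "{..<N}" and K = "\<lambda>i. {(i, j)}"],
        where Y = "\<lambda>i x. x (i, j)" and N = "\<lambda>_. borel", simplified])
      (use j in \<open>auto simp: disjoint_family_on_def\<close>)
qed

text \<open>Distinct rows read disjoint blocks of entries, so functions of the restrictions to these
  blocks are independent. The column version below is the same with blocks transposed.\<close>

lemma iid_random_matrix_indep_row_events:
  assumes X: "iid_random_matrix M D N n X"
  shows "prob_space.indep_vars M (\<lambda>_. borel)
    (\<lambda>i \<omega>. of_bool (\<bar>\<Sum>j<n. X \<omega> $$ (i, j) * w j\<bar> \<le> r) :: real) {..<N}"
proof -
  interpret prob_space M using X by (simp add: iid_random_matrix_def)
  have ind: "indep_vars (\<lambda>_. borel) (\<lambda>ij \<omega>. X \<omega> $$ ij) ({..<N} \<times> {..<n})"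
    using X by (simp add: iid_random_matrix_def)
  have "indep_vars (\<lambda>i. PiM ({i} \<times> {..<n}) (\<lambda>_. borel))
      (\<lambda>i \<omega>. restrict (\<lambda>ij. X \<omega> $$ ij) ({i} \<times> {..<n})) {..<N}"
    by (rule indep_vars_restrict[OF ind]) (auto simp: disjoint_family_on_def)
  hence "indep_vars (\<lambda>_. borel) (\<lambda>i \<omega>. of_bool (\<bar>\<Sum>j<n.
      restrict (\<lambda>ij. X \<omega> $$ ij) ({i} \<times> {..<n}) (i, j) * w j\<bar> \<le> r) :: real) {..<N}"
    by (rule indep_vars_compose2[where Y = "\<lambda>i x. of_bool (\<bar>\<Sum>j<n. x (i, j) * w j\<bar> \<le> r)"]) measurable
  thus ?thesis by (subst indep_vars_cong[where J = "{..<N}" and N' = "\<lambda>_. borel"]) auto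
qed

lemma iid_random_matrix_indep_column_events:
  assumes X: "iid_random_matrix M D N n X"
  shows "prob_space.indep_vars M (\<lambda>_. borel)
    (\<lambda>j \<omega>. of_bool ((\<Sum>i<N. (X \<omega> $$ (i, j))\<^sup>2) \<le> r) :: real) {..<n}"
proof -
  interpret prob_space M using X by (simp add: iid_random_matrix_def)
  have ind: "indep_vars (\<lambda>_. borel) (\<lambda>ij \<omega>. X \<omega> $$ ij) ({..<N} \<times> {..<n})"
    using X by (simp add: iid_random_matrix_def)
  have "indep_vars (\<lambda>j. PiM ({..<N} \<times> {j}) (\<lambda>_. borel))
      (\<lambda>j \<omega>. restrict (\<lambda>ij. X \<omega> $$ ij) ({..<N} \<times> {j})) {..<n}"
    by (rule indep_vars_restrict[OF ind]) (auto simp: disjoint_family_on_def)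
  hence "indep_vars (\<lambda>_. borel) (\<lambda>j \<omega>. of_bool ((\<Sum>i<N.
      (restrict (\<lambda>ij. X \<omega> $$ ij) ({..<N} \<times> {j}) (i, j))\<^sup>2) \<le> r) :: real) {..<n}"
    by (rule indep_vars_compose2[where Y = "\<lambda>j x. of_bool ((\<Sum>i<N. (x (i, j))\<^sup>2) \<le> r)"]) measurable
  thus ?thesis by (subst indep_vars_cong[where J = "{..<n}" and N' = "\<lambda>_. borel"]) auto
qed

subsection \<open>Columns, rows and the net of a random matrix\<close>

text \<open>The transform of the column sum at l/b^2 is at least exp(-B l^(\<alpha>/2)), while the
  error term is exp(-l c^2). As \<alpha>/2 < 1, a large \<open>l\<close> makes the former win for
  any fixed \<open>c\<close>.\<close>

lemma column_small_probability:
  fixes D :: "real measure"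
  assumes law: "heavy_tailed_law \<alpha> D" and \<alpha>: "0 < \<alpha>" "\<alpha> < 2" and a: "a > 0" and c: "c > 0"
  obtains p n0 where "0 < p" "\<And>n N (M :: 'w measure) X j. n \<ge> n0 \<Longrightarrow> real N \<le> 2 * a * real n \<Longrightarrow>
    iid_random_matrix M D N n X \<Longrightarrow> j < n \<Longrightarrow>
    p \<le> measure M {\<omega> \<in> space M. (\<Sum>i<N. (X \<omega> $$ (i, j))\<^sup>2) \<le> (c * real n powr (1 / \<alpha>))\<^sup>2}"
proof -
  obtain K where K: "K > 0" "\<And>l. l > 0 \<Longrightarrow> (\<integral>x. exp (- l * x\<^sup>2) \<partial>D) \<ge> 1 - K * l powr (\<alpha> / 2)"
    using laplace_square_heavy_tailed[OF law \<alpha>] by blast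
  \<comment> \<open>One factor 2 comes from N \<le> 2 a n, the other from ln(1 - y) \<ge> -2 y on
    [0, 1/2].\<close>
  define B where "B = 4 * a * K"
  define q where "q = (1 + B) / c\<^sup>2"
  \<comment> \<open>Makes l^(1 - \<alpha>/2) at least (1 + B)/c^2, which yields 1 + B l^(\<alpha>/2)
    \<le> l c^2. The extra 1 in the exponent provides a factor 2, through e \<ge> 2.\<close>
  define l where "l = max 1 (q powr (1 / (1 - \<alpha> / 2)))"
  have B: "B > 0" using a K by (simp add: B_def)
  have q: "q > 0" using B c by (simp add: q_def)
  have l: "l \<ge> 1" by (simp add: l_def)
  have "q = (q powr (1 / (1 - \<alpha> / 2))) powr (1 - \<alpha> / 2)" using q \<alpha> by (simp add: powr_powr)
  also have "\<dots> \<le> l powr (1 - \<alpha> / 2)" using \<alpha> by (intro powr_mono2) (auto simp: l_def)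
  finally have "l powr (\<alpha> / 2) * q \<le> l powr (\<alpha> / 2) * l powr (1 - \<alpha> / 2)"
    by (intro mult_left_mono) auto
  also have "\<dots> = l" using l by (simp flip: powr_add)
  finally have "l powr (\<alpha> / 2) * (1 + B) \<le> l * c\<^sup>2" using c by (simp add: q_def field_simps)
  moreover have "1 \<le> l powr (\<alpha> / 2)" using l \<alpha> by (simp add: ge_one_powr_ge_zero)
  ultimately have lc: "1 + B * l powr (\<alpha> / 2) \<le> l * c\<^sup>2" by (simp add: algebra_simps)
  define x where "x = K * l powr (\<alpha> / 2)"
  have x: "x > 0" using K l by (simp add: x_def)
  show thesis
  \<comment> \<open>The transform is at least 2 exp(-l c^2), and subtracting the error leaves this
    value of \<open>p\<close>. The threshold on \<open>n\<close> ensures x/n \<le> 1/2 for the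
    logarithm bound.\<close>
  proof (rule that[of "exp (- l * c\<^sup>2)" "nat \<lceil>2 * x\<rceil> + 1"])
    fix n N :: nat and M :: "'w measure" and X j
    assume n: "n \<ge> nat \<lceil>2 * x\<rceil> + 1" and N: "real N \<le> 2 * a * real n"
      and iid: "iid_random_matrix M D N n X" and j: "j < n"
    interpret prob_space M using iid by (simp add: iid_random_matrix_def)
    define b where "b = real n powr (1 / \<alpha>)"
    have n2: "real n \<ge> 2 * x" "n \<ge> 1" using n by linarith+
    have b: "b > 0" using n2 by (simp add: b_def)
    have b2: "(b\<^sup>2) powr (\<alpha> / 2) = n"
    proof -
      have "(b\<^sup>2) powr (\<alpha> / 2) = (b powr 2) powr (\<alpha> / 2)" using b by simp
      also have "\<dots> = n" using \<alpha> n2 by (simp add: powr_powr b_def)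
      finally show ?thesis .
    qed
    have eps: "K * (l / b\<^sup>2) powr (\<alpha> / 2) = x / n"
      using b l by (simp add: powr_divide b2 x_def)
    have e1: "x / n \<le> 1/2" using n2 by (simp add: field_simps)
    have l0: "l / b\<^sup>2 > 0" using l b by simp
    have h: "prob {\<omega> \<in> space M. (\<Sum>i\<in>{..<N}. (X \<omega> $$ (i, j))\<^sup>2) \<le> (c * b)\<^sup>2} \<ge>
        (1 - x / n) ^ card {..<N} - exp (- (l / b\<^sup>2) * (c * b)\<^sup>2)"
    proof (rule prob_sum_squares_le[OF _ iid_random_matrix_column[OF iid j] _ l0])
      show "(\<integral>x. exp (- (l / b\<^sup>2) * x\<^sup>2) \<partial>D) \<ge> 1 - x / n" using K(2)[OF l0] by (simp only: eps)
      show "x / n \<le> 1" using e1 by linarith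
    qed (use iid_random_matrix_row(2)[OF iid _ j] in auto)
    have "- (l / b\<^sup>2) * (c * b)\<^sup>2 = - (l * c\<^sup>2)" using b by (simp add: power_mult_distrib)
    hence 1: "prob {\<omega> \<in> space M. (\<Sum>i\<in>{..<N}. (X \<omega> $$ (i, j))\<^sup>2) \<le> (c * b)\<^sup>2} \<ge>
        (1 - x / n) ^ N - exp (- (l * c\<^sup>2))" using h by (simp only: card_lessThan)
    have "- (2 * (x / n)) \<le> ln (1 - x / n)"
    proof -
      have "x / n - 2 * (x / n)\<^sup>2 \<ge> 0"
      proof -
        have "(x / n) * (x / n) \<le> 1 / 2 * (x / n)" using e1 x by (intro mult_right_mono) auto
        thus ?thesis by (simp add: power2_eq_square)
      qed
      moreover have "- (x / n) - 2 * (x / n)\<^sup>2 \<le> ln (1 - x / n)"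
        using e1 x by (intro ln_one_minus_pos_lower_bound) auto
      ultimately show ?thesis by linarith
    qed
    moreover have "1 - x / n > 0" using e1 by linarith
    ultimately have "exp (- (2 * (x / n))) \<le> 1 - x / n" by (simp only: ln_ge_iff)
    hence "exp (- (2 * (x / n))) ^ N \<le> (1 - x / n) ^ N" by (intro power_mono) auto
    moreover have "exp (- (2 * (x / n))) ^ N \<ge> exp (- (B * l powr (\<alpha> / 2)))"
    proof -
      have "real N * (2 * (x / n)) \<le> 2 * a * real n * (2 * (x / n))"
        using N x by (intro mult_right_mono) auto
      also have "\<dots> = B * l powr (\<alpha> / 2)" using n2 by (simp add: B_def x_def)
      finally show ?thesis by (simp flip: exp_of_nat_mult)
    qed
    moreover have "exp (- (B * l powr (\<alpha> / 2))) \<ge> 2 * exp (- (l * c\<^sup>2))"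
    proof -
      have "2 * exp (- (l * c\<^sup>2)) \<le> exp 1 * exp (- (l * c\<^sup>2))"
        using exp_ge_add_one_self[of "1::real"] by (intro mult_right_mono) auto
      also have "\<dots> \<le> exp (- (B * l powr (\<alpha> / 2)))" using lc by (simp flip: exp_add)
      finally show ?thesis .
    qed
    ultimately show "exp (- l * c\<^sup>2) \<le>
        prob {\<omega> \<in> space M. (\<Sum>i<N. (X \<omega> $$ (i, j))\<^sup>2) \<le> (c * real n powr (1 / \<alpha>))\<^sup>2}"
      using 1 unfolding b_def by simp
  qed simp
qed

text \<open>Columns are independent and each is short with probability at least \<open>p\<close>, so
  having fewer than 2k short ones costs at most 2^(2k) (1 - p/2)^n; since k = o(n), the exponential
  decay prevails.\<close>

lemma few_small_columns_tendsto:
  fixes D :: "real measure" and M :: "nat \<Rightarrow> 'w measure"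
  assumes law: "heavy_tailed_law \<alpha> D" and \<alpha>: "0 < \<alpha>" "\<alpha> < 2" and a: "a > 0" and c: "c > 0"
    and N: "\<And>n. n \<ge> 1 \<Longrightarrow> real (N n) \<le> 2 * a * real n"
    and X: "\<And>n. n \<ge> 1 \<Longrightarrow> iid_random_matrix (M n) D (N n) n (X n)"
    and k: "(\<lambda>n. real (k n) / real n) \<longlonglongrightarrow> 0"
  shows "(\<lambda>n. measure (M n) {\<omega> \<in> space (M n).
    card {j \<in> {..<n}. (\<Sum>i<N n. (X n \<omega> $$ (i, j))\<^sup>2) \<le> (c * real n powr (1 / \<alpha>))\<^sup>2} < 2 * k n}) \<longlonglongrightarrow> 0"
proof -
  obtain p n0 where p: "0 < p" and col: "\<And>n N (M :: 'w measure) X j. n \<ge> n0 \<Longrightarrow> real N \<le> 2 * a * real n \<Longrightarrow>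
    iid_random_matrix M D N n X \<Longrightarrow> j < n \<Longrightarrow>
    p \<le> measure M {\<omega> \<in> space M. (\<Sum>i<N. (X \<omega> $$ (i, j))\<^sup>2) \<le> (c * real n powr (1 / \<alpha>))\<^sup>2}"
    using column_small_probability[OF law \<alpha> a c] by blast
  define n1 where "n1 = max n0 1"
  have n1: "n1 \<ge> n0" "n1 \<ge> 1" by (auto simp: n1_def)
  have "p \<le> 1"
  proof -
    interpret prob_space "M n1" using X[OF n1(2)] by (simp add: iid_random_matrix_def)
    have "0 < n1" using n1 by simp
    show ?thesis by (rule order_trans[OF col[OF n1(1) N[OF n1(2)] X[OF n1(2)] \<open>0 < n1\<close>] prob_le_1])
  qed
  define q where "q = 1 - p / 2"
  have q: "0 < q" "q < 1" using p \<open>p \<le> 1\<close> by (auto simp: q_def)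
  define e where "e = - ln q"
  have e: "e > 0" using q by (simp add: e_def)
  show ?thesis
  proof (rule tendsto_sandwich[OF _ _ tendsto_const])
    show "(\<lambda>n. exp (- e / 2) ^ n) \<longlonglongrightarrow> 0" using e by (intro LIMSEQ_realpow_zero) auto
    \<comment> \<open>This ratio makes 2 k ln 2 at most e n / 2, half of the available
      exponent.\<close>
    have "\<forall>\<^sub>F n in sequentially. real (k n) / real n < e / (4 * ln 2)"
      using e by (intro order_tendstoD(2)[OF k]) simp
    thus "\<forall>\<^sub>F n in sequentially. measure (M n) {\<omega> \<in> space (M n).
      card {j \<in> {..<n}. (\<Sum>i<N n. (X n \<omega> $$ (i, j))\<^sup>2) \<le> (c * real n powr (1 / \<alpha>))\<^sup>2} < 2 * k n}
      \<le> exp (- e / 2) ^ n"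
      using eventually_ge_at_top[of n1]
    proof eventually_elim
      case (elim n)
      hence n: "n \<ge> n0" "n \<ge> 1" using n1 by auto
      interpret prob_space "M n" using X[OF n(2)] by (simp add: iid_random_matrix_def)
      have "prob {\<omega> \<in> space (M n).
        card {j \<in> {..<n}. (\<Sum>i<N n. (X n \<omega> $$ (i, j))\<^sup>2) \<le> (c * real n powr (1 / \<alpha>))\<^sup>2} < 2 * k n}
        \<le> 2 ^ (2 * k n) * (1 - p / 2) ^ card {..<n}"
        using col[OF n(1) N[OF n(2)] X[OF n(2)]]
        by (intro prob_count_less_le iid_random_matrix_indep_column_events[OF X[OF n(2)]] p) auto
      also have "\<dots> = exp (real (2 * k n) * ln 2) * exp (- e * real n)"
      proof -
        have "exp (real (2 * k n) * ln 2) = (2::real) ^ (2 * k n)"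
          by (simp only: exp_of_nat_mult) simp
        moreover have "exp (- e * real n) = q ^ n"
          using q by (simp add: e_def mult.commute[of "ln q"] exp_of_nat_mult)
        ultimately show ?thesis by (simp add: q_def)
      qed
      also have "\<dots> \<le> exp (e / 2 * real n) * exp (- e * real n)"
      proof -
        have "real (k n) * (4 * ln 2) \<le> e * real n"
          using elim(1) n by (simp add: field_simps)
        thus ?thesis by simp
      qed
      also have "\<dots> = exp (real n * (- e / 2))" by (simp add: algebra_simps flip: exp_add)
      also have "\<dots> = exp (- e / 2) ^ n" by (rule exp_of_nat_mult)
      finally show ?case .
    qed
  qed simp
qed

text \<open>A row exceeds squared norm L b^2 with probability at most 2 K L^(-\<alpha>/2), uniformly
  in \<open>n\<close>; Markov's inequality for the number of such rows suffices. \<open>L\<close>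
  depends on the tolerance \<eta>, so this probability is small but need not tend to 0.\<close>

lemma long_rows_rare:
  fixes D :: "real measure"
  assumes law: "heavy_tailed_law \<alpha> D" and \<alpha>: "0 < \<alpha>" "\<alpha> < 2" and a: "a > 0"
    and \<theta>: "\<theta> > 0" and \<eta>: "\<eta> > 0"
  shows "\<exists>L>0. \<forall>n\<ge>1. \<forall>N (M :: 'w measure) X. real N \<le> 2 * a * real n \<longrightarrow>
    iid_random_matrix M D N n X \<longrightarrow>
    {\<omega> \<in> space M. \<theta> * real n < real (card {i \<in> {..<N}. (\<Sum>j<n. (X \<omega> $$ (i, j))\<^sup>2) >
      L * (real n powr (1 / \<alpha>))\<^sup>2})} \<in> sets M \<and>
    measure M {\<omega> \<in> space M. \<theta> * real n < real (card {i \<in> {..<N}. (\<Sum>j<n. (X \<omega> $$ (i, j))\<^sup>2) >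
      L * (real n powr (1 / \<alpha>))\<^sup>2})} \<le> \<eta>"
proof -
  obtain K where K: "K > 0" "\<And>l. l > 0 \<Longrightarrow> (\<integral>x. exp (- l * x\<^sup>2) \<partial>D) \<ge> 1 - K * l powr (\<alpha> / 2)"
    using laplace_square_heavy_tailed[OF law \<alpha>] by blast
  \<comment> \<open>The target for K L^(-\<alpha>/2): Markov gives 4 a y / \<theta>, which must not
    exceed \<eta>. The cap at 1 keeps y/n an admissible \<epsilon>.\<close>
  define y where "y = min 1 (\<eta> * \<theta> / (4 * a))"
  have y: "0 < y" "y \<le> 1" "4 * a * y \<le> \<eta> * \<theta>"
    using \<eta> \<theta> a by (auto simp: y_def min_def field_simps)
  define L where "L = (K / y) powr (2 / \<alpha>)"
  have L: "L > 0" using K y by (simp add: L_def)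
  have Ly: "K * L powr (- (\<alpha> / 2)) = y" using K y \<alpha> by (simp add: L_def powr_powr powr_minus)
  show ?thesis
  proof (rule exI[of _ L], rule conjI[OF L], intro allI impI)
    fix n N :: nat and M :: "'w measure" and X
    assume n: "n \<ge> 1" and N: "real N \<le> 2 * a * real n" and iid: "iid_random_matrix M D N n X"
    interpret prob_space M using iid by (simp add: iid_random_matrix_def)
    define b where "b = real n powr (1 / \<alpha>)"
    have b: "b > 0" using n by (simp add: b_def)
    have b2: "(b\<^sup>2) powr (\<alpha> / 2) = n"
    proof -
      have "(b\<^sup>2) powr (\<alpha> / 2) = (b powr 2) powr (\<alpha> / 2)" using b by simp
      also have "\<dots> = n" using \<alpha> n by (simp add: powr_powr b_def)
      finally show ?thesis .
    qed
    define r where "r = L * b\<^sup>2"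
    have r: "r > 0" using L b by (simp add: r_def)
    have eps: "K * (1 / r) powr (\<alpha> / 2) = y / n"
      using b L Ly by (simp add: r_def powr_divide powr_mult b2 powr_minus field_simps)
    have row: "prob {\<omega> \<in> space M. (\<Sum>j\<in>{..<n}. (X \<omega> $$ (i, j))\<^sup>2) > r} \<le> 2 * y" if i: "i < N" for i
    proof -
      have "prob {\<omega> \<in> space M. (\<Sum>j\<in>{..<n}. (X \<omega> $$ (i, j))\<^sup>2) > r} \<le> 2 * (real (card {..<n}) * (y / n))"
      proof (rule prob_sum_squares_gt[OF _ iid_random_matrix_row(1)[OF iid i] _ r])
        show "(\<integral>x. exp (- (1 / r) * x\<^sup>2) \<partial>D) \<ge> 1 - y / n" using K(2)[of "1 / r"] r by (simp only: eps) simp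
        have "y \<le> n" using y n by linarith
        thus "y / n \<le> 1" using n by simp
      qed (use iid_random_matrix_row(2)[OF iid i] in auto)
      thus ?thesis using n by simp
    qed
    have rm: "random_variable borel (\<lambda>\<omega>. X \<omega> $$ (i, j))" if "i < N" "j < n" for i j
      using iid_random_matrix_row(1)[OF iid that(1)] that(2) by (auto simp: indep_vars_def)
    define S where "S i = {\<omega> \<in> space M. (\<Sum>j<n. (X \<omega> $$ (i, j))\<^sup>2) > r}" for i
    have S: "S i \<in> events" if "i < N" for i
    proof -
      have [measurable]: "random_variable borel (\<lambda>\<omega>. \<Sum>j<n. (X \<omega> $$ (i, j))\<^sup>2)"
        using rm[OF that] by measurable
      show ?thesis unfolding S_def by measurable
    qed
    have cnt: "real (card {i \<in> {..<N}. (\<Sum>j<n. (X \<omega> $$ (i, j))\<^sup>2) > r}) = (\<Sum>i<N. indicator (S i) \<omega>)"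
      if "\<omega> \<in> space M" for \<omega>
    proof -
      have "(\<Sum>i<N. indicator (S i) \<omega>) = (\<Sum>i<N. if (\<Sum>j<n. (X \<omega> $$ (i, j))\<^sup>2) > r then 1 else 0 :: real)"
        using that by (intro sum.cong) (auto simp: S_def indicator_def)
      thus ?thesis by (simp add: sum.If_cases Int_def)
    qed
    have intS: "integrable M (indicator (S i) :: 'w \<Rightarrow> real)" if "i < N" for i
      using S[OF that] by (intro integrable_real_indicator) (auto simp: emeasure_eq_measure)
    have int: "integrable M (\<lambda>\<omega>. \<Sum>i<N. indicator (S i) \<omega> :: real)"
      using intS by (intro Bochner_Integration.integrable_sum) auto
    have eq: "{\<omega> \<in> space M. \<theta> * real n < real (card {i \<in> {..<N}. (\<Sum>j<n. (X \<omega> $$ (i, j))\<^sup>2) > r})} =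
        {\<omega> \<in> space M. \<theta> * real n < (\<Sum>i<N. indicator (S i) \<omega>)}"
      using cnt by auto
    have [measurable]: "(\<lambda>\<omega>. \<Sum>i<N. indicator (S i) \<omega> :: real) \<in> borel_measurable M" using int by simp
    have "prob {\<omega> \<in> space M. \<theta> * real n < (\<Sum>i<N. indicator (S i) \<omega>)} \<le>
        prob {\<omega> \<in> space M. \<theta> * real n \<le> (\<Sum>i<N. indicator (S i) \<omega>)}"
      by (intro finite_measure_mono) auto
    also have "\<dots> \<le> expectation (\<lambda>\<omega>. \<Sum>i<N. indicator (S i) \<omega>) / (\<theta> * real n)"
      using \<theta> n by (intro integral_Markov_inequality_measure[where A = "{}"] int) (auto intro!: sum_nonneg)
    also have "expectation (\<lambda>\<omega>. \<Sum>i<N. indicator (S i) \<omega>) = (\<Sum>i<N. prob (S i))"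
      using intS S by (subst Bochner_Integration.integral_sum) auto
    also have "(\<Sum>i<N. prob (S i)) / (\<theta> * real n) \<le> (\<Sum>i<N. 2 * y) / (\<theta> * real n)"
      using row \<theta> by (intro divide_right_mono sum_mono) (auto simp: S_def)
    also have "\<dots> \<le> 4 * a * y / \<theta>"
    proof -
      have "real N * (2 * y) \<le> 2 * a * real n * (2 * y)" using N y by (intro mult_right_mono) auto
      thus ?thesis using \<theta> n by (simp add: field_simps)
    qed
    also have "\<dots> \<le> \<eta>" using y \<theta> by (simp add: field_simps)
    finally have "prob {\<omega> \<in> space M. \<theta> * real n < (\<Sum>i<N. indicator (S i) \<omega>)} \<le> \<eta>" .
    moreover have "{\<omega> \<in> space M. \<theta> * real n < (\<Sum>i<N. indicator (S i) \<omega> :: real)} \<in> events" by measurable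
    ultimately show "{\<omega> \<in> space M. \<theta> * real n < real (card {i \<in> {..<N}. (\<Sum>j<n. (X \<omega> $$ (i, j))\<^sup>2) >
      L * (real n powr (1 / \<alpha>))\<^sup>2})} \<in> sets M \<and>
    measure M {\<omega> \<in> space M. \<theta> * real n < real (card {i \<in> {..<N}. (\<Sum>j<n. (X \<omega> $$ (i, j))\<^sup>2) >
      L * (real n powr (1 / \<alpha>))\<^sup>2})} \<le> \<eta>"
      using eq by (simp add: r_def b_def)
  qed
qed

section \<open>The lattice net and its union bound\<close>

text \<open>Integer points of an l1 ball of radius R n. The l1 condition already implies the box;
  the box and the extensionality of the functions give the set the finite shape in which it is
  counted.\<close>

definition lattice_net :: "real \<Rightarrow> nat \<Rightarrow> (nat \<Rightarrow> int) set" where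
  "lattice_net R n = {z \<in> {..<n} \<rightarrow>\<^sub>E {-int (nat \<lceil>R * real n\<rceil>)..int (nat \<lceil>R * real n\<rceil>)}.
     (\<Sum>j<n. \<bar>real_of_int (z j)\<bar>) \<le> R * real n}"

lemma lattice_netI:
  assumes "(\<Sum>j<n. \<bar>real_of_int (z j)\<bar>) \<le> R * real n"
  shows "restrict z {..<n} \<in> lattice_net R n"
proof -
  define B where "B = int (nat \<lceil>R * real n\<rceil>)"
  have "- B \<le> z j \<and> z j \<le> B" if "j < n" for j
  proof -
    have "\<bar>real_of_int (z j)\<bar> \<le> (\<Sum>j<n. \<bar>real_of_int (z j)\<bar>)"
      using that by (intro member_le_sum) auto
    thus ?thesis using assms unfolding B_def by linarith
  qed
  hence "restrict z {..<n} \<in> {..<n} \<rightarrow>\<^sub>E {-B..B}" by auto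
  thus ?thesis using assms by (simp add: lattice_net_def B_def)
qed

text \<open>Union bound over the net: its cardinality \<open>O(1/\<tau>)\<^sup>n\<close> is beaten by the small ball
  probability \<open>O(\<tau>)\<close> of more than \<open>(1 + 2\<theta>) n\<close> rows.\<close>
lemma net_small_rows_tendsto:
  fixes D :: "real measure" and M :: "nat \<Rightarrow> 'w measure"
  assumes law: "heavy_tailed_law \<alpha> D" and symm: "symmetric_law D"
    and a: "a > 0" and pos: "\<kappa>1 > 0" "\<kappa>2 > 0" "\<zeta> > 0" "\<theta> > 0" "\<kappa> > 0" "\<tau>1 > 0"
    and N: "\<And>n. n \<ge> 1 \<Longrightarrow> real (N n) \<le> 2 * a * real n"
    and X: "\<And>n. n \<ge> 1 \<Longrightarrow> iid_random_matrix (M n) D (N n) n (X n)"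
  shows "\<exists>\<tau>>0. \<tau> \<le> \<tau>1 \<and> (\<exists>E. (\<forall>n\<ge>1. E n \<in> sets (M n)) \<and> (\<lambda>n. measure (M n) (E n)) \<longlonglongrightarrow> 0 \<and>
    (\<forall>n\<ge>1. \<forall>\<omega>\<in>space (M n). \<forall>z\<in>lattice_net (2 / (\<kappa> * \<tau>)) n.
      \<zeta> * real n \<le> real (card {j. j < n \<and> \<kappa>1 \<le> \<bar>\<kappa> * \<tau> * real_of_int (z j)\<bar> \<and>
        \<bar>\<kappa> * \<tau> * real_of_int (z j)\<bar> \<le> \<kappa>2}) \<longrightarrow>
      nat \<lceil>(1 + 2 * \<theta>) * real n\<rceil> \<le> card {i \<in> {..<N n}.
        \<bar>\<Sum>j<n. X n \<omega> $$ (i, j) * (\<kappa> * \<tau> * real_of_int (z j))\<bar> \<le> \<tau> * real n powr (1 / \<alpha>)} \<longrightarrow>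
      \<omega> \<in> E n))"
proof -
  have \<alpha>: "\<alpha> > 0" using law by (simp add: heavy_tailed_law_def)
  obtain c s0 where c: "c > 0" "s0 > 0"
    and decay: "\<And>s. 0 < \<bar>s\<bar> \<Longrightarrow> \<bar>s\<bar> \<le> s0 \<Longrightarrow> norm (char D s) \<le> exp (- c * \<bar>s\<bar> powr \<alpha>)"
    using char_decay_heavy_tailed[OF law symm] by blast
  obtain C where C: "C > 0" and ball: "\<forall>\<tau>>0. \<exists>n0. \<forall>n\<ge>n0. \<forall>(M :: 'w measure) X w.
     prob_space M \<longrightarrow> prob_space.indep_vars M (\<lambda>_. borel) X {..<n} \<longrightarrow>
     (\<forall>j<n. distr M borel (X j) = D) \<longrightarrow>
     \<zeta> * real n \<le> real (card {j. j < n \<and> \<kappa>1 \<le> \<bar>w j\<bar> \<and> \<bar>w j\<bar> \<le> \<kappa>2}) \<longrightarrow>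
     measure M {\<omega> \<in> space M. \<bar>\<Sum>j<n. X j \<omega> * w j\<bar> \<le> \<tau> * real n powr (1 / \<alpha>)} \<le> C * \<tau>"
    using small_ball_linear_combination[OF \<alpha> heavy_tailed_law_real_distribution[OF law] c decay pos(1-3),
        where ?'w = 'w] by blast
  \<comment> \<open>The n-th root of the union bound with the power of \<tau> removed: 5e/(\<kappa>
    \<tau>) from the net, 4^a from 2^N \<le> 4^(a n), and (C \<tau>)^(1 + 2\<theta>) from the rows
    multiply to G \<tau>^(2\<theta>).\<close>
  define G where "G = 5 * exp 1 / \<kappa> * 4 powr a * C powr (1 + 2 * \<theta>)"
  have G: "G > 0" using C pos by (simp add: G_def)
  \<comment> \<open>Besides the prescribed cap: 1/\<kappa> lets 1 + 2R be absorbed into 5/(\<kappa>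
    \<tau>), 1/C keeps the row bound C \<tau> at most 1, and the last entry makes G
    \<tau>^(2\<theta>) at most 1/2.\<close>
  define \<tau> where "\<tau> = Min {\<tau>1, 1 / \<kappa>, 1 / C, (1 / (2 * G)) powr (1 / (2 * \<theta>))}"
  have \<tau>: "\<tau> > 0" "\<tau> \<le> \<tau>1" using C pos G by (auto simp: \<tau>_def)
  have "\<tau> \<le> 1 / \<kappa>" "\<tau> \<le> 1 / C" "\<tau> \<le> (1 / (2 * G)) powr (1 / (2 * \<theta>))"
    by (auto simp: \<tau>_def)
  hence \<tau>2: "\<kappa> * \<tau> \<le> 1" "C * \<tau> \<le> 1" using C pos by (auto simp: field_simps)
  have "\<tau> powr (2 * \<theta>) \<le> ((1 / (2 * G)) powr (1 / (2 * \<theta>))) powr (2 * \<theta>)"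
    using \<open>\<tau> \<le> (1 / (2 * G)) powr (1 / (2 * \<theta>))\<close> \<tau> pos by (intro powr_mono2) auto
  also have "\<dots> = 1 / (2 * G)" using pos G by (simp add: powr_powr)
  finally have G\<tau>: "G * \<tau> powr (2 * \<theta>) \<le> 1 / 2" using G by (simp add: field_simps)
  define R where "R = 2 / (\<kappa> * \<tau>)"
  have R: "R > 0" using pos \<tau> by (simp add: R_def)
  define w where "w z j = \<kappa> * \<tau> * real_of_int (z j)" for z :: "nat \<Rightarrow> int" and j
  define Z where "Z n = {z \<in> lattice_net R n. \<zeta> * real n \<le> real (card {j. j < n \<and> \<kappa>1 \<le> \<bar>w z j\<bar> \<and> \<bar>w z j\<bar> \<le> \<kappa>2})}" for n
  define m where "m n = nat \<lceil>(1 + 2 * \<theta>) * real n\<rceil>" for n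
  define E where "E n z = {\<omega> \<in> space (M n). m n \<le> card {i \<in> {..<N n}.
        \<bar>\<Sum>j<n. X n \<omega> $$ (i, j) * w z j\<bar> \<le> \<tau> * real n powr (1 / \<alpha>)}}" for n z
  have finZ: "finite (Z n)" "real (card (Z n)) \<le> (exp 1 * (1 + 2 * R)) ^ n" for n
  proof -
    have fin: "finite (lattice_net R n)" and le: "real (card (lattice_net R n)) \<le> (exp 1 * (1 + 2 * R)) ^ n"
      unfolding lattice_net_def by (rule card_lattice_l1_ball[OF R])+
    have sub: "Z n \<subseteq> lattice_net R n" by (auto simp: Z_def)
    show "finite (Z n)" using fin sub finite_subset by blast
    have "card (Z n) \<le> card (lattice_net R n)" using fin sub by (rule card_mono)
    thus "real (card (Z n)) \<le> (exp 1 * (1 + 2 * R)) ^ n" using le by linarith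
  qed
  have meas: "E n z \<in> sets (M n)" if n: "n \<ge> 1" for n z
  proof -
    interpret prob_space "M n" using X[OF n] by (simp add: iid_random_matrix_def)
    show ?thesis unfolding E_def
      by (rule count_ge_event[OF _ iid_random_matrix_indep_row_events[OF X[OF n]]]) simp
  qed
  obtain n0 where n0: "\<forall>n\<ge>n0. \<forall>(M :: 'w measure) X w.
     prob_space M \<longrightarrow> prob_space.indep_vars M (\<lambda>_. borel) X {..<n} \<longrightarrow>
     (\<forall>j<n. distr M borel (X j) = D) \<longrightarrow>
     \<zeta> * real n \<le> real (card {j. j < n \<and> \<kappa>1 \<le> \<bar>w j\<bar> \<and> \<bar>w j\<bar> \<le> \<kappa>2}) \<longrightarrow>
     measure M {\<omega> \<in> space M. \<bar>\<Sum>j<n. X j \<omega> * w j\<bar> \<le> \<tau> * real n powr (1 / \<alpha>)} \<le> C * \<tau>"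
    by (rule exE[OF ball[THEN spec, THEN mp, OF \<tau>(1)]])
  have bound: "measure (M n) (\<Union>z\<in>Z n. E n z) \<le> (1 / 2) ^ n" if n: "n \<ge> n0" "n \<ge> 1" for n
  proof -
    interpret prob_space "M n" using X[OF n(2)] by (simp add: iid_random_matrix_def)
    have each: "prob (E n z) \<le> 2 ^ N n * (C * \<tau>) ^ m n" if z: "z \<in> Z n" for z
    proof -
      have "prob (E n z) \<le> 2 ^ card {..<N n} * (C * \<tau>) ^ m n"
        unfolding E_def
      proof (rule prob_count_ge_le[OF _ iid_random_matrix_indep_row_events[OF X[OF n(2)]]])
        fix i assume "i \<in> {..<N n}"
        hence i: "i < N n" by simp
        show "prob {\<omega> \<in> space (M n). \<bar>\<Sum>j<n. X n \<omega> $$ (i, j) * w z j\<bar> \<le> \<tau> * real n powr (1 / \<alpha>)} \<le> C * \<tau>"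
          using n0[rule_format, OF n(1) prob_space_axioms iid_random_matrix_row(1)[OF X[OF n(2)] i]
              iid_random_matrix_row(2)[OF X[OF n(2)] i], of "w z"] z by (simp add: Z_def)
      qed (use C \<tau> \<tau>2 in auto)
      thus ?thesis by simp
    qed
    have "prob (\<Union>z\<in>Z n. E n z) \<le> (\<Sum>z\<in>Z n. prob (E n z))"
      using finZ meas[OF n(2)] by (intro finite_measure_subadditive_finite) auto
    also have "\<dots> \<le> (\<Sum>z\<in>Z n. 2 ^ N n * (C * \<tau>) ^ m n)" using each by (rule sum_mono)
    also have "\<dots> = real (card (Z n)) * (2 ^ N n * (C * \<tau>) ^ m n)" by simp
    also have "\<dots> \<le> (exp 1 * 5 / (\<kappa> * \<tau>)) ^ n * ((4 powr a) ^ n * ((C * \<tau>) powr (1 + 2 * \<theta>)) ^ n)"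
    proof (intro mult_mono)
      have "1 + 2 * R \<le> 5 / (\<kappa> * \<tau>)" using \<tau>2 pos \<tau> by (simp add: R_def field_simps)
      hence "exp 1 * (1 + 2 * R) \<le> exp 1 * (5 / (\<kappa> * \<tau>))" by (intro mult_left_mono) auto
      hence "(exp 1 * (1 + 2 * R)) ^ n \<le> (exp 1 * 5 / (\<kappa> * \<tau>)) ^ n"
        using R by (intro power_mono) auto
      thus "real (card (Z n)) \<le> (exp 1 * 5 / (\<kappa> * \<tau>)) ^ n" using finZ(2)[of n] by linarith
      have "2 ^ N n = 2 powr real (N n)" by (simp add: powr_realpow)
      also have "\<dots> \<le> 2 powr (2 * a * real n)" using N[OF n(2)] by (intro powr_mono) auto
      also have "\<dots> = (4 powr a) ^ n"
      proof -
        have "2 powr (2 * a * real n) = ((2 powr 2) powr a) powr real n" by (simp only: powr_powr)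
        thus ?thesis by (simp add: powr_realpow)
      qed
      finally show "2 ^ N n \<le> (4 powr a) ^ n" .
      have "(C * \<tau>) ^ m n = (C * \<tau>) powr real (m n)" using C \<tau> by (simp add: powr_realpow)
      also have "\<dots> \<le> (C * \<tau>) powr ((1 + 2 * \<theta>) * real n)"
      proof (intro powr_mono')
        show "(1 + 2 * \<theta>) * real n \<le> real (m n)" unfolding m_def by (rule real_nat_ceiling_ge)
      qed (use C \<tau> \<tau>2 in auto)
      also have "\<dots> = ((C * \<tau>) powr (1 + 2 * \<theta>)) ^ n"
        using C \<tau> by (simp add: powr_powr[symmetric] powr_realpow)
      finally show "(C * \<tau>) ^ m n \<le> ((C * \<tau>) powr (1 + 2 * \<theta>)) ^ n" .
    qed (use C \<tau> pos in auto)
    also have "\<dots> = (G * \<tau> powr (2 * \<theta>)) ^ n"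
    proof -
      have "(C * \<tau>) powr (1 + 2 * \<theta>) = C powr (1 + 2 * \<theta>) * (\<tau> * \<tau> powr (2 * \<theta>))"
        using C \<tau> by (simp add: powr_mult powr_add)
      hence "exp 1 * 5 / (\<kappa> * \<tau>) * (4 powr a * (C * \<tau>) powr (1 + 2 * \<theta>)) = G * \<tau> powr (2 * \<theta>)"
        using \<tau> pos by (simp add: G_def)
      thus ?thesis by (simp flip: power_mult_distrib)
    qed
    also have "\<dots> \<le> (1 / 2) ^ n" using G\<tau> G by (intro power_mono) auto
    finally show ?thesis .
  qed
  have lim: "(\<lambda>n. measure (M n) (\<Union>z\<in>Z n. E n z)) \<longlonglongrightarrow> 0"
  proof (rule tendsto_sandwich[OF _ _ tendsto_const])
    show "\<forall>\<^sub>F n in sequentially. measure (M n) (\<Union>z\<in>Z n. E n z) \<le> (1 / 2) ^ n"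
      using eventually_ge_at_top[of "max n0 1"] by eventually_elim (auto intro: bound)
    show "(\<lambda>n. (1 / 2 :: real) ^ n) \<longlonglongrightarrow> 0" by (intro LIMSEQ_realpow_zero) auto
  qed simp
  show ?thesis
  proof (rule exI[of _ \<tau>], intro conjI \<tau>, rule exI[of _ "\<lambda>n. \<Union>z\<in>Z n. E n z"], intro conjI allI impI ballI lim)
    show "(\<Union>z\<in>Z n. E n z) \<in> sets (M n)" if "n \<ge> 1" for n
      using finZ meas[OF that] by auto
  qed (auto simp: Z_def E_def R_def w_def m_def)
qed

subsection \<open>Localization\<close>

text \<open>The deterministic half of the net argument: a spread unit vector with small image yields
  a net point that is still spread and has a small product with at least (1 + 2\<theta>) n rows. Of
  the (1 + 4\<theta>) n rows, \<theta> n may be long and \<theta> n may be spoiled.\<close>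

lemma spread_vector_rounding:
  fixes A :: "nat \<Rightarrow> nat \<Rightarrow> real" and v :: "nat \<Rightarrow> real"
  assumes N: "(1 + 4 * \<theta>) * real n \<le> real N" "real N \<le> 2 * a * real n"
    and unit: "(\<Sum>j<n. (v j)\<^sup>2) = 1"
    and spread: "\<zeta> * real n \<le> real (card {j. j < n \<and> k1 \<le> sqrt n * \<bar>v j\<bar> \<and> sqrt n * \<bar>v j\<bar> \<le> k2})"
    and pos: "\<kappa> > 0" "\<tau> > 0" "L > 0" "b > 0" and \<kappa>\<tau>: "\<kappa> * \<tau> \<le> 1" "\<kappa> * \<tau> \<le> k1 / 2"
    and L: "4 * a * L * \<kappa>\<^sup>2 \<le> \<theta> / 2" and c: "2 * c\<^sup>2 \<le> \<theta> / 2 * \<tau>\<^sup>2"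
    and bad: "real (card {i \<in> {..<N}. (\<Sum>j<n. (A i j)\<^sup>2) > L * b\<^sup>2}) \<le> \<theta> * real n"
    and small: "(\<Sum>i<N. (\<Sum>j<n. A i j * v j)\<^sup>2) \<le> (c * b)\<^sup>2"
  shows "\<exists>z \<in> lattice_net (2 / (\<kappa> * \<tau>)) n.
      \<zeta> * real n \<le> real (card {j. j < n \<and> k1 / 2 \<le> \<bar>\<kappa> * \<tau> * real_of_int (z j)\<bar> \<and> \<bar>\<kappa> * \<tau> * real_of_int (z j)\<bar> \<le> k2 + 1}) \<and>
      nat \<lceil>(1 + 2 * \<theta>) * real n\<rceil> \<le> card {i \<in> {..<N}. \<bar>\<Sum>j<n. A i j * (\<kappa> * \<tau> * real_of_int (z j))\<bar> \<le> \<tau> * b}"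
proof -
  define e where "e = \<kappa> * \<tau>"
  have e: "e > 0" "e \<le> 1" "e \<le> k1 / 2" using pos \<kappa>\<tau> by (auto simp: e_def)
  define y where "y j = sqrt n * v j" for j
  define I where "I = {i \<in> {..<N}. (\<Sum>j<n. (A i j)\<^sup>2) \<le> L * b\<^sup>2}"
  have I: "I \<subseteq> {..<N}" "finite I" by (auto simp: I_def)
  obtain z where z: "\<forall>j<n. \<bar>real_of_int (z j) - y j / e\<bar> \<le> 1"
    and round: "(\<Sum>i\<in>I. (\<Sum>j<n. A i j * (real_of_int (z j) - y j / e))\<^sup>2) \<le> (\<Sum>i\<in>I. \<Sum>j<n. (A i j)\<^sup>2)"
    using lattice_rounding[where x = "\<lambda>j. y j / e" and A = A and I = I and n = n] by blast
  have near: "\<bar>e * real_of_int (z j) - y j\<bar> \<le> e" if "j < n" for j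
  proof -
    have "\<bar>e * real_of_int (z j) - y j\<bar> = e * \<bar>real_of_int (z j) - y j / e\<bar>"
      using e by (simp add: abs_mult[symmetric] field_simps)
    also have "\<dots> \<le> e * 1" using z that e by (intro mult_left_mono) auto
    finally show ?thesis by simp
  qed
  have ysq: "(\<Sum>j<n. (y j)\<^sup>2) = n"
    by (simp add: y_def power_mult_distrib unit flip: sum_distrib_left)
  have net: "(\<Sum>j<n. \<bar>real_of_int (z j)\<bar>) \<le> 2 / e * real n"
  proof -
    have "e * (\<Sum>j<n. \<bar>real_of_int (z j)\<bar>) = (\<Sum>j<n. \<bar>e * real_of_int (z j)\<bar>)"
      using e by (simp add: sum_distrib_left abs_mult)
    \<comment> \<open>Passing from l2 to l1 by |y| \<le> (1 + y^2)/2. Since the squares sum to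
      \<open>n\<close>, the total is 2n, whence the radius 2/(\<kappa> \<tau>) of the net.\<close>
    also have "\<dots> \<le> (\<Sum>j<n. (1 + (y j)\<^sup>2) / 2 + 1)"
    proof (rule sum_mono)
      fix j assume "j \<in> {..<n}"
      hence "\<bar>e * real_of_int (z j)\<bar> \<le> \<bar>y j\<bar> + 1" using near[of j] e by simp
      moreover have "0 \<le> (1 - \<bar>y j\<bar>)\<^sup>2" by simp
      hence "\<bar>y j\<bar> \<le> (1 + (y j)\<^sup>2) / 2" by (simp add: power2_diff)
      ultimately show "\<bar>e * real_of_int (z j)\<bar> \<le> (1 + (y j)\<^sup>2) / 2 + 1" by linarith
    qed
    also have "\<dots> = 2 * real n"
      by (simp add: sum.distrib ysq flip: sum_divide_distrib)
    finally show ?thesis using e by (simp add: field_simps)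
  qed
  define z' where "z' = restrict z {..<n}"
  have z': "z' \<in> lattice_net (2 / (\<kappa> * \<tau>)) n"
    unfolding z'_def by (rule lattice_netI) (use net in \<open>simp add: e_def\<close>)
  have z'_eq: "z' j = z j" if "j < n" for j using that by (simp add: z'_def)
  \<comment> \<open>Rounding moves a coordinate by at most \<open>e\<close>, which is at most k1/2
    and at most 1, so the window [k1, k2] widens to [k1/2, k2 + 1].\<close>
  have 1: "\<zeta> * real n \<le> real (card {j. j < n \<and> k1 / 2 \<le> \<bar>e * real_of_int (z' j)\<bar> \<and> \<bar>e * real_of_int (z' j)\<bar> \<le> k2 + 1})"
  proof -
    have "{j. j < n \<and> k1 \<le> sqrt n * \<bar>v j\<bar> \<and> sqrt n * \<bar>v j\<bar> \<le> k2} \<subseteq>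
      {j. j < n \<and> k1 / 2 \<le> \<bar>e * real_of_int (z' j)\<bar> \<and> \<bar>e * real_of_int (z' j)\<bar> \<le> k2 + 1}"
    proof safe
      fix j assume j: "j < n" "k1 \<le> sqrt n * \<bar>v j\<bar>" "sqrt n * \<bar>v j\<bar> \<le> k2"
      have "sqrt n * \<bar>v j\<bar> = \<bar>y j\<bar>" by (simp add: y_def abs_mult)
      thus "k1 / 2 \<le> \<bar>e * real_of_int (z' j)\<bar>" "\<bar>e * real_of_int (z' j)\<bar> \<le> k2 + 1"
        using near[OF j(1)] e j unfolding z'_eq[OF j(1)] by linarith+
    qed
    hence "card {j. j < n \<and> k1 \<le> sqrt n * \<bar>v j\<bar> \<and> sqrt n * \<bar>v j\<bar> \<le> k2} \<le>
      card {j. j < n \<and> k1 / 2 \<le> \<bar>e * real_of_int (z' j)\<bar> \<and> \<bar>e * real_of_int (z' j)\<bar> \<le> k2 + 1}"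
      by (intro card_mono) auto
    thus ?thesis using spread by linarith
  qed
  define W where "W i = (\<Sum>j<n. A i j * (e * real_of_int (z' j)))" for i
  define F where "F = {i \<in> I. \<bar>W i\<bar> > \<tau> * b}"
  have F: "F \<subseteq> I" "finite F" using I by (auto simp: F_def)
  \<comment> \<open>A Chebyshev count of the spoiled short rows: their number times (\<tau> b)^2 is
    at most the sum of squares of \<open>W\<close>, which splits into the image of \<open>v\<close>
    and the rounding error.\<close>
  have "real (card F) * (\<tau> * b)\<^sup>2 = (\<Sum>i\<in>F. (\<tau> * b)\<^sup>2)" by simp
  also have "\<dots> \<le> (\<Sum>i\<in>F. (W i)\<^sup>2)"
  proof (rule sum_mono)
    fix i assume "i \<in> F"
    hence "\<tau> * b \<le> \<bar>W i\<bar>" by (simp add: F_def)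
    hence "(\<tau> * b)\<^sup>2 \<le> \<bar>W i\<bar>\<^sup>2" using pos by (intro power_mono) auto
    thus "(\<tau> * b)\<^sup>2 \<le> (W i)\<^sup>2" by simp
  qed
  also have "\<dots> \<le> (\<Sum>i\<in>I. (W i)\<^sup>2)" using F I by (intro sum_mono2) auto
  also have "\<dots> \<le> (\<Sum>i\<in>I. 2 * real n * (\<Sum>j<n. A i j * v j)\<^sup>2 +
      2 * e\<^sup>2 * (\<Sum>j<n. A i j * (real_of_int (z j) - y j / e))\<^sup>2)"
  proof (rule sum_mono)
    fix i assume "i \<in> I"
    define P where "P = (\<Sum>j<n. A i j * v j)"
    define Q where "Q = (\<Sum>j<n. A i j * (real_of_int (z j) - y j / e))"
    have "W i = (\<Sum>j<n. sqrt n * (A i j * v j) + e * (A i j * (real_of_int (z j) - y j / e)))"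
      unfolding W_def using e by (intro sum.cong) (auto simp: z'_eq y_def field_simps)
    also have "\<dots> = sqrt n * P + e * Q" by (simp add: P_def Q_def sum.distrib sum_distrib_left)
    finally have "(W i)\<^sup>2 = (sqrt n * P + e * Q)\<^sup>2" by simp
    also have "\<dots> \<le> 2 * (sqrt n * P)\<^sup>2 + 2 * (e * Q)\<^sup>2"
    proof -
      have "0 \<le> (sqrt n * P - e * Q)\<^sup>2" by simp
      thus ?thesis unfolding power2_sum power2_diff by linarith
    qed
    also have "\<dots> = 2 * real n * P\<^sup>2 + 2 * e\<^sup>2 * Q\<^sup>2" by (simp add: power_mult_distrib)
    finally show "(W i)\<^sup>2 \<le> 2 * real n * (\<Sum>j<n. A i j * v j)\<^sup>2 +
      2 * e\<^sup>2 * (\<Sum>j<n. A i j * (real_of_int (z j) - y j / e))\<^sup>2" by (simp only: P_def Q_def)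
  qed
  also have "\<dots> = 2 * real n * (\<Sum>i\<in>I. (\<Sum>j<n. A i j * v j)\<^sup>2) +
      2 * e\<^sup>2 * (\<Sum>i\<in>I. (\<Sum>j<n. A i j * (real_of_int (z j) - y j / e))\<^sup>2)"
    by (simp add: sum.distrib sum_distrib_left)
  also have "\<dots> \<le> 2 * real n * (c * b)\<^sup>2 + 2 * e\<^sup>2 * (2 * a * real n * (L * b\<^sup>2))"
  proof (intro add_mono mult_left_mono)
    have "(\<Sum>i\<in>I. (\<Sum>j<n. A i j * v j)\<^sup>2) \<le> (\<Sum>i<N. (\<Sum>j<n. A i j * v j)\<^sup>2)"
      using I by (intro sum_mono2) auto
    thus "(\<Sum>i\<in>I. (\<Sum>j<n. A i j * v j)\<^sup>2) \<le> (c * b)\<^sup>2" using small by linarith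
    have "(\<Sum>i\<in>I. \<Sum>j<n. (A i j)\<^sup>2) \<le> (\<Sum>i\<in>I. L * b\<^sup>2)" by (rule sum_mono) (simp add: I_def)
    also have "\<dots> = real (card I) * (L * b\<^sup>2)" by simp
    also have "\<dots> \<le> 2 * a * real n * (L * b\<^sup>2)"
    proof (rule mult_right_mono)
      have "card I \<le> N" using card_mono[OF _ I(1)] by simp
      thus "real (card I) \<le> 2 * a * real n" using N by linarith
    qed (use pos in auto)
    finally show "(\<Sum>i\<in>I. (\<Sum>j<n. A i j * (real_of_int (z j) - y j / e))\<^sup>2) \<le> 2 * a * real n * (L * b\<^sup>2)"
      using round by linarith
  qed auto
  also have "\<dots> = (2 * c\<^sup>2 + 4 * a * L * \<kappa>\<^sup>2 * \<tau>\<^sup>2) * (real n * b\<^sup>2)"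
    by (simp add: e_def power_mult_distrib algebra_simps)
  \<comment> \<open>The image of \<open>v\<close>, controlled by \<open>c\<close>, and the rounding
    error, controlled by \<kappa>, use up half of the allowance \<theta> each.\<close>
  also have "\<dots> \<le> (\<theta> / 2 * \<tau>\<^sup>2 + \<theta> / 2 * \<tau>\<^sup>2) * (real n * b\<^sup>2)"
    using c L by (intro mult_right_mono add_mono) auto
  also have "\<dots> = \<theta> * real n * (\<tau> * b)\<^sup>2" by (simp add: power_mult_distrib algebra_simps)
  finally have cardF: "real (card F) \<le> \<theta> * real n" using pos by simp
  have "I - F \<subseteq> {i \<in> {..<N}. \<bar>W i\<bar> \<le> \<tau> * b}" using I by (auto simp: F_def)
  hence "card (I - F) \<le> card {i \<in> {..<N}. \<bar>W i\<bar> \<le> \<tau> * b}" by (intro card_mono) auto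
  moreover have "card (I - F) = card I - card F" using F by (intro card_Diff_subset) auto
  moreover have "card I = N - card {i \<in> {..<N}. (\<Sum>j<n. (A i j)\<^sup>2) > L * b\<^sup>2}"
  proof -
    have "I = {..<N} - {i \<in> {..<N}. (\<Sum>j<n. (A i j)\<^sup>2) > L * b\<^sup>2}" by (auto simp: I_def)
    also have "card \<dots> = card {..<N} - card {i \<in> {..<N}. (\<Sum>j<n. (A i j)\<^sup>2) > L * b\<^sup>2}"
      by (rule card_Diff_subset) auto
    finally show ?thesis by simp
  qed
  ultimately have "real (card {i \<in> {..<N}. \<bar>W i\<bar> \<le> \<tau> * b}) \<ge> real N - \<theta> * real n - \<theta> * real n"
    using bad cardF by linarith
  hence "(1 + 2 * \<theta>) * real n \<le> real (card {i \<in> {..<N}. \<bar>W i\<bar> \<le> \<tau> * b})"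
    using N by (simp add: algebra_simps)
  hence 2: "nat \<lceil>(1 + 2 * \<theta>) * real n\<rceil> \<le> card {i \<in> {..<N}. \<bar>W i\<bar> \<le> \<tau> * b}"
    by (simp add: nat_ceiling_le_eq)
  show ?thesis using z' 1 2 unfolding W_def e_def by blast
qed

text \<open>Coordinates below sqrt(\<delta>/2)/sqrt n contribute at most \<delta>/2 in total. The
  others carry at least \<delta>/2, at most 1/(e n) each, so there are at least \<delta> e n / 2 of
  them.\<close>

lemma spread_of_mass:
  fixes v :: "nat \<Rightarrow> real"
  assumes n: "n \<ge> 1" and e: "e > 0" and \<delta>: "\<delta> > 0"
    and mass: "\<delta> \<le> (\<Sum>j | j < n \<and> \<bar>v j\<bar> \<le> 1 / sqrt (e * real n). (v j)\<^sup>2)"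
  shows "\<delta> * e / 2 * real n \<le>
    real (card {j. j < n \<and> sqrt (\<delta> / 2) \<le> sqrt n * \<bar>v j\<bar> \<and> sqrt n * \<bar>v j\<bar> \<le> 1 / sqrt e})"
proof -
  define S where "S = {j. j < n \<and> \<bar>v j\<bar> \<le> 1 / sqrt (e * real n)}"
  define T where "T = {j. j < n \<and> sqrt (\<delta> / 2) \<le> sqrt n * \<bar>v j\<bar> \<and> sqrt n * \<bar>v j\<bar> \<le> 1 / sqrt e}"
  have iff: "sqrt n * \<bar>v j\<bar> \<le> 1 / sqrt e \<longleftrightarrow> \<bar>v j\<bar> \<le> 1 / sqrt (e * real n)" for j
    using n e by (simp add: real_sqrt_mult field_simps)
  have TS: "T \<subseteq> S" "finite S" "finite T" by (auto simp: T_def S_def iff)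
  have "\<delta> \<le> (\<Sum>j\<in>S. (v j)\<^sup>2)" using mass by (simp only: S_def)
  hence 1: "\<delta> \<le> (\<Sum>j\<in>S-T. (v j)\<^sup>2) + (\<Sum>j\<in>T. (v j)\<^sup>2)"
    by (simp only: sum.subset_diff[OF TS(1,2)])
  have 2: "(\<Sum>j\<in>T. (v j)\<^sup>2) \<le> (\<Sum>j\<in>T. 1 / (e * real n))"
  proof (rule sum_mono)
    fix j assume "j \<in> T"
    hence "\<bar>v j\<bar> \<le> 1 / sqrt (e * real n)" using TS by (auto simp: S_def)
    hence "\<bar>v j\<bar>\<^sup>2 \<le> (1 / sqrt (e * real n))\<^sup>2" by (intro power_mono) auto
    thus "(v j)\<^sup>2 \<le> 1 / (e * real n)" using e by (simp add: power_divide)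
  qed
  have 3: "(\<Sum>j\<in>S-T. (v j)\<^sup>2) \<le> (\<Sum>j\<in>S-T. \<delta> / 2 / real n)"
  proof (rule sum_mono)
    fix j assume "j \<in> S - T"
    hence "sqrt n * \<bar>v j\<bar> \<le> sqrt (\<delta> / 2)" by (auto simp: S_def T_def iff)
    hence "(sqrt n * \<bar>v j\<bar>)\<^sup>2 \<le> (sqrt (\<delta> / 2))\<^sup>2" by (intro power_mono) auto
    thus "(v j)\<^sup>2 \<le> \<delta> / 2 / real n" using n \<delta> by (simp add: power_mult_distrib field_simps)
  qed
  have 4: "(\<Sum>j\<in>S-T. \<delta> / 2 / real n) \<le> real n * (\<delta> / 2 / real n)"
  proof -
    have "card (S - T) \<le> card {..<n}" by (rule card_mono) (auto simp: S_def)
    hence "real (card (S - T)) * (\<delta> / 2 / real n) \<le> real n * (\<delta> / 2 / real n)"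
      using \<delta> by (intro mult_right_mono) auto
    thus ?thesis by (simp only: sum_constant)
  qed
  have "(\<Sum>j\<in>T. 1 / (e * real n)) = real (card T) / (e * real n)" "real n * (\<delta> / 2 / real n) = \<delta> / 2"
    using n by simp_all
  with 1 2 3 4 have "\<delta> / 2 \<le> real (card T) / (e * real n)" by linarith
  hence "\<delta> * e / 2 * real n \<le> real (card T)" using n e by (simp add: field_simps)
  thus ?thesis by (simp only: T_def)
qed

lemma singular_vector_image_norm:
  assumes A: "A \<in> carrier_mat N n" and "unit_right_singular_vector A s v"
  shows "v \<in> carrier_vec n" "(\<Sum>j<n. (v $ j)\<^sup>2) = 1"
    and "(\<Sum>i<N. (\<Sum>j<n. A $$ (i, j) * v $ j)\<^sup>2) = s\<^sup>2"
proof -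
  obtain w where v: "v \<in> carrier_vec n" and nv: "l2_norm_vec v = 1"
    and w: "w \<in> carrier_vec N" and nw: "l2_norm_vec w = 1" and Av: "A *\<^sub>v v = s \<cdot>\<^sub>v w"
    using assms unfolding unit_right_singular_vector_def by auto
  show "v \<in> carrier_vec n" by (rule v)
  show "(\<Sum>j<n. (v $ j)\<^sup>2) = 1"
    using nv v by (simp add: l2_norm_vec_def scalar_prod_def atLeast0LessThan power2_eq_square)
  have ww: "(\<Sum>i<N. (w $ i)\<^sup>2) = 1"
    using nw w by (simp add: l2_norm_vec_def scalar_prod_def atLeast0LessThan power2_eq_square)
  have "(\<Sum>j<n. A $$ (i, j) * v $ j) = s * w $ i" if "i < N" for i
    using arg_cong[OF Av, of "\<lambda>x. x $ i"] that A v w by (simp add: scalar_prod_def atLeast0LessThan)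
  hence "(\<Sum>i<N. (\<Sum>j<n. A $$ (i, j) * v $ j)\<^sup>2) = (\<Sum>i<N. s\<^sup>2 * (w $ i)\<^sup>2)"
    by (intro sum.cong) (auto simp: power_mult_distrib)
  thus "(\<Sum>i<N. (\<Sum>j<n. A $$ (i, j) * v $ j)\<^sup>2) = s\<^sup>2" using ww by (simp flip: sum_distrib_left)
qed

text \<open>Convergence for each fixed \<open>m\<close> comes without a rate, so the index has to
  grow slowly enough to wait for it.\<close>

lemma diagonal_null_sequence:
  fixes f :: "nat \<Rightarrow> nat \<Rightarrow> real"
  assumes "\<And>m. f m \<longlonglongrightarrow> 0"
  obtains g where "filterlim g at_top sequentially" "(\<lambda>n. f (g n) n) \<longlonglongrightarrow> 0"
proof -
  have "\<exists>n0. \<forall>n\<ge>n0. \<bar>f m n\<bar> < 1 / real (Suc m)" for m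
    using LIMSEQ_D[OF assms, of "1 / real (Suc m)" m] by auto
  then obtain h where h: "\<And>m n. n \<ge> h m \<Longrightarrow> \<bar>f m n\<bar> < 1 / real (Suc m)" by metis
  \<comment> \<open>The largest level whose waiting time \<open>h m\<close> has passed. Inserting 0
    keeps the set nonempty, so \<open>h (g n) \<le> n\<close> is guaranteed from \<open>h 0\<close>
    on.\<close>
  define g where "g n = Max (insert 0 {m. m \<le> n \<and> h m \<le> n})" for n
  have fin: "finite (insert 0 {m. m \<le> n \<and> h m \<le> n})" for n by simp
  have ge: "g n \<ge> m" if "n \<ge> max m (h m)" for m n
    unfolding g_def using that by (intro Max_ge fin) auto
  have hg: "h (g n) \<le> n" if "n \<ge> h 0" for n
    using Max_in[OF fin[of n]] that unfolding g_def by auto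
  have lim: "filterlim g at_top sequentially"
    unfolding filterlim_at_top eventually_sequentially using ge by blast
  show thesis
  proof (rule that[OF lim], rule Lim_null_comparison)
    show "\<forall>\<^sub>F n in sequentially. norm (f (g n) n) \<le> 1 / real (Suc (g n))"
      using eventually_ge_at_top[of "h 0"] by eventually_elim (use h hg in \<open>auto intro: less_imp_le\<close>)
    have "(\<lambda>n. 1 / real (Suc n)) \<longlonglongrightarrow> 0" by (rule LIMSEQ_Suc[OF lim_1_over_n])
    from filterlim_compose[OF this lim] show "(\<lambda>n. 1 / real (Suc (g n))) \<longlonglongrightarrow> 0" .
  qed
qed

text \<open>The upper and lower bounds meet here for a fixed \<open>e\<close>: off the events
  \<open>E1\<close> (many long rows), \<open>E2\<close> (a bad net point) and \<open>E3\<close> (few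
  short columns), substantial mass on small coordinates is contradictory. The tolerance \<eta> is
  fixed first because \<open>L\<close>, and all constants after it, depend on it.\<close>

lemma delocalized_mass_tendsto:
  fixes a \<alpha> :: real and D :: "real measure" and M :: "nat \<Rightarrow> 'w measure"
    and N k :: "nat \<Rightarrow> nat" and X :: "nat \<Rightarrow> 'w \<Rightarrow> real mat" and u :: "nat \<Rightarrow> 'w \<Rightarrow> real vec"
  assumes a: "a > 1"
    and N: "\<And>n. n \<ge> 1 \<Longrightarrow> a * real n \<le> real (N n)" "\<And>n. n \<ge> 1 \<Longrightarrow> real (N n) \<le> 2 * a * real n"
    and \<alpha>: "0 < \<alpha>" "\<alpha> < 2"
    and law: "heavy_tailed_law \<alpha> D" and symm: "symmetric_law D"
    and X: "\<And>n. n \<ge> 1 \<Longrightarrow> iid_random_matrix (M n) D (N n) n (X n)"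
    and k1: "\<And>n. n \<ge> 1 \<Longrightarrow> 1 \<le> k n" and k: "(\<lambda>n. real (k n) / real n) \<longlonglongrightarrow> 0"
    and u_singular: "\<And>n \<omega>. n \<ge> 1 \<Longrightarrow> \<omega> \<in> space (M n) \<Longrightarrow>
      unit_right_singular_vector (X n \<omega>) (kth_smallest_singular_value (X n \<omega>) (k n)) (u n \<omega>)"
    and \<delta>: "\<delta> > 0" and e: "e > 0"
  shows "(\<lambda>n. measure (M n) {\<omega> \<in> space (M n).
    \<delta> \<le> (\<Sum>j | j < n \<and> \<bar>u n \<omega> $ j\<bar> \<le> 1 / sqrt (e * real n). (u n \<omega> $ j)\<^sup>2)}) \<longlonglongrightarrow> 0"
proof (rule tendstoI)
  fix \<eta> :: real assume \<eta>: "\<eta> > 0"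
  define \<theta> where "\<theta> = (a - 1) / 4"
  have \<theta>: "\<theta> > 0" "1 + 4 * \<theta> = a" using a by (simp_all add: \<theta>_def diff_divide_distrib)
  have a0: "a > 0" using a by simp
  have \<eta>4: "\<eta> / 4 > 0" using \<eta> by simp
  obtain L where L: "0 < L" and rows: "\<forall>n\<ge>1. \<forall>N (M :: 'w measure) X. real N \<le> 2 * a * real n \<longrightarrow>
    iid_random_matrix M D N n X \<longrightarrow>
    {\<omega> \<in> space M. \<theta> * real n < real (card {i \<in> {..<N}. (\<Sum>j<n. (X \<omega> $$ (i, j))\<^sup>2) >
      L * (real n powr (1 / \<alpha>))\<^sup>2})} \<in> sets M \<and>
    measure M {\<omega> \<in> space M. \<theta> * real n < real (card {i \<in> {..<N}. (\<Sum>j<n. (X \<omega> $$ (i, j))\<^sup>2) >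
      L * (real n powr (1 / \<alpha>))\<^sup>2})} \<le> \<eta> / 4"
    using long_rows_rare[OF law \<alpha> a0 \<theta>(1) \<eta>4, where ?'w = 'w] by blast
  \<comment> \<open>Solves 4 a L \<kappa>^2 = \<theta>/2, before \<tau> is known.\<close>
  define \<kappa> where "\<kappa> = sqrt (\<theta> / (8 * a * L))"
  have \<kappa>: "\<kappa> > 0" "4 * a * L * \<kappa>\<^sup>2 \<le> \<theta> / 2" using \<theta> a L by (auto simp: \<kappa>_def)
  define \<kappa>1 where "\<kappa>1 = sqrt (\<delta> / 2)"
  define \<kappa>2 where "\<kappa>2 = 1 / sqrt e"
  define \<zeta> where "\<zeta> = \<delta> * e / 2"
  have pos: "\<kappa>1 / 2 > 0" "\<kappa>2 + 1 > 0" "\<zeta> > 0" "\<theta> > 0" "\<kappa> > 0" "min (1 / \<kappa>) (\<kappa>1 / (2 * \<kappa>)) > 0"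
    using \<delta> e \<theta> \<kappa> by (auto simp: \<kappa>1_def \<kappa>2_def \<zeta>_def intro: add_pos_pos)
  obtain \<tau> E2 where \<tau>: "0 < \<tau>" "\<tau> \<le> min (1 / \<kappa>) (\<kappa>1 / (2 * \<kappa>))"
    and E2: "\<forall>n\<ge>1. E2 n \<in> sets (M n)" "(\<lambda>n. measure (M n) (E2 n)) \<longlonglongrightarrow> 0"
    and net: "\<forall>n\<ge>1. \<forall>\<omega>\<in>space (M n). \<forall>z\<in>lattice_net (2 / (\<kappa> * \<tau>)) n.
      \<zeta> * real n \<le> real (card {j. j < n \<and> \<kappa>1 / 2 \<le> \<bar>\<kappa> * \<tau> * real_of_int (z j)\<bar> \<and>
        \<bar>\<kappa> * \<tau> * real_of_int (z j)\<bar> \<le> \<kappa>2 + 1}) \<longrightarrow>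
      nat \<lceil>(1 + 2 * \<theta>) * real n\<rceil> \<le> card {i \<in> {..<N n}.
        \<bar>\<Sum>j<n. X n \<omega> $$ (i, j) * (\<kappa> * \<tau> * real_of_int (z j))\<bar> \<le> \<tau> * real n powr (1 / \<alpha>)} \<longrightarrow>
      \<omega> \<in> E2 n"
    by (rule exE[OF net_small_rows_tendsto[OF law symm a0 pos N(2) X]], assumption, assumption,
        elim exE conjE, rule that)
  have \<kappa>\<tau>: "\<kappa> * \<tau> \<le> 1" "\<kappa> * \<tau> \<le> \<kappa>1 / 2" using \<tau> \<kappa> by (auto simp: field_simps)
  \<comment> \<open>Gives 2 c^2 = \<theta> \<tau>^2 / 2. That \<open>c\<close> may depend on \<tau>
    relies on the singular value bound being available for every positive \<open>c\<close>.\<close>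
  define c where "c = sqrt (\<theta> / 4) * \<tau>"
  have c: "c > 0" "2 * c\<^sup>2 \<le> \<theta> / 2 * \<tau>\<^sup>2" using \<theta> \<tau> by (auto simp: c_def power_mult_distrib)
  define E1 where "E1 n = {\<omega> \<in> space (M n). \<theta> * real n < real (card {i \<in> {..<N n}. (\<Sum>j<n. (X n \<omega> $$ (i, j))\<^sup>2) >
      L * (real n powr (1 / \<alpha>))\<^sup>2})}" for n
  \<comment> \<open>The factor 1/sqrt 2 matches the trace comparison, which asks for squared column
    norms at most (c b)^2 / 2.\<close>
  define E3 where "E3 n = {\<omega> \<in> space (M n).
    card {j \<in> {..<n}. (\<Sum>i<N n. (X n \<omega> $$ (i, j))\<^sup>2) \<le> (c / sqrt 2 * real n powr (1 / \<alpha>))\<^sup>2} < 2 * k n}" for n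
  have E1: "E1 n \<in> sets (M n)" "measure (M n) (E1 n) \<le> \<eta> / 4" if "n \<ge> 1" for n
    unfolding E1_def using rows[rule_format, OF that N(2)[OF that] X[OF that]]
    by (rule conjunct1, rule conjunct2)
  have E3: "(\<lambda>n. measure (M n) (E3 n)) \<longlonglongrightarrow> 0"
    unfolding E3_def using c by (intro few_small_columns_tendsto[OF law \<alpha> a0 _ N(2) X k]) auto
  have E3m: "E3 n \<in> sets (M n)" if n: "n \<ge> 1" for n
  proof -
    interpret prob_space "M n" using X[OF n] by (simp add: iid_random_matrix_def)
    have "{\<omega> \<in> space (M n). 2 * k n \<le> card {j \<in> {..<n}. (\<Sum>i<N n. (X n \<omega> $$ (i, j))\<^sup>2)
        \<le> (c / sqrt 2 * real n powr (1 / \<alpha>))\<^sup>2}} \<in> events"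
      by (rule count_ge_event[OF _ iid_random_matrix_indep_column_events[OF X[OF n]]]) simp
    hence "space (M n) - {\<omega> \<in> space (M n). 2 * k n \<le>
        card {j \<in> {..<n}. (\<Sum>i<N n. (X n \<omega> $$ (i, j))\<^sup>2) \<le> (c / sqrt 2 * real n powr (1 / \<alpha>))\<^sup>2}} \<in> events"
      by (rule sets.compl_sets)
    also have "space (M n) - {\<omega> \<in> space (M n). 2 * k n \<le>
        card {j \<in> {..<n}. (\<Sum>i<N n. (X n \<omega> $$ (i, j))\<^sup>2) \<le> (c / sqrt 2 * real n powr (1 / \<alpha>))\<^sup>2}} = E3 n"
      by (auto simp: E3_def not_le)
    finally show ?thesis .
  qed
  define B where "B n = {\<omega> \<in> space (M n).
    \<delta> \<le> (\<Sum>j | j < n \<and> \<bar>u n \<omega> $ j\<bar> \<le> 1 / sqrt (e * real n). (u n \<omega> $ j)\<^sup>2)}" for n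
  have sub: "B n \<subseteq> E1 n \<union> (E2 n \<union> E3 n)" if n: "n \<ge> 1" for n
  proof
    fix \<omega> assume B: "\<omega> \<in> B n"
    hence \<omega>: "\<omega> \<in> space (M n)" by (simp add: B_def)
    define b where "b = real n powr (1 / \<alpha>)"
    have b: "b > 0" using n by (simp add: b_def)
    have carrier: "X n \<omega> \<in> carrier_mat (N n) n" using X[OF n] \<omega> by (simp add: iid_random_matrix_def)
    let ?s = "kth_smallest_singular_value (X n \<omega>) (k n)"
    note sv = singular_vector_image_norm[OF carrier u_singular[OF n \<omega>]]
    show "\<omega> \<in> E1 n \<union> (E2 n \<union> E3 n)"
    proof (rule ccontr)
      assume neg: "\<omega> \<notin> E1 n \<union> (E2 n \<union> E3 n)"
      define J where "J = {j \<in> {..<n}. (\<Sum>i<N n. (X n \<omega> $$ (i, j))\<^sup>2) \<le> (c / sqrt 2 * b)\<^sup>2}"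
      have "2 * k n \<le> card J" using neg \<omega> by (simp add: E3_def J_def b_def not_less)
      moreover have "(\<Sum>i<N n. (X n \<omega> $$ (i, j))\<^sup>2) \<le> (c * b)\<^sup>2 / 2" if "j \<in> J" for j
        using that by (simp add: J_def power_mult_distrib power_divide)
      ultimately have "0 \<le> ?s" "?s \<le> c * b"
        using kth_smallest_singular_value_bound[OF carrier _ k1[OF n], of "c * b" J] b c
        by (auto simp: J_def)
      hence "?s\<^sup>2 \<le> (c * b)\<^sup>2" by (intro power_mono) auto
      hence small: "(\<Sum>i<N n. (\<Sum>j<n. X n \<omega> $$ (i, j) * u n \<omega> $ j)\<^sup>2) \<le> (c * b)\<^sup>2" using sv(3) by simp
      have spread: "\<zeta> * real n \<le> real (card {j. j < n \<and> \<kappa>1 \<le> sqrt n * \<bar>u n \<omega> $ j\<bar> \<and> sqrt n * \<bar>u n \<omega> $ j\<bar> \<le> \<kappa>2})"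
        unfolding \<zeta>_def \<kappa>1_def \<kappa>2_def using B by (intro spread_of_mass[OF n e \<delta>]) (simp add: B_def)
      have bad: "real (card {i \<in> {..<N n}. (\<Sum>j<n. (X n \<omega> $$ (i, j))\<^sup>2) > L * b\<^sup>2}) \<le> \<theta> * real n"
        using neg \<omega> by (simp add: E1_def b_def not_less)
      have N4: "(1 + 4 * \<theta>) * real n \<le> real (N n)" using N(1)[OF n] \<theta> by simp
      have "\<omega> \<in> E2 n"
        using net n \<omega> spread_vector_rounding[where A = "\<lambda>i j. X n \<omega> $$ (i, j)", OF N4 N(2)[OF n] sv(2) spread
          \<kappa>(1) \<tau>(1) L b \<kappa>\<tau> \<kappa>(2) c(2) bad small] unfolding b_def by blast
      thus False using neg by simp
    qed
  qed
  have "\<forall>\<^sub>F n in sequentially. measure (M n) (E2 n) < \<eta> / 4"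
    using \<eta> by (intro order_tendstoD(2)[OF E2(2)]) simp
  moreover have "\<forall>\<^sub>F n in sequentially. measure (M n) (E3 n) < \<eta> / 4"
    using \<eta> by (intro order_tendstoD(2)[OF E3]) simp
  ultimately show "\<forall>\<^sub>F n in sequentially. dist (measure (M n) {\<omega> \<in> space (M n).
    \<delta> \<le> (\<Sum>j | j < n \<and> \<bar>u n \<omega> $ j\<bar> \<le> 1 / sqrt (e * real n). (u n \<omega> $ j)\<^sup>2)}) 0 < \<eta>"
    using eventually_ge_at_top[of 1]
  proof eventually_elim
    case (elim n)
    interpret prob_space "M n" using X[OF elim(3)] by (simp add: iid_random_matrix_def)
    have m: "E1 n \<in> events" "E2 n \<in> events" "E3 n \<in> events"
      using E1(1) E2(1) E3m elim by auto
    \<comment> \<open>Monotonicity asks for measurability of the larger set, so \<open>B n\<close>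
      itself need not be shown measurable.\<close>
    have "prob (B n) \<le> prob (E1 n \<union> (E2 n \<union> E3 n))"
      using m by (intro finite_measure_mono sub elim) auto
    also have "\<dots> \<le> prob (E1 n) + prob (E2 n \<union> E3 n)"
      using m by (intro measure_Un_le) auto
    finally have "prob (B n) \<le> prob (E1 n) + prob (E2 n \<union> E3 n)" .
    moreover have "prob (E2 n \<union> E3 n) \<le> prob (E2 n) + prob (E3 n)"
      using m by (intro measure_Un_le) auto
    ultimately have "prob (B n) < \<eta>" using E1(2)[OF elim(3)] elim(1,2) \<eta> by linarith
    thus ?case by (simp add: B_def)
  qed
qed

section \<open>The set of small coordinates and the conclusion\<close>

lemma l2_norm_subvec:
  fixes v :: "real vec"
  assumes v: "v \<in> carrier_vec n" and J: "J \<subseteq> {..<n}"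
  shows "l2_norm_vec (subvec v J) = sqrt (\<Sum>j\<in>J. (v $ j)\<^sup>2)"
proof -
  have eq: "{i. i < dim_vec v \<and> i \<in> J} = J" using v J by auto
  have fin: "finite J" using J finite_subset by blast
  have "bij_betw (pick J) {..<card J} J"
  proof (rule bij_betwI')
    fix x y assume "x \<in> {..<card J}" "y \<in> {..<card J}"
    thus "(pick J x = pick J y) = (x = y)"
      using pick_mono_le[of x J y] pick_mono_le[of y J x] by (cases x y rule: linorder_cases) auto
  next
    fix x assume "x \<in> {..<card J}"
    thus "pick J x \<in> J" using pick_in_set_le by auto
  next
    fix y assume y: "y \<in> J"
    have "{a \<in> J. a < y} \<subset> J" using y by auto
    hence "card {a \<in> J. a < y} < card J" using fin by (rule psubset_card_mono[rotated])
    thus "\<exists>x\<in>{..<card J}. y = pick J x" using pick_card_in_set[OF y] by (metis lessThan_iff)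
  qed
  hence "(\<Sum>i<card J. (v $ pick J i)\<^sup>2) = (\<Sum>j\<in>J. (v $ j)\<^sup>2)"
    by (rule sum.reindex_bij_betw)
  thus ?thesis
    by (simp add: l2_norm_vec_def subvec_def eq scalar_prod_def atLeast0LessThan power2_eq_square)
qed

text \<open>Chebyshev: each excluded coordinate has square at least 1/(e n), and the squares sum to
  1, so at most e n are excluded.\<close>

lemma card_small_coordinates:
  fixes v :: "nat \<Rightarrow> real"
  assumes n: "n \<ge> 1" and e: "e > 0" and unit: "(\<Sum>j<n. (v j)\<^sup>2) = 1"
  shows "real n - e * real n \<le> real (card {j. j < n \<and> \<bar>v j\<bar> \<le> 1 / sqrt (e * real n)})"
proof -
  define S where "S = {j. j < n \<and> \<bar>v j\<bar> \<le> 1 / sqrt (e * real n)}"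
  have S: "S \<subseteq> {..<n}" by (auto simp: S_def)
  have "real (card ({..<n} - S)) * (1 / (e * real n)) = (\<Sum>j\<in>{..<n} - S. 1 / (e * real n))" by simp
  also have "\<dots> \<le> (\<Sum>j\<in>{..<n} - S. (v j)\<^sup>2)"
  proof (rule sum_mono)
    fix j assume "j \<in> {..<n} - S"
    hence "1 / sqrt (e * real n) \<le> \<bar>v j\<bar>" by (auto simp: S_def)
    hence "(1 / sqrt (e * real n))\<^sup>2 \<le> \<bar>v j\<bar>\<^sup>2" using n e by (intro power_mono) auto
    thus "1 / (e * real n) \<le> (v j)\<^sup>2" using e by (simp add: power_divide)
  qed
  also have "\<dots> \<le> (\<Sum>j<n. (v j)\<^sup>2)" by (intro sum_mono2) auto
  finally have "real (card ({..<n} - S)) \<le> e * real n" using unit n e by (simp add: field_simps)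
  moreover have "card ({..<n} - S) = n - card S" using S by (subst card_Diff_subset) (auto intro: finite_subset)
  moreover have "card S \<le> n" using card_mono[OF _ S] by simp
  ultimately show ?thesis by (simp add: S_def)
qed

text \<open>|J| = n - o(n) is rendered by a deterministic \<open>r\<close> in o(n) bounding the
  number of dropped coordinates for every outcome, not merely with high probability.
  \<open>J n\<close> sees the outcome through \<open>u n \<omega>\<close> alone. If a singular value
  is multiple, \<open>u\<close> is any measurable choice of a singular vector.\<close>

theorem corollary1p9:
  fixes a \<alpha> \<bb> :: real
    and D :: "real measure"
    and M :: "nat \<Rightarrow> 'w measure"
    and N k :: "nat \<Rightarrow> nat"
    and X :: "nat \<Rightarrow> 'w \<Rightarrow> real mat"
    and u :: "nat \<Rightarrow> 'w \<Rightarrow> real vec"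
  assumes a: "a > 1"
    and N: "\<And>n. N n = nat \<lceil>a * real n\<rceil>"
    and \<alpha>: "0 < \<alpha>" "\<alpha> < 2"
    and tail: "heavy_tailed_law \<alpha> D"
    and symm: "symmetric_law D"
    and X: "\<And>n. n \<ge> 1 \<Longrightarrow> iid_random_matrix (M n) D (N n) n (X n)"
    and \<bb>: "0 < \<bb>" "\<bb> < 1 / 2"
    and k_range: "\<And>n. n \<ge> 1 \<Longrightarrow> 1 \<le> k n \<and> k n \<le> n"
    and k_growth: "(\<lambda>n. real (k n)) \<in> O(\<lambda>n. real n powr (1 - 2 * \<bb>))"
    and u_random: "\<And>n. n \<ge> 1 \<Longrightarrow> random_vec (M n) n (u n)"
    and u_singular: "\<And>n \<omega>. n \<ge> 1 \<Longrightarrow> \<omega> \<in> space (M n) \<Longrightarrow>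
      unit_right_singular_vector (X n \<omega>) (kth_smallest_singular_value (X n \<omega>) (k n)) (u n \<omega>)"
  shows "\<forall>\<delta> > 0. \<exists>(J :: nat \<Rightarrow> real vec \<Rightarrow> nat set) (r :: nat \<Rightarrow> real).
    r \<in> o(\<lambda>n. real n) \<and>
    (\<forall>n \<ge> 1. (\<lambda>\<omega>. J n (u n \<omega>)) \<in> M n \<rightarrow>\<^sub>M count_space UNIV \<and>
       (\<forall>\<omega> \<in> space (M n). J n (u n \<omega>) \<subseteq> {..<n} \<and>
          real (card (J n (u n \<omega>))) \<ge> real n - r n)) \<and>
    (\<lambda>n. measure (M n)
       {\<omega> \<in> space (M n). l2_norm_vec (subvec (u n \<omega>) (J n (u n \<omega>))) < sqrt \<delta>}) \<longlonglongrightarrow> 1"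
proof (intro allI impI)
  fix \<delta> :: real assume \<delta>: "\<delta> > 0"
  have a0: "a > 0" using a by simp
  have N1: "a * real n \<le> real (N n)" for n unfolding N by (rule real_nat_ceiling_ge)
  have N2: "real (N n) \<le> 2 * a * real n" if "n \<ge> 1" for n
  proof -
    have "real (N n) \<le> a * real n + 1" unfolding N using a0 by (simp add: of_nat_nat)
    moreover have "1 * 1 \<le> a * real n" using a that by (intro mult_mono) auto
    ultimately show ?thesis by simp
  qed
  have k_lim: "(\<lambda>n. real (k n) / real n) \<longlonglongrightarrow> 0"
  proof -
    have "(\<lambda>n. real n powr (1 - 2 * \<bb>)) \<in> o(\<lambda>n. real n)"
      using \<bb> by real_asymp
    with k_growth have "(\<lambda>n. real (k n)) \<in> o(\<lambda>n. real n)" by (rule landau_o.big_small_trans)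
    thus ?thesis by (rule smalloD_tendsto)
  qed
  define P where "P e n = measure (M n) {\<omega> \<in> space (M n).
    \<delta> \<le> (\<Sum>j | j < n \<and> \<bar>u n \<omega> $ j\<bar> \<le> 1 / sqrt (e * real n). (u n \<omega> $ j)\<^sup>2)}" for e n
  have "(\<lambda>n. P (1 / real (Suc m)) n) \<longlonglongrightarrow> 0" for m
    unfolding P_def
    by (rule delocalized_mass_tendsto[OF a N1 N2 \<alpha> tail symm X _ k_lim u_singular \<delta>])
      (use k_range in auto)
  then obtain g where g: "filterlim g at_top sequentially" "(\<lambda>n. P (1 / real (Suc (g n))) n) \<longlonglongrightarrow> 0"
    by (rule diagonal_null_sequence)
  \<comment> \<open>It tends to 0, which puts \<open>r\<close> into o(n), yet so slowly that the
    failure probability \<open>P (e n) n\<close> still tends to 0.\<close>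
  define e where "e n = 1 / real (Suc (g n))" for n
  have e: "e n > 0" for n by (simp add: e_def)
  have e_lim: "e \<longlonglongrightarrow> 0"
    unfolding e_def by (rule filterlim_compose[OF LIMSEQ_Suc[OF lim_1_over_n] g(1)])
  define J where "J n v = {j. j < n \<and> \<bar>v $ j\<bar> \<le> 1 / sqrt (e n * real n)}" for n and v :: "real vec"
  define r where "r n = e n * real n" for n
  have r: "r \<in> o(\<lambda>n. real n)"
  proof (rule smalloI_tendsto)
    have "\<forall>\<^sub>F n in sequentially. e n = r n / real n"
      using eventually_gt_at_top[of 0] by eventually_elim (simp add: r_def)
    thus "(\<lambda>n. r n / real n) \<longlonglongrightarrow> 0" using e_lim by (rule Lim_transform_eventually[rotated])
    show "\<forall>\<^sub>F n in sequentially. real n \<noteq> 0" using eventually_gt_at_top[of 0] by eventually_elim simp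
  qed
  have J_sub: "J n v \<subseteq> {..<n}" for n v by (auto simp: J_def)
  have unit: "u n \<omega> \<in> carrier_vec n" "(\<Sum>j<n. (u n \<omega> $ j)\<^sup>2) = 1" if "n \<ge> 1" "\<omega> \<in> space (M n)" for n \<omega>
  proof -
    have "X n \<omega> \<in> carrier_mat (N n) n" using X[OF that(1)] that(2) by (simp add: iid_random_matrix_def)
    from singular_vector_image_norm(1,2)[OF this u_singular[OF that]]
    show "u n \<omega> \<in> carrier_vec n" "(\<Sum>j<n. (u n \<omega> $ j)\<^sup>2) = 1" .
  qed
  have J_meas: "(\<lambda>\<omega>. J n (u n \<omega>)) \<in> M n \<rightarrow>\<^sub>M count_space UNIV" if n: "n \<ge> 1" for n
  proof -
    have um[measurable]: "(\<lambda>\<omega>. u n \<omega> $ j) \<in> borel_measurable (M n)" if "j < n" for j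
      using u_random[OF n] that by (simp add: random_vec_def)
    have fin: "finite (Pow {..<n})" by simp
    \<comment> \<open>\<open>J\<close> takes finitely many values, so measurability reduces to its
      fibres, each a finite combination of conditions on single coordinates; enlarging the target to
      all sets of naturals comes afterwards.\<close>
    have J_Pow: "(\<lambda>\<omega>. J n (u n \<omega>)) \<in> M n \<rightarrow>\<^sub>M count_space (Pow {..<n})"
    proof (subst measurable_count_space_eq2[OF fin], intro conjI ballI)
      show "(\<lambda>\<omega>. J n (u n \<omega>)) \<in> space (M n) \<rightarrow> Pow {..<n}" using J_sub by auto
      fix S assume S: "S \<in> Pow {..<n}"
      have "(\<lambda>\<omega>. J n (u n \<omega>)) -` {S} \<inter> space (M n) =
          {\<omega> \<in> space (M n). \<forall>j\<in>{..<n}. j \<in> S \<longleftrightarrow> \<bar>u n \<omega> $ j\<bar> \<le> 1 / sqrt (e n * real n)}"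
        using S by (auto simp: J_def)
      also have "\<dots> \<in> sets (M n)"
      proof (rule sets.sets_Collect_finite_All)
        fix j assume j: "j \<in> {..<n}"
        have le: "{\<omega> \<in> space (M n). \<bar>u n \<omega> $ j\<bar> \<le> 1 / sqrt (e n * real n)} \<in> sets (M n)"
          using um[of j] j by simp
        have nle: "{\<omega> \<in> space (M n). \<not> \<bar>u n \<omega> $ j\<bar> \<le> 1 / sqrt (e n * real n)} \<in> sets (M n)"
          using um[of j] j by simp
        show "{\<omega> \<in> space (M n). j \<in> S \<longleftrightarrow> \<bar>u n \<omega> $ j\<bar> \<le> 1 / sqrt (e n * real n)} \<in> sets (M n)"
        proof (cases "j \<in> S")
          case True
          show ?thesis using le by (simp only: True simp_thms)
        next
          case False
          show ?thesis using nle by (simp only: False simp_thms)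
        qed
      qed simp
      finally show "(\<lambda>\<omega>. J n (u n \<omega>)) -` {S} \<inter> space (M n) \<in> sets (M n)" .
    qed
    have "(\<lambda>S. S) \<in> count_space (Pow {..<n}) \<rightarrow>\<^sub>M count_space UNIV"
      by (rule measurable_count_space)
    with J_Pow show ?thesis by (rule measurable_compose)
  qed
  have lim: "(\<lambda>n. measure (M n)
       {\<omega> \<in> space (M n). l2_norm_vec (subvec (u n \<omega>) (J n (u n \<omega>))) < sqrt \<delta>}) \<longlonglongrightarrow> 1"
  proof (rule Lim_transform_eventually)
    show "(\<lambda>n. 1 - P (e n) n) \<longlonglongrightarrow> 1"
      using tendsto_diff[OF tendsto_const[of 1] g(2)] by (simp add: e_def)
    show "\<forall>\<^sub>F n in sequentially. 1 - P (e n) n = measure (M n)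
       {\<omega> \<in> space (M n). l2_norm_vec (subvec (u n \<omega>) (J n (u n \<omega>))) < sqrt \<delta>}"
      using eventually_ge_at_top[of 1]
    proof eventually_elim
      case (elim n)
      interpret prob_space "M n" using X[OF elim] by (simp add: iid_random_matrix_def)
      have um: "(\<lambda>\<omega>. u n \<omega> $ j) \<in> borel_measurable (M n)" if "j < n" for j
        using u_random[OF elim] that by (simp add: random_vec_def)
      define Q where "Q \<omega> = (\<Sum>j\<in>J n (u n \<omega>). (u n \<omega> $ j)\<^sup>2)" for \<omega>
      have "Q \<omega> = (\<Sum>j<n. if \<bar>u n \<omega> $ j\<bar> \<le> 1 / sqrt (e n * real n) then (u n \<omega> $ j)\<^sup>2 else 0)" for \<omega>
        unfolding Q_def J_def by (simp add: sum.If_cases Int_def)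
      moreover have "(\<lambda>\<omega>. \<Sum>j<n. if \<bar>u n \<omega> $ j\<bar> \<le> 1 / sqrt (e n * real n) then (u n \<omega> $ j)\<^sup>2 else 0) \<in> borel_measurable (M n)"
        using um by measurable
      ultimately have Q: "Q \<in> borel_measurable (M n)" by presburger
      have ev: "{\<omega> \<in> space (M n). \<delta> \<le> Q \<omega>} \<in> events" using Q unfolding borel_measurable_iff_ge by blast
      have "{\<omega> \<in> space (M n). l2_norm_vec (subvec (u n \<omega>) (J n (u n \<omega>))) < sqrt \<delta>} =
          space (M n) - {\<omega> \<in> space (M n). \<delta> \<le> Q \<omega>}"
        using unit(1)[OF elim] by (auto simp: l2_norm_subvec[OF _ J_sub] Q_def)
      moreover have "prob (space (M n) - {\<omega> \<in> space (M n). \<delta> \<le> Q \<omega>}) = 1 - prob {\<omega> \<in> space (M n). \<delta> \<le> Q \<omega>}"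
        by (rule prob_compl[OF ev])
      ultimately show ?case by (simp add: P_def Q_def J_def)
    qed
  qed
  show "\<exists>(J :: nat \<Rightarrow> real vec \<Rightarrow> nat set) (r :: nat \<Rightarrow> real).
    r \<in> o(\<lambda>n. real n) \<and>
    (\<forall>n \<ge> 1. (\<lambda>\<omega>. J n (u n \<omega>)) \<in> M n \<rightarrow>\<^sub>M count_space UNIV \<and>
       (\<forall>\<omega> \<in> space (M n). J n (u n \<omega>) \<subseteq> {..<n} \<and>
          real (card (J n (u n \<omega>))) \<ge> real n - r n)) \<and>
    (\<lambda>n. measure (M n)
       {\<omega> \<in> space (M n). l2_norm_vec (subvec (u n \<omega>) (J n (u n \<omega>))) < sqrt \<delta>}) \<longlonglongrightarrow> 1"
  proof (rule exI[of _ J], rule exI[of _ r], intro conjI allI impI ballI)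
    fix n :: nat and \<omega> assume "1 \<le> n" "\<omega> \<in> space (M n)"
    thus "real n - r n \<le> real (card (J n (u n \<omega>)))"
      unfolding J_def r_def by (intro card_small_coordinates unit e)
  qed (use r J_meas J_sub lim in auto)
qed

end
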